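(* The model checking problem for $\mathsf{FPL}_0$ is in $\mathsf{LOGCFL}$.
   Context: Intuitionistic formulas: $\varphi ::= \bot \mid p \mid \varphi\wedge\varphi \mid \varphi\vee\varphi \mid \varphi\Rightarrow\varphi$. A model for $\mathsf{FPL}$ is $(U,\triangleleft,\xi)$ with $U$ finite nonempty, $\triangleleft$ transitive and irreflexive, $\xi$ monotone ($a\in\xi(p)$, $a\triangleleft b$ imply $b\in\xi(p)$). Satisfaction: $s\not\models\bot$; $s\models p$ iff $s\in\xi(p)$; $\wedge,\vee$ pointwise; $s\models\varphi\Rightarrow\psi$ iff for all $n$ with $s\triangleleft n$, $n\models\varphi$ implies $n\models\psi$. $\mathsf{FPL}_0$ denotes the variable-free formulas. The model checking problem: given a variable-free formula $\varphi$, a finite $\mathsf{FPL}$ model $\mathfrak{M}$ (relation given by adjacency matrix) and a state $s$, decide whether $\mathfrak{M},s\models\varphi$. $\mathsf{LOGCFL}$ is the class of languages logspace many-one reducible to context-free languages, equivalently decidable by nondeterministic polynomial-time logarithmic-space Turing machines with an additional stack. *)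

theory Defs
  imports Complex_Main "HOL-Library.Landau_Symbols"
begin

section \<open>The logic FPL\<close>

datatype (vars: 'p) form =
    Bot
  | Var 'p
  | Conj "'p form" "'p form"
  | Disj "'p form" "'p form"
  | Imp "'p form" "'p form"

record ('w, 'p) model =
  worlds :: "'w set"
  acc :: "('w \<times> 'w) set"
  val :: "'p \<Rightarrow> 'w set"

definition FPL_model :: "('w, 'p) model \<Rightarrow> bool" where
  "FPL_model M \<longleftrightarrow>
     finite (worlds M) \<and> worlds M \<noteq> {} \<and>
     acc M \<subseteq> worlds M \<times> worlds M \<and> trans (acc M) \<and> irrefl (acc M) \<and>
     (\<forall>p. val M p \<subseteq> worlds M) \<and>
     (\<forall>p a b. a \<in> val M p \<longrightarrow> (a, b) \<in> acc M \<longrightarrow> b \<in> val M p)"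

primrec sat :: "('w, 'p) model \<Rightarrow> 'w \<Rightarrow> 'p form \<Rightarrow> bool" where
  "sat M s Bot \<longleftrightarrow> False"
| "sat M s (Var p) \<longleftrightarrow> s \<in> val M p"
| "sat M s (Conj \<phi> \<psi>) \<longleftrightarrow> sat M s \<phi> \<and> sat M s \<psi>"
| "sat M s (Disj \<phi> \<psi>) \<longleftrightarrow> sat M s \<phi> \<or> sat M s \<psi>"
| "sat M s (Imp \<phi> \<psi>) \<longleftrightarrow> (\<forall>n. (s, n) \<in> acc M \<longrightarrow> sat M n \<phi> \<longrightarrow> sat M n \<psi>)"

definition FPL0 :: "nat form set" where
  "FPL0 = {\<phi>. vars \<phi> = {}}"


section \<open>The model checking problem as a language\<close>

datatype letter =
  LBot | LVar | LAnd | LOr | LImp | LOpen | LClose | LZero | LOne | LSemi | LHash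

instance letter :: finite
proof
  have "(UNIV :: letter set) =
    {LBot, LVar, LAnd, LOr, LImp, LOpen, LClose, LZero, LOne, LSemi, LHash}"
    using letter.exhaust by blast
  then show "finite (UNIV :: letter set)"
    by (metis finite.emptyI finite.insertI)
qed

text \<open>Formulas are written in fully parenthesised infix notation, the variable with index
  \<open>p\<close> being followed by \<open>p\<close> ones.\<close>

primrec enc_form :: "nat form \<Rightarrow> letter list" where
  "enc_form Bot = [LBot]"
| "enc_form (Var p) = LVar # replicate p LOne"
| "enc_form (Conj \<phi> \<psi>) = [LOpen] @ enc_form \<phi> @ [LAnd] @ enc_form \<psi> @ [LClose]"
| "enc_form (Disj \<phi> \<psi>) = [LOpen] @ enc_form \<phi> @ [LOr] @ enc_form \<psi> @ [LClose]"
| "enc_form (Imp \<phi> \<psi>) = [LOpen] @ enc_form \<phi> @ [LImp] @ enc_form \<psi> @ [LClose]"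

definition enc_row :: "nat \<Rightarrow> nat set \<Rightarrow> letter list" where
  "enc_row n X = map (\<lambda>b. if b \<in> X then LOne else LZero) [0..<n] @ [LSemi]"

text \<open>An instance consists of a formula, a model with worlds \<open>0, \<dots>, n - 1\<close> whose valuation is
  empty on all variables with index \<open>\<ge> m\<close> (so that it is a finite object), and a world \<open>s\<close>.
  It is written as the formula, the \<open>n \<times> n\<close> adjacency matrix of the accessibility relation,
  the \<open>m \<times> n\<close> matrix of the valuation, and \<open>s\<close> in unary, separated by \<open>LHash\<close>.  Since
  \<open>s < n\<close>, unary notation does not affect the order of magnitude of the length.\<close>

definition enc_instance :: "nat form \<Rightarrow> nat \<Rightarrow> nat \<Rightarrow> (nat, nat) model \<Rightarrow> nat \<Rightarrow> letter list" where
  "enc_instance \<phi> n m M s =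
     enc_form \<phi> @ [LHash] @
     concat (map (\<lambda>a. enc_row n {b. (a, b) \<in> acc M}) [0..<n]) @ [LHash] @
     concat (map (\<lambda>p. enc_row n (val M p)) [0..<m]) @ [LHash] @
     replicate s LOne"

definition model_checking :: "nat form set \<Rightarrow> letter list set" where
  "model_checking F =
     {enc_instance \<phi> n m M s | \<phi> n m M s.
        \<phi> \<in> F \<and> FPL_model M \<and> worlds M = {..<n} \<and> (\<forall>p\<ge>m. val M p = {}) \<and>
        s \<in> worlds M \<and> sat M s \<phi>}"


section \<open>Context-free languages\<close>

datatype ('n, 't) gsym = Nt 'n | Tm 't

type_synonym ('n, 't) prods = "('n \<times> ('n, 't) gsym list) set"

inductive derives1 :: "('n, 't) prods \<Rightarrow> ('n, 't) gsym list \<Rightarrow> ('n, 't) gsym list \<Rightarrow> bool"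
  for P :: "('n, 't) prods" where
  "(A, \<alpha>) \<in> P \<Longrightarrow> derives1 P (u @ [Nt A] @ v) (u @ \<alpha> @ v)"

definition cfg_lang :: "('n, 't) prods \<Rightarrow> 'n \<Rightarrow> 't list set" where
  "cfg_lang P A = {w. (derives1 P)\<^sup>*\<^sup>* [Nt A] (map Tm w)}"

text \<open>A grammar uses finitely many nonterminals, so they may be taken to be natural numbers.\<close>

definition context_free :: "'t list set \<Rightarrow> bool" where
  "context_free L \<longleftrightarrow> (\<exists>(P :: (nat, 't) prods) A. finite P \<and> L = cfg_lang P A)"


section \<open>Logarithmic-space computable functions\<close>

text \<open>Deterministic Turing machines with a two-way read-only input tape, \<open>work_tapes T\<close> one-way
  infinite read-write work tapes and a write-only output tape.  States, work tape symbols and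
  output symbols are natural numbers; the blank is \<open>0\<close>.\<close>

datatype move = MLeft | MStay | MRight

datatype 'a cell = LeftEnd | RightEnd | Input 'a

record 'a transducer =
  states :: "nat set"
  start :: nat
  halting :: "nat set"
  work_tapes :: nat
  work_symbols :: "nat set"
  delta :: "nat \<Rightarrow> 'a cell \<Rightarrow> nat list \<Rightarrow> nat \<times> move \<times> (nat \<times> move) list \<times> nat option"

definition wf_transducer :: "'a transducer \<Rightarrow> bool" where
  "wf_transducer T \<longleftrightarrow>
     finite (states T) \<and> start T \<in> states T \<and> halting T \<subseteq> states T \<and>
     finite (work_symbols T) \<and> 0 \<in> work_symbols T \<and>
     (\<forall>q c ys q' d acts out.
        q \<in> states T - halting T \<longrightarrow> length ys = work_tapes T \<longrightarrow> set ys \<subseteq> work_symbols T \<longrightarrow>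
        delta T q c ys = (q', d, acts, out) \<longrightarrow>
        q' \<in> states T \<and> length acts = work_tapes T \<and> fst ` set acts \<subseteq> work_symbols T)"

record config =
  state :: nat
  in_head :: nat
  works :: "((nat \<Rightarrow> nat) \<times> nat) list" \<comment> \<open>contents and head position of each work tape\<close>
  emitted :: "nat list"

fun move_head :: "move \<Rightarrow> nat \<Rightarrow> nat" where
  "move_head MLeft i = i - 1"
| "move_head MStay i = i"
| "move_head MRight i = Suc i"

text \<open>The input occupies cells \<open>1, \<dots>, length x\<close>, between two end markers which the input head
  does not pass.\<close>

definition in_cell :: "'a list \<Rightarrow> nat \<Rightarrow> 'a cell" where
  "in_cell x i = (if i = 0 then LeftEnd
                  else if i \<le> length x then Input (x ! (i - 1)) else RightEnd)"

fun act :: "nat \<times> move \<Rightarrow> (nat \<Rightarrow> nat) \<times> nat \<Rightarrow> (nat \<Rightarrow> nat) \<times> nat" where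
  "act (y, d) (w, i) = (w(i := y), move_head d i)"

definition initial :: "'a transducer \<Rightarrow> config" where
  "initial T = \<lparr>state = start T, in_head = 0,
                works = replicate (work_tapes T) (\<lambda>_. 0, 0), emitted = []\<rparr>"

definition step :: "'a transducer \<Rightarrow> 'a list \<Rightarrow> config \<Rightarrow> config" where
  "step T x c =
     (if state c \<in> halting T then c
      else case delta T (state c) (in_cell x (in_head c)) (map (\<lambda>(w, i). w i) (works c)) of
        (q, d, acts, out) \<Rightarrow>
          \<lparr>state = q,
           in_head = min (move_head d (in_head c)) (Suc (length x)),
           works = map2 act acts (works c),
           emitted = emitted c @ (case out of None \<Rightarrow> [] | Some y \<Rightarrow> [y])\<rparr>)"

definition run :: "'a transducer \<Rightarrow> 'a list \<Rightarrow> nat \<Rightarrow> config" where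
  "run T x t = (step T x ^^ t) (initial T)"

definition computes :: "'a transducer \<Rightarrow> ('a list \<Rightarrow> nat list) \<Rightarrow> bool" where
  "computes T f \<longleftrightarrow> (\<forall>x. \<exists>t. state (run T x t) \<in> halting T \<and> emitted (run T x t) = f x)"

text \<open>Heads start in cell \<open>0\<close> and move by at most one cell per step, so the cells of a work tape
  visited during a computation are those up to the largest head position.  Only work tapes are
  charged for space.\<close>

definition runs_in_space :: "'a transducer \<Rightarrow> (nat \<Rightarrow> nat) \<Rightarrow> bool" where
  "runs_in_space T S \<longleftrightarrow>
     (\<forall>x t. \<forall>(w, i) \<in> set (works (run T x t)). i < S (length x))"

definition logspace_computable :: "('a::finite list \<Rightarrow> nat list) \<Rightarrow> bool" where
  "logspace_computable f \<longleftrightarrow>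
     (\<exists>T S. wf_transducer T \<and> computes T f \<and> runs_in_space T S \<and>
            (\<lambda>n. real (S n)) \<in> O(\<lambda>n. ln (real n)))"


section \<open>The class LOGCFL\<close>

text \<open>The terminal symbols of a context-free language form a finite set and may be taken to be
  natural numbers.\<close>

definition LOGCFL :: "'a::finite list set set" where
  "LOGCFL =
     {A. \<exists>f (B :: nat list set).
           logspace_computable f \<and> context_free B \<and> (\<forall>x. x \<in> A \<longleftrightarrow> f x \<in> B)}"

end

theory Submission
  imports Defs "HOL-Library.Countable"
begin

text \<open>Let \<open>N d\<close> be the set of worlds that start a chain of \<open>d\<close> steps.  On a variable-free formula
  \<open>\<phi>\<close>, satisfaction at \<open>a\<close> amounts to \<open>a \<notin> N r\<close>, where the number \<open>r\<close> is computed from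
  \<open>\<phi>\<close> by minimum, maximum and \<open>r\<^sub>1 \<Rightarrow> r\<^sub>2 = (if r\<^sub>1 \<le> r\<^sub>2 then \<infinity> else r\<^sub>2 + 1)\<close>.
  Non-membership in \<open>N r\<close> is a coNL condition; it gets short certificates by inductive counting
  of the cardinalities of \<open>N 0, N 1, \<dots>\<close> as in the theorem of Immerman and Szelepcsenyi.
  Parsing the input, computing \<open>r\<close> and counting are expressed by Horn rules over positions of the
  input, with derivation trees of polynomial size.

  Such a rule system is reduced to a context-free language as follows.  A rule instance becomes
  the word that pops the code of the head from a stack and pushes the codes of the bodies.  The
  output lists all rule instances, polynomially many times over, and the language consists of the
  words from which segments can be deleted to leave a balanced bracket word.  The output is
  produced by an odometer of binary counters, whose values are the variables of the rules.\<close>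

text \<open>The rank rule for implication rests on \<open>high_exact_successor\<close>: in a finite
  transitive irreflexive relation, a world that starts a chain of d + 1 steps sees a world whose
  longest chain has exactly d steps. Truth of a variable-free formula therefore depends only on the
  length of the longest chain, and the formula acts as a threshold on it, a number that fits into
  one counter.

  Horn derivations are trees: a fact is derived anew at each use. Inductive counting would become
  exponential if every non-membership certificate contained a derivation of the count on the
  previous level. So \<open>Avoid\<close> merely carries the claimed count as an argument, and
  \<open>CountTo\<close> threads a single derivation of that count through all worlds; the costs of
  the levels then add up instead of multiplying.

  The output lists the rule instances in an order fixed by the counters, whereas a derivation uses
  them in its own order. Repetition resolves this: each round of the odometer offers all instances,
  and one node of the derivation is replayed per round, so polynomially many rounds suffice for a
  tree of polynomial size.\<close>

section \<open>An odometer with logarithmic space\<close>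

text \<open>The recursion mirrors the machine's counter: a new binary digit appears exactly when
  incrementing a register full of ones overflows.\<close>

primrec bitlength :: "nat \<Rightarrow> nat" where
  "bitlength 0 = 0"
| "bitlength (Suc j) = (if Suc j = 2 ^ bitlength j then Suc (bitlength j) else bitlength j)"

lemma less_bitlength: "j < 2 ^ bitlength j"
  by (induction j) auto

lemma bitlength_lower: "j > 0 \<Longrightarrow> 2 ^ bitlength j \<le> 2 * j"
proof (induction j)
  case (Suc j)
  then show ?case by (cases "j = 0") auto
qed simp

lemma bitlength_mono: "i \<le> j \<Longrightarrow> bitlength i \<le> bitlength j"
  by (rule lift_Suc_mono_le[of bitlength]) auto

definition nbit :: "nat \<Rightarrow> nat \<Rightarrow> nat" where
  "nbit v i = v div 2 ^ i mod 2"

definition bits :: "nat \<Rightarrow> nat \<Rightarrow> nat list" where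
  "bits l v = map (nbit v) [0..<l]"

lemma nbit_less_2: "nbit v i < 2"
  by (simp add: nbit_def)

lemma nbit_mod: "i < l \<Longrightarrow> nbit (v mod 2 ^ l) i = nbit v i"
proof -
  assume "i < l"
  then have "bit (take_bit l v) i = bit v i"
    by (simp add: bit_take_bit_iff)
  then show ?thesis
    by (simp add: nbit_def bit_iff_odd take_bit_eq_mod mod2_eq_if)
qed

text \<open>Divisibility of \<open>Suc v\<close> by \<open>2 ^ h\<close> means that the lowest h
  bits of v are all 1, that is, that adding 1 to v sends a carry into position h. The increment
  loops below express their carry in this form.\<close>

lemma dvd_Suc_power_2:
  "2 ^ Suc h dvd Suc v \<longleftrightarrow> 2 ^ h dvd Suc v \<and> nbit v h = 1"
proof (cases "2 ^ h dvd Suc v")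
  case True
  then obtain m where m: "Suc v = 2 ^ h * m" ..
  then obtain m' where m': "m = Suc m'" by (cases m) auto
  obtain r :: nat where r: "2 ^ h = Suc r"
    by (metis not0_implies_Suc power_not_zero zero_neq_numeral)
  have "v = r + 2 ^ h * m'" using m m' r by simp
  then have "v div 2 ^ h = m'" using r by (simp del: mult_Suc)
  moreover have "2 ^ Suc h dvd Suc v \<longleftrightarrow> even m"
    unfolding m by (simp add: mult.commute)
  ultimately show ?thesis
    using True m' by (auto simp: nbit_def mod_2_eq_odd)
next
  case False
  then show ?thesis
    using dvd_trans[of "2 ^ h" "2 ^ Suc h" "Suc v"] by auto
qed

lemma nbit_Suc:
  "nbit (Suc v) h = (if 2 ^ h dvd Suc v then 1 - nbit v h else nbit v h)"
proof -
  have "Suc v div 2 ^ h = (if 2 ^ h dvd Suc v then Suc (v div 2 ^ h) else v div 2 ^ h)"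
    by (metis div_Suc dvd_eq_mod_eq_0)
  then show ?thesis
    by (auto simp: nbit_def mod_Suc)
qed


section \<open>Programs over counters and the machine that runs them\<close>

definition push_sym :: "nat \<Rightarrow> nat" where "push_sym a = 2 * a + 2"
definition pop_sym :: "nat \<Rightarrow> nat" where "pop_sym a = 2 * a + 3"

datatype 'a instr = Out "'a cell \<Rightarrow> nat" | Pop nat | Push nat

text \<open>\<open>Push\<close> lists the bits in reverse, so that they lie on the stack in the
  order in which \<open>Pop\<close> removes them.\<close>

primrec instr_out :: "'a cell \<Rightarrow> nat \<Rightarrow> (nat \<Rightarrow> nat) \<Rightarrow> 'a instr \<Rightarrow> nat list" where
  "instr_out c l v (Out f) = [f c]"
| "instr_out c l v (Pop k) = map pop_sym (bits l (v k))"
| "instr_out c l v (Push k) = map push_sym (rev (bits l (v k)))"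

text \<open>On the work tapes, \<open>1\<close> marks cell \<open>0\<close>, symbols \<open>2\<close> and \<open>3\<close> are the bits and \<open>0\<close> is the
  blank.  All work heads move together.  Tape \<open>0\<close> holds the predecessor of the counter on tape
  \<open>1\<close>, which in turn is the position of the input head as long as that stays in the input.\<close>

datatype ctl =
    Init | Check | Count | Clear | Ret ctl | Rew ctl | Emit | Exec nat
  | PopR nat nat | PushR nat nat | PushL nat nat | IncS nat | Inc nat bool | Stop

instance ctl :: countable
  by countable_datatype

text \<open>\<open>Check\<close> and \<open>Count\<close> measure the input in binary, which fixes
  the common width of all counters. \<open>Clear\<close> zeroes the counters but fills track 0 with
  ones, the predecessor of 0 modulo the range. \<open>Exec\<close> runs the program for the current
  counter values, and \<open>Inc k\<close> carries into the counter on track \<open>Suc k\<close>.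
  \<open>Ret\<close> returns the work heads to cell 0, and \<open>Rew\<close> does so for the input
  head.\<close>

fun trans_fun :: "'a instr list \<Rightarrow> nat \<Rightarrow> nat \<Rightarrow> ctl \<Rightarrow> 'a cell \<Rightarrow> (nat \<Rightarrow> nat) \<Rightarrow>
    ctl \<times> move \<times> (nat \<Rightarrow> nat) \<times> move \<times> nat option" where
  "trans_fun P M g Init c y = (Check, MStay, \<lambda>_. 1, MStay, None)"
| "trans_fun P M g Check c y =
     (if c = RightEnd then (Clear, MStay, y, MRight, None) else (Count, MRight, y, MRight, None))"
| "trans_fun P M g Count c y =
     (if y 0 = 3 then (Count, MStay, \<lambda>_. 2, MRight, None)
      else (Ret Check, MStay, \<lambda>_. 3, MLeft, None))"
| "trans_fun P M g Clear c y =
     (if y 0 = 0 then (Ret (Rew Emit), MStay, y, MLeft, None)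
      else (Clear, MStay, \<lambda>k. if k = 0 then 3 else 2, MRight, None))"
| "trans_fun P M g (Ret q) c y =
     (if y 0 = 1 then (q, MStay, y, MStay, None) else (Ret q, MStay, y, MLeft, None))"
| "trans_fun P M g (Rew q) c y =
     (if c = LeftEnd then (q, MStay, y, MStay, None) else (Rew q, MLeft, y, MStay, None))"
| "trans_fun P M g Emit c y = (Exec 0, MStay, y, MStay, Some g)"
| "trans_fun P M g (Exec pc) c y =
     (if length P \<le> pc then (IncS 0, MStay, y, MStay, None)
      else case P ! pc of
        Out f \<Rightarrow> (Exec (Suc pc), MStay, y, MStay, Some (f c))
      | Pop k \<Rightarrow> (PopR pc k, MStay, y, MRight, None)
      | Push k \<Rightarrow> (PushR pc k, MStay, y, MRight, None))"
| "trans_fun P M g (PopR pc k) c y =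
     (if y 0 = 0 then (Ret (Exec (Suc pc)), MStay, y, MLeft, None)
      else (PopR pc k, MStay, y, MRight, Some (pop_sym (y k - 2))))"
| "trans_fun P M g (PushR pc k) c y =
     (if y 0 = 0 then (PushL pc k, MStay, y, MLeft, None)
      else (PushR pc k, MStay, y, MRight, None))"
| "trans_fun P M g (PushL pc k) c y =
     (if y 0 = 1 then (Exec (Suc pc), MStay, y, MStay, None)
      else (PushL pc k, MStay, y, MLeft, Some (push_sym (y k - 2))))"
| "trans_fun P M g (IncS k) c y = (Inc k True, MStay, y, MRight, None)"
| "trans_fun P M g (Inc k b) c y =
     (if y 0 = 0 then
        (if b then
           (if Suc k < M then (Ret (Rew (IncS (Suc k))), MStay, y, MLeft, None)
            else (Stop, MStay, y, MLeft, None))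
         else (Ret (Exec 0), if k = 0 then MRight else MStay, y, MLeft, None))
      else
        (Inc k (b \<and> y (Suc k) = 3), MStay,
         \<lambda>j. if j = Suc k then (if b then (if y j = 3 then 2 else 3) else y j)
             else if j = 0 \<and> k = 0 then y 1 else y j, MRight, None))"
| "trans_fun P M g Stop c y = (Stop, MStay, y, MStay, None)"

text \<open>The type \<open>ctl\<close> is infinite, as \<open>Ret\<close> and \<open>Rew\<close>
  nest and indices are unbounded. This finite set contains \<open>Init\<close> and is closed under
  transitions.\<close>

definition ctls :: "'a instr list \<Rightarrow> nat \<Rightarrow> ctl set" where
  "ctls P M =
     {Init, Check, Count, Clear, Emit, Stop, Ret Check, Rew Emit, Ret (Rew Emit)} \<union>
     Exec ` {..length P} \<union> (Ret \<circ> Exec) ` {..length P} \<union>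
     IncS ` {..<M} \<union> (Rew \<circ> IncS) ` {..<M} \<union> (Ret \<circ> Rew \<circ> IncS) ` {..<M} \<union>
     case_prod Inc ` ({..<M} \<times> UNIV) \<union>
     case_prod PopR ` ({..<length P} \<times> {..M}) \<union> case_prod PushR ` ({..<length P} \<times> {..M}) \<union>
     case_prod PushL ` ({..<length P} \<times> {..M})"

definition odometer :: "'a instr list \<Rightarrow> nat \<Rightarrow> nat \<Rightarrow> 'a transducer" where
  "odometer P M g =
     \<lparr>states = to_nat ` ctls P M, start = to_nat Init, halting = {to_nat Stop},
      work_tapes = Suc M, work_symbols = {..3},
      delta = \<lambda>q c ys.
        case trans_fun P M g (from_nat q) c (\<lambda>k. if k \<le> M then ys ! k else 0) of
          (q', d, w, dir, out) \<Rightarrow> (to_nat q', d, map (\<lambda>k. (w k, dir)) [0..<Suc M], out)\<rparr>"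

lemma trans_fun_closed:
  assumes "\<And>k. Pop k \<in> set P \<or> Push k \<in> set P \<Longrightarrow> k \<le> M" and "0 < M"
    and "q \<in> ctls P M" and "trans_fun P M g q c y = (q', d, w, dir, out)"
    and "\<And>k. y k \<le> 3"
  shows "q' \<in> ctls P M \<and> w k \<le> 3"
proof -
  have nth: "k \<le> M" if "pc \<le> length P" "length P \<noteq> pc" "P ! pc = Pop k \<or> P ! pc = Push k" for pc k
    using assms(1) that nth_mem[of pc P] by (metis le_neq_implies_less)
  show ?thesis
  proof
    show "q' \<in> ctls P M"
      using assms(2-4)
      by (cases q) (auto dest: nth simp: ctls_def image_iff split: if_splits instr.splits)
    show "w k \<le> 3"
      using assms(4) assms(5)[of k] assms(5)[of 1]
      by (cases q) (auto split: if_splits instr.splits)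
  qed
qed

lemma wf_odometer:
  assumes "\<And>k. Pop k \<in> set P \<or> Push k \<in> set P \<Longrightarrow> k \<le> M" and "0 < M"
  shows "wf_transducer (odometer P M g)"
  unfolding wf_transducer_def
proof (intro conjI allI impI)
  fix q c ys q' d acts out
  assume q: "q \<in> states (odometer P M g) - halting (odometer P M g)"
    and len: "length ys = work_tapes (odometer P M g)"
    and ys: "set ys \<subseteq> work_symbols (odometer P M g)"
    and eq: "delta (odometer P M g) q c ys = (q', d, acts, out)"
  obtain q0 where q0: "q0 \<in> ctls P M" "q = to_nat q0"
    using q by (auto simp: odometer_def)
  obtain q1 d1 w dir out1 where
    r: "trans_fun P M g q0 c (\<lambda>k. if k \<le> M then ys ! k else 0) = (q1, d1, w, dir, out1)"
    by (metis prod_cases5)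
  have eqs: "q' = to_nat q1" "acts = map (\<lambda>k. (w k, dir)) [0..<Suc M]"
    using eq r q0 by (simp_all add: odometer_def del: upt_Suc)
  have "(if k \<le> M then ys ! k else 0) \<le> 3" for k
  proof (cases "k \<le> M")
    case True
    then have "ys ! k \<in> set ys" using len by (simp add: odometer_def)
    then show ?thesis using ys True by (auto simp: odometer_def)
  qed simp
  from trans_fun_closed[OF assms q0(1) r this]
  have closed: "q1 \<in> ctls P M" "\<And>k. w k \<le> 3" by blast+
  show "q' \<in> states (odometer P M g)"
    using closed(1) by (simp add: eqs odometer_def)
  show "length acts = work_tapes (odometer P M g)"
    by (simp add: eqs odometer_def)
  show "fst ` set acts \<subseteq> work_symbols (odometer P M g)"
    using closed(2) by (auto simp: eqs odometer_def simp del: upt_Suc)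
qed (auto simp: odometer_def ctls_def)

section \<open>Runs of the odometer\<close>

definition conf :: "nat \<Rightarrow> ctl \<Rightarrow> nat \<Rightarrow> (nat \<Rightarrow> nat \<Rightarrow> nat) \<Rightarrow> nat \<Rightarrow> nat list \<Rightarrow> config" where
  "conf M q ih tp h em =
     \<lparr>state = to_nat q, in_head = ih, works = map (\<lambda>k. (tp k, h)) [0..<Suc M], emitted = em\<rparr>"

text \<open>Halting, final output and space bound in one predicate that is inherited backwards along
  steps. Loops of the machine are thus treated by induction in continuation style, without counting
  steps.\<close>

definition halts_with :: "'a transducer \<Rightarrow> 'a list \<Rightarrow> nat \<Rightarrow> config \<Rightarrow> nat list \<Rightarrow> bool" where
  "halts_with T x B c out \<longleftrightarrow>
     (\<exists>t. state ((step T x ^^ t) c) \<in> halting T \<and> emitted ((step T x ^^ t) c) = out \<and>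
          (\<forall>s\<le>t. \<forall>(w, i) \<in> set (works ((step T x ^^ s) c)). i < B))"

lemma halts_with_step:
  assumes "halts_with T x B (step T x c) out" and "\<forall>(w, i) \<in> set (works c). i < B"
  shows "halts_with T x B c out"
proof -
  obtain t where t: "state ((step T x ^^ t) (step T x c)) \<in> halting T"
    "emitted ((step T x ^^ t) (step T x c)) = out"
    "\<forall>s\<le>t. \<forall>(w, i) \<in> set (works ((step T x ^^ s) (step T x c))). i < B"
    using assms(1) unfolding halts_with_def by blast
  have "\<forall>(w, i) \<in> set (works ((step T x ^^ s) c)). i < B" if "s \<le> Suc t" for s
    using t(3) assms(2) that by (cases s) (auto simp: funpow_swap1)
  then show ?thesis
    using t(1,2) unfolding halts_with_def
    by (intro exI[of _ "Suc t"]) (simp add: funpow_swap1)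
qed

text \<open>A track in the middle of a sweep with the head on cell h: cells to the left already show
  \<open>new\<close>, the others still show \<open>old\<close>. Bit i stands in cell
  \<open>Suc i\<close>, since cell 0 carries the marker.\<close>

definition blend :: "nat \<Rightarrow> nat \<Rightarrow> nat \<Rightarrow> nat \<Rightarrow> nat \<Rightarrow> nat" where
  "blend l h new old i =
     (if i = 0 then 1 else if i \<le> l then 2 + nbit (if i < h then new else old) (i - 1) else 0)"

text \<open>The tracks at odometer value E. Only the lowest l bits of a number reach the tape, so
  the quotient stands for a digit of E in base \<open>2 ^ l\<close>, and adding
  \<open>2 ^ l - 1\<close> stands for subtracting 1.\<close>

definition digits :: "nat \<Rightarrow> nat \<Rightarrow> nat \<Rightarrow> nat" where
  "digits l E k = (case k of 0 \<Rightarrow> E + (2 ^ l - 1) | Suc i \<Rightarrow> E div (2 ^ l) ^ i)"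

text \<open>While the carry is propagated, track \<open>0\<close> holds the predecessor of the first counter, and the
  counters before the \<open>k\<close>-th have already been advanced.\<close>

definition mid :: "nat \<Rightarrow> nat \<Rightarrow> nat \<Rightarrow> nat \<Rightarrow> nat" where
  "mid l E k j = (case j of 0 \<Rightarrow> if k = 0 then E + (2 ^ l - 1) else E
                  | Suc i \<Rightarrow> (if i < k then Suc E else E) div (2 ^ l) ^ i)"

locale odometer_run =
  fixes P :: "'a instr list" and M g :: nat and x :: "'a list" and B :: nat
  assumes M_pos: "0 < M" and tracks: "Pop k \<in> set P \<or> Push k \<in> set P \<Longrightarrow> k \<le> M"
begin

abbreviation "ends \<equiv> halts_with (odometer P M g) x B"

lemma step_conf:
  assumes "q \<noteq> Stop"
    and "trans_fun P M g q (in_cell x ih) (\<lambda>k. if k \<le> M then tp k h else 0) = (q', d, w, dir, out)"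
  shows "step (odometer P M g) x (conf M q ih tp h em) =
    conf M q' (min (move_head d ih) (Suc (length x))) (\<lambda>k. (tp k)(h := w k)) (move_head dir h)
      (em @ (case out of None \<Rightarrow> [] | Some y \<Rightarrow> [y]))"
proof -
  have ys: "(\<lambda>k. if k \<le> M then map ((\<lambda>(w, i). w i) \<circ> (\<lambda>k. (tp k, h))) [0..<Suc M] ! k else 0)
      = (\<lambda>k. if k \<le> M then tp k h else 0)"
    by (auto simp del: upt_Suc)
  have "map2 act (map (\<lambda>k. (w k, dir)) [0..<Suc M]) (map (\<lambda>k. (tp k, h)) [0..<Suc M])
      = map (\<lambda>k. ((tp k)(h := w k), move_head dir h)) [0..<Suc M]"
    by (rule nth_equalityI) (auto simp del: upt_Suc)
  then show ?thesis
    using assms by (simp add: step_def conf_def odometer_def ys del: upt_Suc)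
qed

lemma conf_cong: "(\<And>k. k \<le> M \<Longrightarrow> tp k = tp' k) \<Longrightarrow> conf M q ih tp h em = conf M q ih tp' h em"
  by (auto simp: conf_def)

text \<open>One backward step. The \<open>case\<close> hypothesis collects everything to be checked
  about a transition, so that it can be discharged by unfolding \<open>trans_fun\<close>.\<close>

lemma ends_step:
  assumes "ends (conf M q' ih' tp' h' em') out"
    and "case trans_fun P M g q (in_cell x ih) (\<lambda>k. if k \<le> M then tp k h else 0) of
      (q1, d, w, dir, out') \<Rightarrow>
        q1 = q' \<and> ih' = min (move_head d ih) (Suc (length x)) \<and>
        (\<forall>k\<le>M. tp' k = (tp k)(h := w k)) \<and> h' = move_head dir h \<and>
        em' = em @ (case out' of None \<Rightarrow> [] | Some y \<Rightarrow> [y])"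
    and "q \<noteq> Stop" "h < B"
  shows "ends (conf M q ih tp h em) out"
proof (rule halts_with_step)
  obtain d w dir out' where
    r: "trans_fun P M g q (in_cell x ih) (\<lambda>k. if k \<le> M then tp k h else 0) = (q', d, w, dir, out')"
    and eqs: "ih' = min (move_head d ih) (Suc (length x))" "h' = move_head dir h"
      "em' = em @ (case out' of None \<Rightarrow> [] | Some y \<Rightarrow> [y])"
    and tp: "\<forall>k\<le>M. tp' k = (tp k)(h := w k)"
    using assms(2) by (auto split: prod.splits)
  have "step (odometer P M g) x (conf M q ih tp h em) = conf M q' ih' tp' h' em'"
    unfolding step_conf[where tp = tp and h = h, OF assms(3) r] eqs using tp by (intro conf_cong) simp
  then show "ends (step (odometer P M g) x (conf M q ih tp h em)) out"
    using assms(1) by simp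
  show "\<forall>(w, i) \<in> set (works (conf M q ih tp h em)). i < B"
    using assms(4) by (auto simp: conf_def)
qed

abbreviation "tape l v \<equiv> blend l 0 v v"

lemma blend_1: "blend l (Suc 0) new old = tape l old"
  by (auto simp: blend_def fun_eq_iff)

lemma blend_end: "l < h \<Longrightarrow> blend l h new old = tape l new"
  by (auto simp: blend_def fun_eq_iff)

lemma blend_upd:
  "0 < h \<Longrightarrow> h \<le> l \<Longrightarrow> (blend l h new old)(h := 2 + nbit new (h - 1)) = blend l (Suc h) new old"
  by (auto simp: blend_def fun_eq_iff)

lemma ends_Ret:
  assumes "ends (conf M q ih (\<lambda>k. tape l (v k)) 0 em) out" "h < B" "ih \<le> Suc (length x)"
  shows "ends (conf M (Ret q) ih (\<lambda>k. tape l (v k)) h em) out"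
  using assms(2)
proof (induction h)
  case 0
  show ?case
    by (rule ends_step[OF assms(1)]) (use 0 assms(3) in \<open>auto simp: blend_def\<close>)
next
  case (Suc h)
  show ?case
    by (rule ends_step[OF Suc.IH]) (use Suc assms(3) in \<open>auto simp: blend_def fun_eq_iff\<close>)
qed

lemma ends_Rew:
  assumes "ends (conf M q 0 tp 0 em) out" "0 < B" "ih \<le> Suc (length x)"
  shows "ends (conf M (Rew q) ih tp 0 em) out"
  using assms(3)
proof (induction ih)
  case 0
  show ?case
    by (rule ends_step[OF assms(1)]) (use assms(2) in \<open>auto simp: in_cell_def\<close>)
next
  case (Suc h)
  then have "ends (conf M (Rew q) h tp 0 em) out" by simp
  then show ?case
    by (rule ends_step) (use Suc assms(2) in \<open>auto simp: in_cell_def\<close>)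
qed

lemma ends_PopR:
  assumes "ends (conf M (Exec (Suc pc)) ih (\<lambda>k. tape l (v k)) 0 (em @ map pop_sym (bits l (v k)))) out"
    and "Suc l < B" "ih \<le> Suc (length x)" "k \<le> M" "i \<le> l"
  shows "ends (conf M (PopR pc k) ih (\<lambda>k. tape l (v k)) (Suc i)
           (em @ map pop_sym (map (nbit (v k)) [0..<i]))) out"
  using assms(5)
proof (induction rule: inc_induct)
  case base
  have "ends (conf M (Ret (Exec (Suc pc))) ih (\<lambda>k. tape l (v k)) l
      (em @ map pop_sym (bits l (v k)))) out"
    by (rule ends_Ret[OF assms(1)]) (use assms in auto)
  then show ?case
    by (rule ends_step) (use assms in \<open>auto simp: blend_def bits_def fun_eq_iff\<close>)
next
  case (step i)
  show ?case
    by (rule ends_step[OF step.IH])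
      (use assms step(1,2) in \<open>auto simp: blend_def fun_eq_iff\<close>)
qed

lemma ends_PushL:
  assumes "ends (conf M (Exec (Suc pc)) ih (\<lambda>k. tape l (v k)) 0 (em @ map push_sym (rev (bits i (v k))))) out"
    and "l < B" "ih \<le> Suc (length x)" "k \<le> M" "i \<le> l"
  shows "ends (conf M (PushL pc k) ih (\<lambda>k. tape l (v k)) i em) out"
  using assms(1,5)
proof (induction i arbitrary: em)
  case 0
  show ?case
    by (rule ends_step[OF 0(1)]) (use assms in \<open>auto simp: blend_def bits_def\<close>)
next
  case (Suc i)
  have "ends (conf M (PushL pc k) ih (\<lambda>k. tape l (v k)) i (em @ [push_sym (nbit (v k) i)])) out"
    by (rule Suc.IH) (use Suc.prems in \<open>auto simp: bits_def\<close>)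
  then show ?case
    by (rule ends_step)
      (use assms(2,3,4) Suc.prems in \<open>auto simp: blend_def fun_eq_iff\<close>)
qed

lemma ends_PushR:
  assumes "ends (conf M (Exec (Suc pc)) ih (\<lambda>k. tape l (v k)) 0 (em @ map push_sym (rev (bits l (v k))))) out"
    and "Suc l < B" "ih \<le> Suc (length x)" "k \<le> M" "i \<le> l"
  shows "ends (conf M (PushR pc k) ih (\<lambda>k. tape l (v k)) (Suc i) em) out"
  using assms(5)
proof (induction rule: inc_induct)
  case base
  have "ends (conf M (PushL pc k) ih (\<lambda>k. tape l (v k)) l em) out"
    by (rule ends_PushL[OF assms(1)]) (use assms in auto)
  then show ?case
    by (rule ends_step) (use assms in \<open>auto simp: blend_def fun_eq_iff\<close>)
next
  case (step i)
  show ?case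
    by (rule ends_step[OF step.IH])
      (use assms step(1,2) in \<open>auto simp: blend_def fun_eq_iff\<close>)
qed

lemma ends_Exec:
  assumes "ends (conf M (IncS 0) ih (\<lambda>k. tape l (v k)) 0
      (em @ concat (map (instr_out (in_cell x ih) l v) (drop pc P)))) out"
    and "Suc l < B" "ih \<le> Suc (length x)" "pc \<le> length P"
  shows "ends (conf M (Exec pc) ih (\<lambda>k. tape l (v k)) 0 em) out"
  using assms(4,1)
proof (induction arbitrary: em rule: inc_induct)
  case base
  show ?case
    by (rule ends_step[where em' = em]) (use base assms(2,3) in \<open>auto simp: fun_eq_iff\<close>)
next
  case (step pc)
  define c where "c = in_cell x ih"
  have drop: "drop pc P = P ! pc # drop (Suc pc) P"
    using step(2) by (simp add: Cons_nth_drop_Suc)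
  have *: "ends (conf M (Exec (Suc pc)) ih (\<lambda>k. tape l (v k)) 0 (em @ instr_out c l v (P ! pc))) out"
    by (rule step.IH) (use step.prems drop in \<open>simp add: c_def\<close>)
  have k: "k \<le> M" if "P ! pc = Pop k \<or> P ! pc = Push k" for k
    using tracks that step(2) nth_mem by metis
  show ?case
  proof (cases "P ! pc")
    case (Out f)
    show ?thesis
      by (rule ends_step[OF *]) (use Out step(2) assms(2,3) in \<open>auto simp: fun_eq_iff c_def\<close>)
  next
    case (Pop k)
    have "ends (conf M (PopR pc k) ih (\<lambda>k. tape l (v k)) (Suc 0) em) out"
      using ends_PopR[of pc ih l v em k out 0] * Pop k assms(2,3) by simp
    then show ?thesis
      by (rule ends_step) (use Pop step(2) assms(2,3) in \<open>auto simp: fun_eq_iff\<close>)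
  next
    case (Push k)
    have "ends (conf M (PushR pc k) ih (\<lambda>k. tape l (v k)) (Suc 0) em) out"
      using ends_PushR[of pc ih l v em k out 0] * Push k assms(2,3) by simp
    then show ?thesis
      by (rule ends_step) (use Push step(2) assms(2,3) in \<open>auto simp: fun_eq_iff\<close>)
  qed
qed

text \<open>The assumption \<open>2 ^ i dvd Suc j\<close> says that the carry is still alive at cell
  \<open>Suc i\<close>: all lower bits have been 1 and are now 0.\<close>

lemma ends_Count:
  assumes "ends (conf M Check ih (\<lambda>k. tape (bitlength (Suc j)) (Suc j)) 0 em) out"
    and "Suc (bitlength j) < B" "ih \<le> Suc (length x)" "i \<le> bitlength j" "2 ^ i dvd Suc j"
  shows "ends (conf M Count ih (\<lambda>k. blend (bitlength j) (Suc i) (Suc j) j) (Suc i) em) out"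
  using assms(4,5)
proof (induction rule: inc_induct)
  case base
  define l where "l = bitlength j"
  \<comment> \<open>The carry has run through the whole register, so j consists of ones only and the
    numeral gains a leading 1.\<close>
  have j: "Suc j = 2 ^ l"
    using base less_bitlength[of j] by (metis Suc_leI dvd_imp_le l_def le_antisym zero_less_Suc)
  then have "bitlength (Suc j) = Suc l"
    unfolding l_def bitlength.simps(2) by (rule if_P)
  with assms(1) have *: "ends (conf M Check ih (\<lambda>k. tape (Suc l) (Suc j)) 0 em) out" by simp
  have **: "ends (conf M (Ret Check) ih (\<lambda>k. tape (Suc l) (Suc j)) l em) out"
    by (rule ends_Ret[OF *]) (use assms(2,3) in \<open>auto simp: l_def\<close>)
  have "tape (Suc l) (Suc j) = (blend l (Suc l) (Suc j) j)(Suc l := 3)"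
    using j by (auto simp: blend_def fun_eq_iff le_Suc_eq nbit_def)
  then show ?case
    unfolding l_def[symmetric]
    by (intro ends_step[OF **]) (use assms(2,3) in \<open>auto simp: blend_def l_def\<close>)
next
  case (step i)
  define l where "l = bitlength j"
  have i: "i < l" using step by (simp add: l_def)
  have y: "blend l (Suc i) (Suc j) j (Suc i) = 2 + nbit j i"
    using i by (simp add: blend_def)
  show ?case
  proof (cases "nbit j i = 1")
    case True
    then have "2 ^ Suc i dvd Suc j"
      using step.prems dvd_Suc_power_2 by blast
    then have *: "ends (conf M Count ih (\<lambda>k. blend l (Suc (Suc i)) (Suc j) j) (Suc (Suc i)) em) out"
      unfolding l_def by (rule step.IH)
    have "(blend l (Suc i) (Suc j) j)(Suc i := 2) = blend l (Suc (Suc i)) (Suc j) j"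
      using blend_upd[of "Suc i" l "Suc j" j] i True step.prems by (simp add: nbit_Suc)
    then show ?thesis
      unfolding l_def[symmetric]
      by (intro ends_step[OF *]) (use assms(2,3) i True y in \<open>auto simp: l_def\<close>)
  next
    case False
    then have 0: "nbit j i = 0" using nbit_less_2[of j i] by simp
    have nd: "\<not> 2 ^ Suc i dvd Suc j"
      using False dvd_Suc_power_2 by blast
    then have nd': "\<not> 2 ^ m dvd Suc j" if "i < m" for m
      using that by (meson Suc_leI dvd_trans le_imp_power_dvd)
    have "bitlength (Suc j) = l"
      using nd'[OF i] by (auto simp: l_def)
    with assms(1) have *: "ends (conf M Check ih (\<lambda>k. tape l (Suc j)) 0 em) out" by simp
    have **: "ends (conf M (Ret Check) ih (\<lambda>k. tape l (Suc j)) i em) out"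
      by (rule ends_Ret[OF *]) (use assms(2,3) i in \<open>auto simp: l_def\<close>)
    have "(blend l (Suc i) (Suc j) j)(Suc i := 3) = tape l (Suc j)"
      using step.prems 0 i nd' by (auto simp: blend_def fun_eq_iff nbit_Suc)
    then show ?thesis
      unfolding l_def[symmetric]
      by (intro ends_step[OF **]) (use assms(2,3) i 0 y in \<open>auto simp: l_def\<close>)
  qed
qed

lemma ends_Check:
  assumes "ends (conf M Clear (Suc (length x))
      (\<lambda>k. tape (bitlength (Suc (length x))) (Suc (length x))) 1 em) out"
    and "Suc (bitlength (Suc (length x))) < B" "j \<le> Suc (length x)"
  shows "ends (conf M Check j (\<lambda>k. tape (bitlength j) j) 0 em) out"
  using assms(3)
proof (induction rule: inc_induct)
  case base
  show ?case
    by (rule ends_step[OF assms(1)]) (use assms(2) in \<open>auto simp: in_cell_def simp del: bitlength.simps\<close>)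
next
  case (step j)
  have "bitlength j \<le> bitlength (Suc (length x))"
    using step by (intro bitlength_mono) simp
  then have l: "Suc (bitlength j) < B" using assms(2) by linarith
  have "ends (conf M Count (Suc j) (\<lambda>k. blend (bitlength j) (Suc 0) (Suc j) j) (Suc 0) em) out"
    by (rule ends_Count[OF step.IH]) (use l step in auto)
  then show ?case
    by (rule ends_step)
      (use step assms(2) in \<open>auto simp: in_cell_def blend_1 fun_eq_iff simp del: bitlength.simps\<close>)
qed

lemma ends_Clear:
  assumes "ends (conf M Emit 0 (\<lambda>k. tape l (digits l 0 k)) 0 em) out"
    and "Suc l < B" "i \<le> l" and "ih \<le> Suc (length x)"
  shows "ends (conf M Clear ih (\<lambda>k. blend l (Suc i) (digits l 0 k) v) (Suc i) em) out"
  using assms(3)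
proof (induction rule: inc_induct)
  case base
  have "ends (conf M (Rew Emit) ih (\<lambda>k. tape l (digits l 0 k)) 0 em) out"
    by (rule ends_Rew[OF assms(1)]) (use assms in auto)
  then have "ends (conf M (Ret (Rew Emit)) ih (\<lambda>k. tape l (digits l 0 k)) l em) out"
    by (rule ends_Ret) (use assms in auto)
  then show ?case
    by (rule ends_step) (use assms in \<open>auto simp: blend_def fun_eq_iff\<close>)
next
  case (step i)
  have "nbit (digits l 0 k) i = (if k = 0 then 1 else 0)" for k
  proof -
    have "nbit (2 ^ l - 1) i = 1"
      using step(2) by (simp add: nbit_def flip: mask_eq_exp_minus_1) (metis bit_iff_odd bit_mask_iff mask_eq_exp_minus_1 odd_iff_mod_2_eq_one One_nat_def less_imp_le possible_bit_nat)
    then show ?thesis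
      by (simp add: digits_def nbit_def split: nat.splits)
  qed
  then have "blend l (Suc (Suc i)) (digits l 0 k) v =
      (blend l (Suc i) (digits l 0 k) v)(Suc i := if k = 0 then 3 else 2)" for k
    using blend_upd[of "Suc i" l "digits l 0 k" v, symmetric] step(2)
    by (simp add: numeral_2_eq_2 numeral_3_eq_3)
  then show ?case
    by (intro ends_step[OF step.IH])
      (use step(2) assms(2,4) in \<open>auto simp: blend_def\<close>)
qed

text \<open>The flag of \<open>Inc\<close> is the carry into bit i, written as divisibility. For k =
  0 the sweep also copies the old first counter to track 0, which makes track 0 the predecessor of
  the new first counter.\<close>

lemma ends_Inc:
  assumes "ends (conf M (Inc k (2 ^ l dvd Suc (v (Suc k)))) ih (\<lambda>j. tape l (new j)) (Suc l) em) out"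
    and "Suc l < B" "ih \<le> Suc (length x)" "k < M" "i \<le> l"
    and new: "\<And>j. new j = (if j = Suc k then Suc (v j) else if j = 0 \<and> k = 0 then v 1 else v j)"
  shows "ends (conf M (Inc k (2 ^ i dvd Suc (v (Suc k)))) ih (\<lambda>j. blend l (Suc i) (new j) (v j)) (Suc i) em) out"
  using assms(5)
proof (induction rule: inc_induct)
  case base
  show ?case using assms(1) by (simp add: blend_end)
next
  case (step i)
  let ?b = "2 ^ i dvd Suc (v (Suc k))"
  have y: "blend l (Suc i) (new j) (v j) (Suc i) = 2 + nbit (v j) i" for j
    using step(2) by (simp add: blend_def)
  have bit01: "nbit (v j) i = 0 \<or> nbit (v j) i = 1" for j
    using nbit_less_2[of "v j" i] by linarith
  have "blend l (Suc (Suc i)) (new j) (v j) = (blend l (Suc i) (new j) (v j))(Suc i :=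
      if j = Suc k then (if ?b then (if 2 + nbit (v j) i = 3 then 2 else 3) else 2 + nbit (v j) i)
      else if j = 0 \<and> k = 0 then 2 + nbit (v 1) i else 2 + nbit (v j) i)" for j
    using blend_upd[of "Suc i" l "new j" "v j", symmetric] step(2) bit01[of j]
    by (auto simp: new nbit_Suc numeral_2_eq_2 numeral_3_eq_3)
  then show ?case
    by (intro ends_step[OF step.IH])
      (use step(2) assms(2-4) y M_pos in \<open>auto simp: dvd_Suc_power_2 simp del: power_Suc\<close>)
qed

lemma tape_cong_mod: "v mod 2 ^ l = v' mod 2 ^ l \<Longrightarrow> tape l v = tape l v'"
proof -
  assume "v mod 2 ^ l = v' mod 2 ^ l"
  then have "nbit v i = nbit v' i" if "i < l" for i
    using nbit_mod[OF that, of v] nbit_mod[OF that, of v'] by simp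
  then show ?thesis
    by (auto simp: blend_def fun_eq_iff)
qed

text \<open>The carry enters digit k exactly if the k-th power of the base divides
  \<open>Suc E\<close>. Either it ends there and the tracks show the digits of \<open>Suc E\<close>,
  or the digit wraps to 0 and the carry moves on; hence the induction on \<open>M - k\<close>. For k
  > 0 the first digit has wrapped, which is why the input head stands at 0.\<close>

lemma ends_IncS:
  assumes "E < (2 ^ l) ^ M"
    and next_E: "Suc E < (2 ^ l) ^ M \<Longrightarrow>
      ends (conf M (Exec 0) (min (Suc E mod 2 ^ l) (Suc (length x)))
        (\<lambda>k. tape l (digits l (Suc E) k)) 0 em) out"
    and last_E: "Suc E = (2 ^ l) ^ M \<Longrightarrow> out = em"
    and B: "Suc l < B"
    and k: "k < M" "(2 ^ l) ^ k dvd Suc E"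
    and ih: "ih = (if k = 0 then min (E mod 2 ^ l) (Suc (length x)) else 0)"
  shows "ends (conf M (IncS k) ih (\<lambda>j. tape l (mid l E k j)) 0 em) out"
  using k ih
proof (induction "M - k" arbitrary: k ih rule: less_induct)
  case less
  define N :: nat where "N = 2 ^ l"
  define new where "new = (\<lambda>j. if j = Suc k then Suc (mid l E k j)
    else if j = 0 \<and> k = 0 then mid l E k 1 else mid l E k j)"
  define b where "b \<longleftrightarrow> N ^ Suc k dvd Suc E"
  have ih_le: "ih \<le> Suc (length x)" using less.prems by auto
  have div_k: "Suc (E div N ^ k) = Suc E div N ^ k"
    using less.prems(2) by (simp add: div_Suc dvd_eq_mod_eq_0 N_def)
  have new_mid: "new j = mid l E (Suc k) j" for j
    using div_k by (auto simp: new_def mid_def N_def less_Suc_eq split: nat.splits)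
  have carry: "2 ^ l dvd Suc (mid l E k (Suc k)) \<longleftrightarrow> b"
  proof -
    have "mid l E k (Suc k) = E div N ^ k" by (simp add: mid_def N_def)
    moreover obtain m where "Suc E = N ^ k * m"
      using less.prems(2) unfolding N_def by (elim dvdE)
    ultimately show ?thesis
      using div_k by (simp add: b_def N_def mult.commute)
  qed
  have main: "ends (conf M (Inc k b) ih (\<lambda>j. tape l (mid l E (Suc k) j)) (Suc l) em) out"
  proof (cases b)
    case b: True
    show ?thesis
    proof (cases "Suc k < M")
      case True
      have "ends (conf M (IncS (Suc k)) 0 (\<lambda>j. tape l (mid l E (Suc k) j)) 0 em) out"
        by (rule less.hyps) (use True b less.prems in \<open>auto simp: b_def N_def\<close>)
      then have "ends (conf M (Rew (IncS (Suc k))) ih (\<lambda>j. tape l (mid l E (Suc k) j)) 0 em) out"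
        by (rule ends_Rew) (use B ih_le in auto)
      then have "ends (conf M (Ret (Rew (IncS (Suc k)))) ih (\<lambda>j. tape l (mid l E (Suc k) j)) l em) out"
        by (rule ends_Ret) (use B ih_le in auto)
      then show ?thesis
        by (rule ends_step) (use B ih_le b True in \<open>auto simp: blend_def fun_eq_iff\<close>)
    next
      case False
      then have "Suc k = M" using less.prems by simp
      then have "(2 ^ l) ^ M \<le> Suc E"
        using b dvd_imp_le unfolding b_def N_def by blast
      then have "out = em" using last_E assms(1) by simp
      then have "ends (conf M Stop ih (\<lambda>j. tape l (mid l E (Suc k) j)) l em) out"
        unfolding halts_with_def using B
        by (intro exI[of _ 0]) (auto simp: conf_def odometer_def)
      then show ?thesis
        by (rule ends_step) (use B ih_le b False in \<open>auto simp: blend_def fun_eq_iff\<close>)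
    qed
  next
    case False
    have "Suc E \<noteq> N ^ M"
    proof
      assume "Suc E = N ^ M"
      moreover have "N ^ Suc k dvd N ^ M"
        using less.prems(1) by (intro le_imp_power_dvd) simp
      ultimately show False using False unfolding b_def by metis
    qed
    then have lt: "Suc E < (2 ^ l) ^ M" using assms(1) by (simp add: N_def)
    have "tape l (mid l E (Suc k) j) = tape l (digits l (Suc E) j)" for j
    proof (cases j)
      case 0
      \<comment> \<open>Track 0 shows E after the copy, while \<open>digits\<close> asks for
        \<open>Suc E + (2 ^ l - 1)\<close>; these agree in their lowest l bits.\<close>
      have "(E + 2 ^ l) mod 2 ^ l = E mod 2 ^ l" by simp
      then have "tape l E = tape l (E + 2 ^ l)"
        by (intro tape_cong_mod) simp
      then show ?thesis using 0 by (simp add: mid_def digits_def)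
    next
      case (Suc i)
      have "Suc E div N ^ i = E div N ^ i" if "\<not> i < Suc k"
      proof -
        have "N ^ Suc k dvd N ^ i"
          using that by (intro le_imp_power_dvd) simp
        then have "\<not> N ^ i dvd Suc E"
          using False unfolding b_def by (meson dvd_trans)
        then show ?thesis by (simp add: div_Suc dvd_eq_mod_eq_0)
      qed
      then show ?thesis using Suc by (simp add: mid_def digits_def N_def)
    qed
    then have *: "ends (conf M (Exec 0) (min (Suc E mod 2 ^ l) (Suc (length x)))
        (\<lambda>j. tape l (mid l E (Suc k) j)) 0 em) out"
      using next_E[OF lt] by simp
    have **: "ends (conf M (Ret (Exec 0)) (min (Suc E mod 2 ^ l) (Suc (length x)))
        (\<lambda>j. tape l (mid l E (Suc k) j)) l em) out"
      by (rule ends_Ret[OF *]) (use B in auto)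
    \<comment> \<open>If the first digit absorbs the carry, digit and input head both advance by
      one. Otherwise it has wrapped, and the head has been rewound to cell 0.\<close>
    have "min (Suc E mod 2 ^ l) (Suc (length x)) =
        min (if k = 0 then Suc ih else ih) (Suc (length x))"
    proof (cases "k = 0")
      case True
      then have "Suc E mod 2 ^ l = Suc (E mod 2 ^ l)"
        using False by (simp add: b_def N_def mod_Suc dvd_eq_mod_eq_0 split: if_splits)
      then show ?thesis using True less.prems by simp
    next
      case kpos: False
      then have "N dvd N ^ k" by (simp add: dvd_power)
      then have "N dvd Suc E"
        using less.prems(2) unfolding N_def by (meson dvd_trans)
      then show ?thesis using kpos less.prems by (simp add: N_def dvd_eq_mod_eq_0)
    qed
    then show ?thesis
      by (intro ends_step[OF **]) (use B ih_le False in \<open>auto simp: blend_def fun_eq_iff\<close>)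
  qed
  have "ends (conf M (Inc k (2 ^ 0 dvd Suc (mid l E k (Suc k)))) ih
      (\<lambda>j. blend l (Suc 0) (new j) (mid l E k j)) (Suc 0) em) out"
  proof (rule ends_Inc)
    show "ends (conf M (Inc k (2 ^ l dvd Suc (mid l E k (Suc k)))) ih (\<lambda>j. tape l (new j)) (Suc l) em) out"
      using main unfolding carry new_mid .
  qed (use B ih_le less.prems in \<open>auto simp: new_def\<close>)
  then show ?case
    by (rule ends_step) (use B ih_le in \<open>auto simp: blend_1 blend_def fun_eq_iff\<close>)
qed

definition block :: "nat \<Rightarrow> nat \<Rightarrow> nat list" where
  "block l E = concat (map (instr_out (in_cell x (E mod 2 ^ l)) l (digits l E)) P)"

lemma ends_blocks:
  assumes "E < (2 ^ l) ^ M" "Suc l < B" "out = em @ concat (map (block l) [E..<(2 ^ l) ^ M])"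
  shows "ends (conf M (Exec 0) (min (E mod 2 ^ l) (Suc (length x)))
    (\<lambda>k. tape l (digits l E k)) 0 em) out"
  using assms(1,3)
proof (induction "(2 ^ l) ^ M - E" arbitrary: E em rule: less_induct)
  case less
  have upt: "[E..<(2 ^ l) ^ M] = E # [Suc E..<(2 ^ l) ^ M]"
    using less.prems(1) by (simp add: upt_conv_Cons)
  \<comment> \<open>The first counter may run beyond the input. The head then waits on the right end
    marker, which \<open>in_cell\<close> reports for all such positions.\<close>
  have cell: "in_cell x (min i (Suc (length x))) = in_cell x i" for i
    by (auto simp: in_cell_def)
  have "ends (conf M (IncS 0) (min (E mod 2 ^ l) (Suc (length x)))
      (\<lambda>j. tape l (mid l E 0 j)) 0 (em @ block l E)) out"
  proof (rule ends_IncS[OF less.prems(1) _ _ assms(2) M_pos])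
    assume "Suc E < (2 ^ l) ^ M"
    then show "ends (conf M (Exec 0) (min (Suc E mod 2 ^ l) (Suc (length x)))
        (\<lambda>k. tape l (digits l (Suc E) k)) 0 (em @ block l E)) out"
      using less.prems upt by (intro less.hyps) auto
  qed (use less.prems upt in auto)
  moreover have "mid l E 0 j = digits l E j" for j
    by (auto simp: mid_def digits_def split: nat.splits)
  ultimately show ?case
    using assms(2) cell by (intro ends_Exec) (auto simp: block_def)
qed

lemma ends_Init:
  assumes l: "l = bitlength (Suc (length x))" and B: "Suc l < B"
    and out: "out = g # concat (map (block l) [0..<(2 ^ l) ^ M])"
  shows "ends (initial (odometer P M g)) out"
proof -
  have "ends (conf M (Exec 0) (min (0 mod 2 ^ l) (Suc (length x)))
      (\<lambda>k. tape l (digits l 0 k)) 0 [g]) out"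
    by (rule ends_blocks) (use B out in auto)
  then have "ends (conf M Emit 0 (\<lambda>k. tape l (digits l 0 k)) 0 []) out"
    by (rule ends_step) (use B in auto)
  then have "ends (conf M Clear (Suc (length x))
      (\<lambda>k. blend l (Suc 0) (digits l 0 k) (Suc (length x))) (Suc 0) []) out"
    by (rule ends_Clear) (use B in auto)
  then have "ends (conf M Check 0 (\<lambda>k. tape (bitlength 0) 0) 0 []) out"
    unfolding l by (intro ends_Check) (use B l in \<open>auto simp: blend_1\<close>)
  then have "ends (conf M Init 0 (\<lambda>_ _. 0) 0 []) out"
    by (rule ends_step) (use B in \<open>auto simp: blend_def fun_eq_iff\<close>)
  moreover have "initial (odometer P M g) = conf M Init 0 (\<lambda>_ _. 0) 0 []"
    by (simp add: initial_def conf_def odometer_def map_replicate_const del: upt_Suc replicate_Suc)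
  ultimately show ?thesis by simp
qed

end

section \<open>Logarithmic space for the odometer\<close>

lemma step_halted: "state c \<in> halting T \<Longrightarrow> (step T x ^^ t) c = c"
  by (induction t) (auto simp: step_def)

text \<open>For n at least 2, the power \<open>2 ^ bitlength (Suc n)\<close> is at most 2(n + 1) and
  so at most n^3. This accounts for 3 of the 5 in the constant; the two extra cells account for the
  rest because ln 2 is at most ln n.\<close>

lemma ln_bound_bitlength: "(\<lambda>n. real (bitlength (Suc n) + 2)) \<in> O(\<lambda>n. ln (real n))"
proof (rule bigoI)
  show "\<forall>\<^sub>F n in sequentially. norm (real (bitlength (Suc n) + 2)) \<le> 5 / ln 2 * norm (ln (real n))"
  proof (rule eventually_sequentiallyI)
    fix n :: nat
    assume n: "2 \<le> n"
    have "2 * Suc n \<le> n ^ 3"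
    proof -
      have "2 * Suc n \<le> 2 * 2 * n" using n by simp
      also have "\<dots> \<le> n * n * n" using n by (intro mult_mono) auto
      finally show ?thesis by (simp add: power3_eq_cube)
    qed
    then have "2 ^ bitlength (Suc n) \<le> n ^ 3"
      using bitlength_lower[of "Suc n"] by linarith
    then have "real (2 ^ bitlength (Suc n)) \<le> real (n ^ 3)"
      by (simp only: of_nat_le_iff)
    then have "ln (2 ^ bitlength (Suc n)) \<le> ln (real n ^ 3)"
      using n by simp
    then have b: "real (bitlength (Suc n)) * ln 2 \<le> 3 * ln (real n)"
      using n by (simp add: ln_realpow)
    have "ln 2 \<le> ln (real n)" using n by simp
    then have "(real (bitlength (Suc n)) + 2) * ln 2 \<le> 5 * ln (real n)"
      using b by (simp add: distrib_right)
    then have "real (bitlength (Suc n)) + 2 \<le> 5 * ln (real n) / ln 2"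
      by (simp add: pos_le_divide_eq)
    then show "norm (real (bitlength (Suc n) + 2)) \<le> 5 / ln 2 * norm (ln (real n))"
      using n by simp
  qed
qed

lemma logspace_odometer:
  fixes P :: "'a::finite instr list"
  assumes "0 < M" and "\<And>k. Pop k \<in> set P \<or> Push k \<in> set P \<Longrightarrow> k \<le> M"
  shows "logspace_computable (\<lambda>x. g # concat (map
    (\<lambda>E. let l = bitlength (Suc (length x)) in
      concat (map (instr_out (in_cell x (E mod 2 ^ l)) l (digits l E)) P))
    [0..<(2 ^ bitlength (Suc (length x))) ^ M]))" (is "logspace_computable ?f")
proof -
  interpret odometer_run P M g x "bitlength (Suc (length x)) + 2" for x
    using assms by unfold_locales auto
  have ends: "ends x (initial (odometer P M g)) (?f x)" for x
    by (rule ends_Init) (simp_all add: block_def[abs_def] Let_def lessI del: bitlength.simps)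
  show ?thesis
    unfolding logspace_computable_def
  proof (intro exI[of _ "odometer P M g"] exI[of _ "\<lambda>n. bitlength (Suc n) + 2"] conjI)
    show "wf_transducer (odometer P M g)"
      using assms by (intro wf_odometer) auto
    show "computes (odometer P M g) ?f"
      using ends unfolding computes_def halts_with_def run_def by blast
    show "runs_in_space (odometer P M g) (\<lambda>n. bitlength (Suc n) + 2)"
      unfolding runs_in_space_def
    proof (intro allI)
      fix x t
      obtain t0 where t0: "state (run (odometer P M g) x t0) \<in> halting (odometer P M g)"
        "\<forall>s\<le>t0. \<forall>(w, i) \<in> set (works (run (odometer P M g) x s)). i < bitlength (Suc (length x)) + 2"
        using ends[of x] unfolding halts_with_def run_def by blast
      \<comment> \<open>The space bound is demanded at all times, also after halting, when the
        configuration no longer changes.\<close>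
      have "run (odometer P M g) x t = run (odometer P M g) x (min t t0)"
      proof (cases "t \<le> t0")
        case False
        then have "run (odometer P M g) x t = (step (odometer P M g) x ^^ (t - t0)) (run (odometer P M g) x t0)"
          unfolding run_def by (metis add_diff_inverse_nat comp_apply funpow_add add.commute linorder_not_le not_le_imp_less less_imp_le)
        then show ?thesis
          using False step_halted[OF t0(1)] by (simp add: min_def)
      qed (simp add: min_def)
      then show "\<forall>(w, i) \<in> set (works (run (odometer P M g) x t)). i < bitlength (Suc (length x)) + 2"
        using t0(2) by (metis min.cobounded2)
    qed
  qed (rule ln_bound_bitlength)
qed

section \<open>Balanced bracket words with optional segments\<close>

declare bitlength.simps(2) [simp del]

text \<open>Reads a sentential form with each nonterminal A interpreted as the language
  \<open>Y A\<close>. With it, the language of a grammar can be treated as a least solution of its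
  productions, without derivation trees.\<close>

fun matches :: "('n \<Rightarrow> 't list \<Rightarrow> bool) \<Rightarrow> ('n, 't) gsym list \<Rightarrow> 't list \<Rightarrow> bool" where
  "matches Y [] w \<longleftrightarrow> w = []"
| "matches Y (Tm t # \<alpha>) w \<longleftrightarrow> (\<exists>v. w = t # v \<and> matches Y \<alpha> v)"
| "matches Y (Nt A # \<alpha>) w \<longleftrightarrow> (\<exists>u v. w = u @ v \<and> Y A u \<and> matches Y \<alpha> v)"

lemma matches_append:
  "matches Y (\<alpha> @ \<beta>) w \<longleftrightarrow> (\<exists>u v. w = u @ v \<and> matches Y \<alpha> u \<and> matches Y \<beta> v)"
proof (induction Y \<alpha> w rule: matches.induct)
  case (2 Y t \<alpha> w)
  then show ?case by (auto simp: Cons_eq_append_conv) blast+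
next
  case (3 Y A \<alpha> w)
  then show ?case by simp (metis append.assoc)
qed simp

lemma matches_Tm: "matches Y (map Tm w) v \<longleftrightarrow> v = w"
  by (induction w arbitrary: v) auto

text \<open>Undoing a derivation step preserves matching when Y is closed under the productions, and
  the derived terminal word matches itself.\<close>

lemma cfg_lang_matches:
  assumes closed: "\<And>A \<alpha> w. (A, \<alpha>) \<in> P \<Longrightarrow> matches Y \<alpha> w \<Longrightarrow> Y A w"
    and "w \<in> cfg_lang P A"
  shows "Y A w"
proof -
  have pull: "matches Y \<alpha> v" if "derives1 P \<alpha> \<beta>" "matches Y \<beta> v" for \<alpha> \<beta> v
    using that
  proof (induction rule: derives1.induct)
    case (1 A \<gamma> u u')
    then show ?case using closed by (auto simp: matches_append) blast
  qed
  have "(derives1 P)\<^sup>*\<^sup>* \<alpha> (map Tm w) \<Longrightarrow> matches Y \<alpha> w" for \<alpha>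
    by (induction rule: converse_rtranclp_induct) (auto simp: matches_Tm intro: pull)
  then have "matches Y [Nt A] w"
    using assms(2) unfolding cfg_lang_def by blast
  then show ?thesis by auto
qed

lemma derives1_context: "derives1 P \<alpha> \<beta> \<Longrightarrow> derives1 P (u @ \<alpha> @ v) (u @ \<beta> @ v)"
proof (induction rule: derives1.induct)
  case (1 A \<alpha> u' v')
  then show ?case
    using derives1.intros[of A \<alpha> P "u @ u'" "v' @ v"] by simp
qed

lemma derives_context:
  "(derives1 P)\<^sup>*\<^sup>* \<alpha> \<beta> \<Longrightarrow> (derives1 P)\<^sup>*\<^sup>* (u @ \<alpha> @ v) (u @ \<beta> @ v)"
  by (induction rule: rtranclp_induct) (auto intro: derives1_context rtranclp.rtrancl_into_rtrancl)

lemma matches_derives: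
  "matches (\<lambda>A w. w \<in> cfg_lang P A) \<alpha> w \<Longrightarrow> (derives1 P)\<^sup>*\<^sup>* \<alpha> (map Tm w)"
proof (induction "\<lambda>A w. w \<in> cfg_lang P A" \<alpha> w rule: matches.induct)
  case (2 t \<alpha> w)
  then obtain v where "w = t # v" "(derives1 P)\<^sup>*\<^sup>* \<alpha> (map Tm v)" by auto
  then show ?case using derives_context[of P \<alpha> "map Tm v" "[Tm t]" "[]"] by simp
next
  case (3 A \<alpha> w)
  then obtain u v where w: "w = u @ v" "u \<in> cfg_lang P A" "(derives1 P)\<^sup>*\<^sup>* \<alpha> (map Tm v)"
    by auto
  have "(derives1 P)\<^sup>*\<^sup>* (Nt A # \<alpha>) (map Tm u @ \<alpha>)"
    using derives_context[of P "[Nt A]" "map Tm u" "[]" \<alpha>] w(2) by (simp add: cfg_lang_def)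
  also have "(derives1 P)\<^sup>*\<^sup>* \<dots> (map Tm u @ map Tm v)"
    using derives_context[of P \<alpha> "map Tm v" "map Tm u" "[]"] w(3) by simp
  finally show ?case using w(1) by simp
qed simp

lemma cfg_langI:
  assumes "(A, \<alpha>) \<in> P" "matches (\<lambda>A w. w \<in> cfg_lang P A) \<alpha> w"
  shows "w \<in> cfg_lang P A"
proof -
  have "derives1 P [Nt A] \<alpha>"
    using derives1.intros[OF assms(1), of "[]" "[]"] by simp
  then show ?thesis
    using matches_derives[OF assms(2)] by (simp add: cfg_lang_def)
qed

text \<open>The letters \<open>0\<close> and \<open>1\<close> delimit segments that may be skipped as a whole; the values of
  \<open>push_sym\<close> and \<open>pop_sym\<close> are opening and closing brackets.\<close>

inductive skip_dyck :: "nat \<Rightarrow> nat list \<Rightarrow> bool" for K :: nat where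
  "skip_dyck K []"
| "t < 2 \<Longrightarrow> skip_dyck K v \<Longrightarrow> skip_dyck K (t # v)"
| "set u \<subseteq> {2..<2 * K + 2} \<Longrightarrow> skip_dyck K v \<Longrightarrow> skip_dyck K (0 # u @ 1 # v)"
| "a < K \<Longrightarrow> skip_dyck K u \<Longrightarrow> skip_dyck K v \<Longrightarrow> skip_dyck K (push_sym a # u @ pop_sym a # v)"

text \<open>Nonterminal 1 generates the arbitrary bracket words over which a skip passes.\<close>

definition skip_dyck_prods :: "nat \<Rightarrow> (nat, nat) prods" where
  "skip_dyck_prods K =
     {(0, []), (0, [Tm 0, Nt 0]), (0, [Tm 1, Nt 0]), (0, [Tm 0, Nt 1, Tm 1, Nt 0]), (1, [])} \<union>
     (\<lambda>a. (0, [Tm (push_sym a), Nt 0, Tm (pop_sym a), Nt 0])) ` {..<K} \<union>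
     (\<lambda>t. (1, [Tm t, Nt 1])) ` {2..<2 * K + 2}"

lemma cfg_lang_skip_dyck: "cfg_lang (skip_dyck_prods K) 0 = {w. skip_dyck K w}"
proof (intro equalityI subsetI CollectI)
  let ?Y = "\<lambda>(A :: nat) w. if A = 0 then skip_dyck K w else set w \<subseteq> {2..<2 * K + 2}"
  fix w
  assume "w \<in> cfg_lang (skip_dyck_prods K) 0"
  then have "?Y 0 w"
    by (rule cfg_lang_matches[where Y = ?Y, rotated])
      (auto 4 3 simp: skip_dyck_prods_def intro: skip_dyck.intros(1,3,4)[simplified]
        skip_dyck.intros(2)[of 0, simplified] skip_dyck.intros(2)[of "Suc 0", simplified]
        dest: subsetD)
  then show "skip_dyck K w" by simp
next
  let ?P = "skip_dyck_prods K"
  have skip: "set u \<subseteq> {2..<2 * K + 2} \<Longrightarrow> u \<in> cfg_lang ?P 1" for u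
  proof (induction u)
    case Nil
    show ?case by (rule cfg_langI[of _ "[]"]) (auto simp: skip_dyck_prods_def)
  next
    case (Cons t u)
    then show ?case
      by (intro cfg_langI[of _ "[Tm t, Nt 1]"]) (auto simp: skip_dyck_prods_def)
  qed
  fix w
  assume "w \<in> {w. skip_dyck K w}"
  then have "skip_dyck K w" by simp
  then show "w \<in> cfg_lang ?P 0"
  proof induction
    case 1
    show ?case by (rule cfg_langI[of _ "[]"]) (auto simp: skip_dyck_prods_def)
  next
    case (2 t v)
    then show ?case
      by (intro cfg_langI[of _ "[Tm t, Nt 0]"]) (auto simp: skip_dyck_prods_def less_2_cases_iff)
  next
    case (3 u v)
    then show ?case
      using skip by (intro cfg_langI[of _ "[Tm 0, Nt 1, Tm 1, Nt 0]"]) (auto simp: skip_dyck_prods_def)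
  next
    case (4 a u v)
    then show ?case
      by (intro cfg_langI[of _ "[Tm (push_sym a), Nt 0, Tm (pop_sym a), Nt 0]"])
        (auto simp: skip_dyck_prods_def)
  qed
qed

lemma context_free_skip_dyck: "context_free {w. skip_dyck K w}"
proof -
  have "finite (skip_dyck_prods K)" by (simp add: skip_dyck_prods_def)
  then show ?thesis
    unfolding context_free_def using cfg_lang_skip_dyck by metis
qed

text \<open>Within a segment the brackets are mostly unmatched; their partners lie in other
  segments. Reading from left to right with an explicit stack gives each segment a meaning of its
  own.\<close>

inductive stack_run :: "nat \<Rightarrow> nat list \<Rightarrow> nat list \<Rightarrow> bool" for K :: nat where
  Done: "stack_run K [] []"
| Delim: "t < 2 \<Longrightarrow> stack_run K st v \<Longrightarrow> stack_run K st (t # v)"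
| Skip: "set u \<subseteq> {2..<2 * K + 2} \<Longrightarrow> stack_run K st v \<Longrightarrow> stack_run K st (0 # u @ 1 # v)"
| Push: "a < K \<Longrightarrow> stack_run K (a # st) v \<Longrightarrow> stack_run K st (push_sym a # v)"
| Pop: "stack_run K st v \<Longrightarrow> stack_run K (a # st) (pop_sym a # v)"

lemma skip_dyck_append_run: "skip_dyck K u \<Longrightarrow> stack_run K st w \<Longrightarrow> stack_run K st (u @ w)"
proof (induction arbitrary: st w rule: skip_dyck.induct)
  case (4 a u v)
  have "stack_run K (a # st) (u @ pop_sym a # v @ w)"
    using 4 by (intro 4 stack_run.Pop)
  then show ?case using stack_run.Push[OF 4(1)] by simp
qed (auto intro: stack_run.intros[simplified])

text \<open>The invariant that recovers nesting from a run: between the closing brackets for the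
  pending stack symbols lie words of the bracket language.\<close>

fun unstack :: "nat \<Rightarrow> nat list \<Rightarrow> nat list \<Rightarrow> bool" where
  "unstack K [] w \<longleftrightarrow> skip_dyck K w"
| "unstack K (a # st) w \<longleftrightarrow> (\<exists>u v. w = u @ pop_sym a # v \<and> skip_dyck K u \<and> unstack K st v)"

lemma unstack_prefix:
  assumes "\<And>v. skip_dyck K v \<Longrightarrow> skip_dyck K (u @ v)" "unstack K st w"
  shows "unstack K st (u @ w)"
  using assms by (cases st) (auto, metis append.assoc)

lemma stack_run_unstack: "stack_run K st w \<Longrightarrow> unstack K st w"
proof (induction rule: stack_run.induct)
  case Done
  show ?case by (auto intro: skip_dyck.intros)
next
  case (Delim t st v)
  then show ?case using unstack_prefix[of K "[t]"] by (simp add: skip_dyck.intros)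
next
  case (Skip u st v)
  then show ?case using unstack_prefix[of K "0 # u @ [1]"] by (simp add: skip_dyck.intros[simplified])
next
  case (Push a st v)
  then obtain u v' where "v = u @ pop_sym a # v'" "skip_dyck K u" "unstack K st v'" by auto
  then show ?case
    using Push.hyps(1) unstack_prefix[of K "push_sym a # u @ [pop_sym a]"]
    by (simp add: skip_dyck.intros)
next
  case (Pop st v a)
  then show ?case by (metis append_Nil skip_dyck.intros(1) unstack.simps(2))
qed

lemma skip_dyck_iff_run: "skip_dyck K w \<longleftrightarrow> stack_run K [] w"
  using skip_dyck_append_run[of K w "[]" "[]"] stack_run_unstack[of K "[]" w]
  by (auto intro: stack_run.intros)

lemma push_sym_neq [simp]:
  "push_sym a \<noteq> 0" "push_sym a \<noteq> Suc 0" "pop_sym a \<noteq> 0" "pop_sym a \<noteq> Suc 0"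
  "0 \<noteq> push_sym a" "Suc 0 \<noteq> push_sym a" "0 \<noteq> pop_sym a" "Suc 0 \<noteq> pop_sym a"
  "push_sym a \<noteq> pop_sym b" "pop_sym b \<noteq> push_sym a" "\<not> push_sym a < 2" "\<not> pop_sym a < 2"
  "push_sym a = push_sym b \<longleftrightarrow> a = b" "pop_sym a = pop_sym b \<longleftrightarrow> a = b"
  unfolding push_sym_def pop_sym_def by presburger+

lemma stack_run_pops:
  "stack_run K st (map pop_sym p @ w) \<longleftrightarrow> (\<exists>st'. st = p @ st' \<and> stack_run K st' w)"
proof (induction p arbitrary: st)
  case (Cons a p)
  have "stack_run K st (pop_sym a # v) \<longleftrightarrow> (\<exists>st'. st = a # st' \<and> stack_run K st' v)" for v
    by (subst stack_run.simps) auto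
  with Cons show ?case by auto
qed simp

lemma stack_run_pushes:
  "set q \<subseteq> {..<K} \<Longrightarrow> stack_run K st (map push_sym (rev q) @ w) \<longleftrightarrow> stack_run K (q @ st) w"
proof (induction q arbitrary: st w)
  case (Cons a q)
  have "stack_run K st (push_sym a # v) \<longleftrightarrow> a < K \<and> stack_run K (a # st) v" for v st
    by (subst stack_run.simps) auto
  with Cons show ?case by simp
qed simp

text \<open>The order of the brackets makes the segment replace the stack prefix
  \<open>fst pq\<close> by \<open>snd pq\<close>, with the head of the list as the top of the
  stack.\<close>

definition segment :: "nat list \<times> nat list \<Rightarrow> nat list" where
  "segment pq = 0 # map pop_sym (fst pq) @ map push_sym (rev (snd pq)) @ [1]"

text \<open>Prefix rewriting by a subsequence of the given pairs, in their order, that empties the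
  stack.\<close>

inductive select :: "nat list \<Rightarrow> (nat list \<times> nat list) list \<Rightarrow> bool" where
  "select [] []"
| "select st us \<Longrightarrow> select st (u # us)"
| "select (q @ st) us \<Longrightarrow> select (p @ st) ((p, q) # us)"

lemma stack_run_select:
  assumes "\<forall>(p, q) \<in> set us. set p \<subseteq> {..<K} \<and> set q \<subseteq> {..<K}"
  shows "stack_run K st (concat (map segment us)) \<longleftrightarrow> select st us"
  using assms
proof (induction us arbitrary: st)
  case Nil
  show ?case by (auto elim: stack_run.cases select.cases intro: stack_run.intros select.intros)
next
  case (Cons pq us)
  obtain p q where pq: "pq = (p, q)" by (cases pq)
  let ?u = "map pop_sym p @ map push_sym (rev q)"
  let ?w = "concat (map segment us)"
  have K: "set p \<subseteq> {..<K}" "set q \<subseteq> {..<K}" using Cons.prems pq by auto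
  have u: "set ?u \<subseteq> {2..<2 * K + 2}"
    using K by (fastforce simp: push_sym_def pop_sym_def)
  have one: "stack_run K st (1 # v) \<longleftrightarrow> stack_run K st v" for st v
    by (subst stack_run.simps) auto
  \<comment> \<open>No bracket equals 1, so a skip that starts at the delimiter 0 must end at the
    closing delimiter of the same segment.\<close>
  have split: "v = v' \<and> y = y'" if "v @ Suc 0 # y = v' @ Suc 0 # y'" "set v \<subseteq> {2..<n}" "set v' \<subseteq> {2..<n}"
    for v v' y y' n
    using that
  proof (induction v arbitrary: v')
    case Nil
    then show ?case by (cases v') auto
  next
    case (Cons a v)
    then show ?case by (cases v') auto
  qed
  have zero: "stack_run K st (0 # ?u @ 1 # ?w) \<longleftrightarrow>
      stack_run K st (?u @ 1 # ?w) \<or> stack_run K st ?w"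
  proof
    assume "stack_run K st (0 # ?u @ 1 # ?w)"
    then show "stack_run K st (?u @ 1 # ?w) \<or> stack_run K st ?w"
    proof cases
      case (Skip u' v)
      then have "?u @ Suc 0 # ?w = u' @ Suc 0 # v" by simp
      from split[OF this u Skip(2)] show ?thesis using Skip by simp
    qed auto
  next
    assume "stack_run K st (?u @ 1 # ?w) \<or> stack_run K st ?w"
    then show "stack_run K st (0 # ?u @ 1 # ?w)"
      using stack_run.Skip[OF u] stack_run.Delim[of 0] by auto
  qed
  have "stack_run K st (concat (map segment (pq # us))) \<longleftrightarrow>
      stack_run K st (?u @ 1 # ?w) \<or> stack_run K st ?w"
    using zero by (simp add: segment_def pq)
  also have "stack_run K st (?u @ 1 # ?w) \<longleftrightarrow> (\<exists>st'. st = p @ st' \<and> stack_run K (q @ st') ?w)"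
    using K one by (simp add: stack_run_pops stack_run_pushes)
  also have "(\<exists>st'. st = p @ st' \<and> stack_run K (q @ st') ?w) \<or> stack_run K st ?w \<longleftrightarrow> select st (pq # us)"
    using Cons by (subst select.simps) (auto simp: pq)
  finally show ?case .
qed


section \<open>Horn rules with polynomial derivations\<close>

type_synonym 'r atom = "'r \<times> nat list"

definition inst :: "(nat \<Rightarrow> nat) \<Rightarrow> 'r atom \<Rightarrow> 'r atom" where
  "inst env a = (fst a, map env (snd a))"

text \<open>\<open>proves R e x N t fs\<close>: the facts \<open>fs\<close> have derivations with \<open>t\<close> nodes in total.  The input
  is given by the facts \<open>e c (j - 1, j)\<close>, with arithmetic modulo \<open>N\<close>, where \<open>c\<close> is the content
  of cell \<open>j\<close>.\<close>

inductive proves :: "('r atom \<times> 'r atom list) list \<Rightarrow> ('a cell \<Rightarrow> 'r) \<Rightarrow> 'a list \<Rightarrow> nat \<Rightarrow>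
    nat \<Rightarrow> 'r atom list \<Rightarrow> bool"
  for R e x N where
  Nil: "proves R e x N 0 []"
| Edge: "j < N \<Longrightarrow> proves R e x N t fs \<Longrightarrow>
    proves R e x N (Suc t) ((e (in_cell x j), [(j + (N - 1)) mod N, j]) # fs)"
| Rule: "(h, bs) \<in> set R \<Longrightarrow> (\<And>i. env i < N) \<Longrightarrow> proves R e x N t (map (inst env) bs @ fs) \<Longrightarrow>
    proves R e x N (Suc t) (inst env h # fs)"

text \<open>The stack symbols 0 and 1 are reserved for bits. The arity is part of the symbol, so the
  code of an atom determines its own length and codes of the same width l are prefix-free.\<close>

definition rel_sym :: "'r::countable \<Rightarrow> nat \<Rightarrow> nat" where
  "rel_sym r k = 2 + to_nat (r, k)"

definition code :: "nat \<Rightarrow> 'r::countable atom \<Rightarrow> nat list" where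
  "code l a = rel_sym (fst a) (length (snd a)) # concat (map (bits l) (snd a))"

lemma bits_mod: "bits l (v mod 2 ^ l) = bits l v"
  by (simp add: bits_def nbit_mod)

lemma bits_cong: "v mod 2 ^ l = w mod 2 ^ l \<Longrightarrow> bits l v = bits l w"
  by (metis bits_mod)

lemma bits_inj:
  assumes "bits l v = bits l w" "v < 2 ^ l" "w < 2 ^ l"
  shows "v = w"
proof -
  have "nbit v i = nbit w i" if "i < l" for i
    using assms(1) that by (simp add: bits_def)
  then have "bit v i = bit w i" if "i < l" for i
    using that by (simp add: bit_iff_odd nbit_def odd_iff_mod_2_eq_one)
  then have "take_bit l v = take_bit l w"
    by (intro bit_eqI) (auto simp: bit_take_bit_iff)
  then show ?thesis
    using assms(2,3) by (simp add: take_bit_eq_mod)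
qed

lemma concat_bits_inj:
  assumes "length vs = length ws" "\<forall>v \<in> set vs. v < 2 ^ l" "\<forall>w \<in> set ws. w < 2 ^ l"
    and "concat (map (bits l) vs) @ st = concat (map (bits l) ws) @ st'"
  shows "vs = ws \<and> st = st'"
  using assms
proof (induction vs ws rule: list_induct2)
  case (Cons v vs w ws)
  then have "bits l v = bits l w" "concat (map (bits l) vs) @ st = concat (map (bits l) ws) @ st'"
    by (auto simp: append_eq_append_conv bits_def)
  then show ?case using Cons bits_inj by auto
qed simp

lemma code_inj:
  assumes "\<forall>v \<in> set (snd a). v < 2 ^ l" "\<forall>w \<in> set (snd b). w < 2 ^ l"
    and "code l a @ st = code l b @ st'"
  shows "a = b \<and> st = st'"
proof -
  have "rel_sym (fst a) (length (snd a)) = rel_sym (fst b) (length (snd b))"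
    using assms(3) by (simp add: code_def)
  then have "fst a = fst b" "length (snd a) = length (snd b)"
    by (simp_all add: rel_sym_def)
  then show ?thesis
    using concat_bits_inj[of "snd a" "snd b" l st st'] assms
    by (auto simp: code_def prod_eq_iff)
qed

text \<open>Variable i of a rule lives on track \<open>Suc i\<close>, because track 0 holds a
  predecessor.\<close>

definition pop_atom :: "'r::countable atom \<Rightarrow> 'a instr list" where
  "pop_atom a = Out (\<lambda>_. pop_sym (rel_sym (fst a) (length (snd a)))) # map (\<lambda>i. Pop (Suc i)) (snd a)"

definition push_atom :: "'r::countable atom \<Rightarrow> 'a instr list" where
  "push_atom a = map (\<lambda>i. Push (Suc i)) (rev (snd a)) @
     [Out (\<lambda>_. push_sym (rel_sym (fst a) (length (snd a))))]"

definition rule_prog :: "'r::countable atom \<times> 'r atom list \<Rightarrow> 'a instr list" where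
  "rule_prog r = Out (\<lambda>_. 0) # pop_atom (fst r) @ concat (map push_atom (rev (snd r))) @ [Out (\<lambda>_. 1)]"

text \<open>Tracks 0 and 1 hold the predecessor of j and j itself while the input head sees the
  content of cell j. The segment therefore pops precisely the input fact for j.\<close>

definition edge_prog :: "('a cell \<Rightarrow> 'r::countable) \<Rightarrow> 'a instr list" where
  "edge_prog e = [Out (\<lambda>_. 0), Out (\<lambda>c. pop_sym (rel_sym (e c) 2)), Pop 0, Pop 1, Out (\<lambda>_. 1)]"

definition choices :: "('r::countable atom \<times> 'r atom list) list \<Rightarrow> ('a cell \<Rightarrow> 'r) \<Rightarrow> 'a cell \<Rightarrow>
    nat \<Rightarrow> (nat \<Rightarrow> nat) \<Rightarrow> (nat list \<times> nat list) list" where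
  "choices R e c l v =
     (code l (e c, [v 0, v 1]), []) #
     map (\<lambda>(h, bs). (code l (inst (v \<circ> Suc) h), concat (map (code l \<circ> inst (v \<circ> Suc)) bs))) R"

lemma pop_atom_out:
  "concat (map (instr_out c l v) (pop_atom a)) = map pop_sym (code l (inst (v \<circ> Suc) a))"
proof -
  have "concat (map (instr_out c l v) (map (\<lambda>i. Pop (Suc i)) is)) =
      map pop_sym (concat (map (bits l) (map (v \<circ> Suc) is)))" for "is"
    by (induction "is") auto
  then show ?thesis by (simp add: pop_atom_def code_def inst_def)
qed

lemma push_atom_out:
  "concat (map (instr_out c l v) (push_atom a)) = map push_sym (rev (code l (inst (v \<circ> Suc) a)))"
proof -
  have "concat (map (instr_out c l v) (map (\<lambda>i. Push (Suc i)) (rev is))) =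
      map push_sym (rev (concat (map (bits l) (map (v \<circ> Suc) is))))" for "is"
    by (induction "is") auto
  then show ?thesis by (simp add: push_atom_def code_def inst_def)
qed

lemma choices_out:
  "concat (map (instr_out c l v) (edge_prog e @ concat (map rule_prog R))) =
     concat (map segment (choices R e c l v))"
proof -
  have push: "concat (map (instr_out c l v) (concat (map push_atom (rev bs)))) =
      map push_sym (rev (concat (map (code l \<circ> inst (v \<circ> Suc)) bs)))" for bs :: "'b atom list"
    by (induction bs) (simp_all add: push_atom_out comp_def)
  have "concat (map (instr_out c l v) (rule_prog (h, bs))) =
      segment (code l (inst (v \<circ> Suc) h), concat (map (code l \<circ> inst (v \<circ> Suc)) bs))"
    for h :: "'b atom" and bs
    using push[of bs] by (simp add: rule_prog_def segment_def pop_atom_out)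
  then have "concat (map (instr_out c l v) (concat (map rule_prog R))) = concat (map segment
      (map (\<lambda>(h, bs). (code l (inst (v \<circ> Suc) h), concat (map (code l \<circ> inst (v \<circ> Suc)) bs))) R))"
    by (induction R) (auto simp del: map_concat)
  then show ?thesis
    by (simp add: choices_def edge_prog_def segment_def code_def numeral_2_eq_2)
qed


section \<open>Selections of rule instances correspond to derivations\<close>

lemma select_skip: "select st us \<Longrightarrow> select st (us' @ us)"
  by (induction us') (auto intro: select.intros)

text \<open>The stack is always the concatenated code of the open goals. As codes are prefix-free,
  popping the code of a rule head removes exactly the foremost goal. Counter values act as a
  valuation after reduction modulo N, which their bits do not notice.\<close>

lemma select_proves:
  assumes "select (concat (map (code l) fs)) us" and N: "N = 2 ^ l"
    and "\<forall>u \<in> set us. \<exists>E. u \<in> set (choices R e (in_cell x (E mod N)) l (digits l E))"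
    and "\<forall>f \<in> set fs. \<forall>v \<in> set (snd f). v < N"
  shows "\<exists>t. proves R e x N t fs"
  using assms(1,3,4)
proof (induction "concat (map (code l) fs)" us arbitrary: fs rule: select.induct)
  case 1
  then have "fs = []" by (cases fs) (auto simp: code_def)
  then show ?case by (auto intro: proves.Nil)
next
  case (2 us u)
  then show ?case by simp
next
  case (3 q st us p)
  have "0 < N" by (simp add: N)
  have dig: "digits l E (Suc i) = E div N ^ i" for E i
    by (simp add: digits_def N)
  obtain E where "(p, q) \<in> set (choices R e (in_cell x (E mod N)) l (digits l E))"
    using 3 by auto
  then consider (Edge) "p = code l (e (in_cell x (E mod N)), [digits l E 0, digits l E 1])" "q = []"
    | (Rule) h bs where "(h, bs) \<in> set R" "p = code l (inst (digits l E \<circ> Suc) h)"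
      "q = concat (map (code l \<circ> inst (digits l E \<circ> Suc)) bs)"
    by (auto simp: choices_def)
  then obtain h gs where h: "p = code l h" "q = concat (map (code l) gs)"
    "\<forall>v \<in> set (snd h). v < N" "\<forall>f \<in> set gs. \<forall>v \<in> set (snd f). v < N"
    and step: "\<And>t fs. proves R e x N t (gs @ fs) \<Longrightarrow> proves R e x N (Suc t) (h # fs)"
  proof cases
    case Edge
    define j where "j = E mod N"
    have "bits l (digits l E 0) = bits l ((j + (N - 1)) mod N)"
      unfolding j_def N digits_def nat.case by (rule bits_cong) (simp only: mod_add_left_eq mod_mod_trivial)
    moreover have "bits l (digits l E 1) = bits l j"
      by (simp add: digits_def j_def N bits_mod)
    ultimately have "p = code l (e (in_cell x j), [(j + (N - 1)) mod N, j])"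
      using Edge by (simp add: code_def j_def)
    moreover have "j < N" using \<open>0 < N\<close> by (simp add: j_def)
    ultimately show thesis
      using Edge(2) proves.Edge[of j N R e x]
      by (intro that[of "(e (in_cell x j), [(j + (N - 1)) mod N, j])" "[]"]) (auto simp del: One_nat_def)
  next
    case Rule
    define env where "env i = digits l E (Suc i) mod N" for i
    have code: "code l (inst (digits l E \<circ> Suc) a) = code l (inst env a)" for a :: "'a atom"
      by (simp add: code_def inst_def env_def N bits_mod comp_def)
    have env: "env i < N" for i using \<open>0 < N\<close> by (simp add: env_def)
    show thesis
    proof (rule that)
      show "p = code l (inst env h)" "q = concat (map (code l) (map (inst env) bs))"
        using Rule code by (simp_all add: comp_def)
      show "proves R e x N (Suc t) (inst env h # fs)"
        if "proves R e x N t (map (inst env) bs @ fs)" for t fs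
        using Rule(1) env that by (rule proves.Rule)
    qed (use env in \<open>auto simp: inst_def\<close>)
  qed
  have "fs \<noteq> []" using 3(3) h(1) by (auto simp: code_def)
  then obtain f fs' where fs: "fs = f # fs'" by (cases fs) auto
  then have "code l f @ concat (map (code l) fs') = code l h @ st"
    using 3(3) h(1) by simp
  then have "f = h" "concat (map (code l) fs') = st"
    using code_inj[of f l h] 3(5) h(3) fs N by auto
  moreover have "\<forall>f \<in> set (gs @ fs'). \<forall>v \<in> set (snd f). v < N"
    using h(4) 3(5) fs by auto
  moreover have "\<forall>u \<in> set us. \<exists>E. u \<in> set (choices R e (in_cell x (E mod N)) l (digits l E))"
    using 3(4) by auto
  ultimately obtain t where "proves R e x N t (gs @ fs')"
    using 3(2)[of "gs @ fs'"] h(2) by auto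
  then show ?case using step fs \<open>f = h\<close> by blast
qed

lemma upt_split:
  assumes "c \<le> d" "a \<le> i" "Suc i \<le> c"
  shows "[a..<d] = [a..<i] @ i # [Suc i..<c] @ [c..<d]"
proof -
  have append: "[j..<n] = [j..<k] @ [k..<n]" if "j \<le> k" "k \<le> n" for j k n :: nat
    using that upt_add_eq_append[of j k "n - k"] by simp
  have "[a..<d] = [a..<i] @ [i..<d]" using assms by (intro append) auto
  also have "[i..<d] = i # [Suc i..<d]" using assms by (intro upt_conv_Cons) auto
  also have "[Suc i..<d] = [Suc i..<c] @ [c..<d]" using assms by (intro append) auto
  finally show ?thesis .
qed

lemma digit_shift:
  fixes N :: nat
  assumes "i < K" "0 < N"
  shows "((b * N ^ K + E) div N ^ i) mod N = (E div N ^ i) mod N"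
proof -
  have "N ^ K = N ^ i * N * N ^ (K - Suc i)"
    using assms(1) by (metis Suc_leI le_add_diff_inverse power_Suc2 power_add)
  then have "b * N ^ K + E = E + N ^ i * (N * (N ^ (K - Suc i) * b))"
    by (simp add: ac_simps)
  then have "(b * N ^ K + E) div N ^ i = N * (N ^ (K - Suc i) * b) + E div N ^ i"
    using assms(2) by (simp only: div_mult_self2 power_eq_0_iff) simp
  then show ?thesis by simp
qed

lemma exists_digits:
  fixes N :: nat
  assumes "\<And>i. env i < N"
  shows "\<exists>E < N ^ K. \<forall>i<K. (E div N ^ i) mod N = env i"
proof (induction K)
  case (Suc K)
  have "0 < N" using assms[of 0] by simp
  from Suc obtain E where E: "E < N ^ K" "\<forall>i<K. (E div N ^ i) mod N = env i" by auto
  define E' where "E' = env K * N ^ K + E"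
  have "E' < N ^ Suc K"
  proof -
    have "E' < Suc (env K) * N ^ K" using E(1) by (simp add: E'_def)
    also have "\<dots> \<le> N * N ^ K" using assms[of K] by (intro mult_right_mono) auto
    finally show ?thesis by simp
  qed
  moreover have "(E' div N ^ i) mod N = env i" if "i < Suc K" for i
  proof (cases "i = K")
    case True
    then show ?thesis using E(1) assms[of K] \<open>0 < N\<close> by (simp add: E'_def)
  next
    case False
    with that show ?thesis
      using E(2) digit_shift[of i K N "env K" E] \<open>0 < N\<close> by (simp add: E'_def)
  qed
  ultimately show ?case by blast
qed simp

text \<open>A round consists of \<open>N ^ K\<close> consecutive odometer values. By
  \<open>digit_shift\<close>, the lowest K digits run through all valuations of the rule variables
  in every round, so each round offers every instance. A derivation with t nodes is replayed with
  one instance per round, starting in round b.\<close>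

lemma proves_select:
  assumes "proves R e x N t fs" and N: "N = 2 ^ l"
    and vars: "\<And>h bs a i. (h, bs) \<in> set R \<Longrightarrow> a \<in> insert h (set bs) \<Longrightarrow> i \<in> set (snd a) \<Longrightarrow> i < K"
    and "0 < K" and "b + t \<le> T"
  shows "select (concat (map (code l) fs)) (concat (map
    (\<lambda>E. choices R e (in_cell x (E mod N)) l (digits l E)) [b * N ^ K..<T * N ^ K]))"
proof -
  define ch where "ch E = choices R e (in_cell x (E mod N)) l (digits l E)" for E
  define us where "us b = concat (map ch [b * N ^ K..<T * N ^ K])" for b
  have "0 < N" by (simp add: N)
  \<comment> \<open>One round: skip up to the wanted instance, apply it, and skip the rest.\<close>
  have advance: "select (p @ st) (us b)"
    if E: "E < N ^ K" "(p, q) \<in> set (ch (b * N ^ K + E))" and "Suc b \<le> T"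
      and "select (q @ st) (us (Suc b))" for p q st b E
  proof -
    define F where "F = b * N ^ K + E"
    have "Suc b * N ^ K \<le> T * N ^ K" using that(3) by (rule mult_right_mono) simp
    moreover have "b * N ^ K \<le> F" "Suc F \<le> Suc b * N ^ K" using E(1) by (simp_all add: F_def)
    ultimately have upt: "[b * N ^ K..<T * N ^ K] =
        [b * N ^ K..<F] @ F # [Suc F..<Suc b * N ^ K] @ [Suc b * N ^ K..<T * N ^ K]"
      by (intro upt_split)
    obtain ys zs where ch: "ch F = ys @ (p, q) # zs"
      using E(2) unfolding F_def by (metis split_list)
    define rest where "rest = zs @ concat (map ch [Suc F..<Suc b * N ^ K])"
    have us: "us b = (concat (map ch [b * N ^ K..<F]) @ ys) @ (p, q) # rest @ us (Suc b)"
      unfolding us_def upt rest_def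
      by (simp only: ch map_append list.map concat_append concat.simps append_assoc append_Cons)
    have "select (p @ st) ((p, q) # rest @ us (Suc b))"
      using that(4) by (intro select.intros(3) select_skip)
    then show ?thesis
      unfolding us by (rule select_skip)
  qed
  have "select (concat (map (code l) fs)) (us b)"
    using assms(1,5)
  proof (induction arbitrary: b rule: proves.induct)
    case Nil
    show ?case
      using select_skip[OF select.intros(1), of "us b"] by simp
  next
    case (Edge j t fs)
    have "N ^ 1 \<le> N ^ K" using \<open>0 < K\<close> \<open>0 < N\<close> by (intro power_increasing) auto
    then have "j < N ^ K" using Edge(1) by simp
    have mem: "(code l (e (in_cell x j), [(j + (N - 1)) mod N, j]), []) \<in> set (ch (b * N ^ K + j))"
    proof -
      have j: "(b * N ^ K + j) mod N = j"
        using digit_shift[of 0 K N b j] assms(4) Edge(1) by simp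
      have "bits l (digits l (b * N ^ K + j) 0) = bits l ((j + (N - 1)) mod N)"
      proof -
        have "(b * N ^ K + j + (2 ^ l - 1)) mod 2 ^ l = ((b * N ^ K + j) mod N + (N - 1)) mod N"
          unfolding N by (simp only: mod_add_left_eq)
        then have "(b * N ^ K + j + (2 ^ l - 1)) mod 2 ^ l = (j + (N - 1)) mod N mod 2 ^ l"
          unfolding j by (simp only: N mod_mod_trivial)
        then show ?thesis
          unfolding digits_def nat.case by (rule bits_cong)
      qed
      moreover have "bits l (digits l (b * N ^ K + j) 1) = bits l j"
        using j Edge(1) by (intro bits_cong) (simp add: digits_def N)
      ultimately show ?thesis using j by (simp add: ch_def choices_def code_def)
    qed
    have "Suc b \<le> T" "Suc b + t \<le> T" using Edge.prems by simp_all
    then have "select (code l (e (in_cell x j), [(j + (N - 1)) mod N, j]) @ concat (map (code l) fs)) (us b)"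
      using Edge.IH by (intro advance[OF \<open>j < N ^ K\<close> mem]) (simp_all only: append_Nil)
    then show ?case by (simp only: list.map concat.simps)
  next
    case (Rule h bs env t fs)
    obtain E where E: "E < N ^ K" "\<And>i. i < K \<Longrightarrow> (E div N ^ i) mod N = env i"
      using exists_digits[of env N K] Rule(2) by blast
    define v where "v = digits l (b * N ^ K + E) \<circ> Suc"
    have "v i mod N = env i" if "i < K" for i
      using digit_shift[OF that \<open>0 < N\<close>, of b E] E(2)[OF that] by (simp add: v_def digits_def N)
    then have v: "bits l (v i) = bits l (env i)" if "i < K" for i
      using that by (metis N bits_mod)
    have code: "code l (inst v a) = code l (inst env a)" if "a \<in> insert h (set bs)" for a
    proof -
      have "map (bits l \<circ> v) (snd a) = map (bits l \<circ> env) (snd a)"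
        using vars[OF Rule(1) that] v by auto
      then have "concat (map (bits l \<circ> v) (snd a)) = concat (map (bits l \<circ> env) (snd a))"
        by (rule arg_cong)
      then show ?thesis by (simp add: code_def inst_def)
    qed
    have "map (code l \<circ> inst v) bs = map (code l) (map (inst env) bs)"
      using code by simp
    then have "concat (map (code l \<circ> inst v) bs) = concat (map (code l) (map (inst env) bs))"
      by (rule arg_cong)
    moreover have "(code l (inst v h), concat (map (code l \<circ> inst v) bs)) \<in> set (ch (b * N ^ K + E))"
      unfolding ch_def choices_def v_def[symmetric] list.set set_map
      by (intro insertI2 image_eqI[of _ _ "(h, bs)"]) (simp_all add: Rule(1))
    ultimately have mem: "(code l (inst env h), concat (map (code l) (map (inst env) bs))) \<in> set (ch (b * N ^ K + E))"
      using code[of h] by simp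
    have "Suc b \<le> T" "Suc b + t \<le> T" using Rule.prems by simp_all
    then have "select (code l (inst env h) @ concat (map (code l) fs)) (us b)"
      using Rule.IH[of "Suc b"] by (intro advance[OF E(1) mem]) (simp_all only: map_append concat_append)
    then show ?case by (simp only: list.map concat.simps)
  qed
  then show ?thesis by (simp add: us_def ch_def[abs_def])
qed

section \<open>Rule systems with polynomial derivations define languages in LOGCFL\<close>

theorem proves_LOGCFL:
  fixes R :: "('r::countable atom \<times> 'r atom list) list" and A :: "'a::finite list set"
  assumes sound: "\<And>x t. proves R e x (2 ^ bitlength (Suc (length x))) t [(g, [])] \<Longrightarrow> x \<in> A"
    and complete: "\<And>x. x \<in> A \<Longrightarrow> \<exists>t \<le> (2 ^ bitlength (Suc (length x))) ^ T.
      proves R e x (2 ^ bitlength (Suc (length x))) t [(g, [])]"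
  shows "A \<in> LOGCFL"
proof -
  define P :: "'a instr list" where "P = edge_prog e @ concat (map rule_prog R)"
  define atoms where "atoms = (\<Union>(h, bs) \<in> set R. insert h (set bs))"
  have fin: "finite atoms" by (auto simp: atoms_def)
  define I where "I = (\<Union>a \<in> atoms. set (snd a))"
  have "finite I" using fin by (auto simp: I_def)
  then obtain k where "I \<subseteq> {..<k}"
    unfolding finite_nat_set_iff_bounded by auto
  \<comment> \<open>Passing to \<open>Suc k\<close> makes K positive: even without rule variables,
    the input facts use the counter on track 1.\<close>
  then have "I \<subseteq> {..<Suc k}" by auto
  then obtain K where K: "I \<subseteq> {..<K}" "0 < K" by blast
  \<comment> \<open>The lower K counters are the rule variables. The other T merely repeat their
    enumeration \<open>N ^ T\<close> times, which is the bound on the number of nodes.\<close>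
  define M where "M = K + T"
  define syms where "syms = {0, 1, rel_sym g 0} \<union> (\<lambda>a. rel_sym (fst a) (length (snd a))) ` atoms \<union>
    (\<lambda>c. rel_sym (e c) 2) ` UNIV"
  have "(UNIV :: 'a cell set) \<subseteq> {LeftEnd, RightEnd} \<union> range Input"
  proof
    fix c :: "'a cell"
    show "c \<in> {LeftEnd, RightEnd} \<union> range Input" by (cases c) auto
  qed
  then have "finite (UNIV :: 'a cell set)"
    by (rule finite_subset) simp
  then have "finite syms" using fin by (simp add: syms_def)
  then obtain S where S: "syms \<subseteq> {..<S}"
    unfolding finite_nat_set_iff_bounded by auto
  define N :: "'a list \<Rightarrow> nat" where "N x = 2 ^ bitlength (Suc (length x))" for x
  define ch where "ch x E = choices R e (in_cell x (E mod N x)) (bitlength (Suc (length x)))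
    (digits (bitlength (Suc (length x))) E)" for x E
  define us where "us x = concat (map (ch x) [0..<N x ^ M])" for x
  define f where "f x = push_sym (rel_sym g 0) # concat (map segment (us x))" for x
  have vars: "i < K" if "(h, bs) \<in> set R" "a \<in> insert h (set bs)" "i \<in> set (snd a)" for h bs a i
    using that K by (auto simp: I_def atoms_def)
  have "logspace_computable f"
  proof -
    have *: "Suc i \<le> M" if "(h, bs) \<in> set R" "a \<in> insert h (set bs)" "i \<in> set (snd a)" for h bs a i
      using vars[OF that] by (simp add: M_def)
    have rule: "k \<le> M" if "r \<in> set R" "Pop k \<in> set (rule_prog r) \<or> Push k \<in> set (rule_prog r)" for r k
    proof -
      obtain h bs where r: "r = (h, bs)" by (cases r)
      with that(2) consider (Head) i where "i \<in> set (snd h)" "k = Suc i"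
        | (Body) a i where "a \<in> set bs" "i \<in> set (snd a)" "k = Suc i"
        by (auto simp: rule_prog_def pop_atom_def push_atom_def)
      then show ?thesis
      proof cases
        case (Head i)
        then show ?thesis using *[of h bs h i] that(1) r by simp
      next
        case (Body a i)
        then show ?thesis using *[of h bs a i] that(1) r by simp
      qed
    qed
    have tracks: "k \<le> M" if "Pop k \<in> set P \<or> Push k \<in> set P" for k
    proof -
      from that obtain i where i: "i = Pop k \<or> i = Push k" "i \<in> set P" by metis
      then consider "i \<in> set (edge_prog e)" | r where "r \<in> set R" "i \<in> set (rule_prog r)"
        by (auto simp: P_def)
      then show ?thesis
      proof cases
        case 1
        then have "k \<le> 1" using i(1) by (auto simp: edge_prog_def)
        then show ?thesis using \<open>0 < K\<close> by (simp add: M_def)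
      next
        case 2
        then show ?thesis using rule[of r k] i(1) by metis
      qed
    qed
    have f: "f x = push_sym (rel_sym g 0) # concat (map
        (\<lambda>E. let l = bitlength (Suc (length x)) in
          concat (map (instr_out (in_cell x (E mod 2 ^ l)) l (digits l E)) P))
        [0..<(2 ^ bitlength (Suc (length x))) ^ M])" for x
    proof -
      have "concat (map segment (concat (map g Es))) = concat (map (\<lambda>E. concat (map segment (g E))) Es)"
        for g :: "nat \<Rightarrow> (nat list \<times> nat list) list" and Es
        by (induction Es) auto
      then show ?thesis
        unfolding f_def us_def P_def ch_def N_def choices_out Let_def by simp
    qed
    show ?thesis
      unfolding f[abs_def] using \<open>0 < K\<close> tracks by (intro logspace_odometer) (auto simp: M_def)
  qed
  moreover have "x \<in> A \<longleftrightarrow> f x \<in> {w. skip_dyck S w}" for x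
  proof -
    define l where "l = bitlength (Suc (length x))"
    have N: "N x = 2 ^ l" by (simp add: N_def l_def)
    have code: "set (code l a) \<subseteq> {..<S}" if "rel_sym (fst a) (length (snd a)) \<in> syms" for a :: "'r atom"
    proof -
      have "rel_sym (fst a) (length (snd a)) < S" "1 < S" using S that by (auto simp: syms_def)
      moreover have "nbit v i < S" for v i using nbit_less_2[of v i] \<open>1 < S\<close> by linarith
      ultimately show ?thesis by (auto simp: code_def bits_def)
    qed
    have "\<forall>(p, q) \<in> set (us x). set p \<subseteq> {..<S} \<and> set q \<subseteq> {..<S}"
    proof (clarify)
      fix p q assume "(p, q) \<in> set (us x)"
      then obtain E where "(p, q) \<in> set (ch x E)" by (auto simp: us_def)
      then consider (Edge) "p = code l (e (in_cell x (E mod N x)), [digits l E 0, digits l E 1])" "q = []"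
        | (Rule) h bs where "(h, bs) \<in> set R" "p = code l (inst (digits l E \<circ> Suc) h)"
          "q = concat (map (code l \<circ> inst (digits l E \<circ> Suc)) bs)"
        by (auto simp: ch_def choices_def l_def)
      then show "set p \<subseteq> {..<S} \<and> set q \<subseteq> {..<S}"
      proof cases
        case Edge
        have "rel_sym (e (in_cell x (E mod N x))) 2 \<in> syms"
          unfolding syms_def by blast
        moreover have "length [digits l E 0, digits l E 1] = 2"
          by simp
        ultimately have "rel_sym (e (in_cell x (E mod N x))) (length [digits l E 0, digits l E 1]) \<in> syms"
          by (simp only:)
        then have "set (code l (e (in_cell x (E mod N x)), [digits l E 0, digits l E 1])) \<subseteq> {..<S}"
          by (intro code) (simp only: fst_conv snd_conv)
        then show ?thesis unfolding Edge by simp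
      next
        case Rule
        define v where "v = digits l E \<circ> Suc"
        have "set (code l (inst v a)) \<subseteq> {..<S}" if "a \<in> insert h (set bs)" for a
          using that Rule(1) by (intro code) (auto simp: inst_def syms_def atoms_def)
        then have "set (code l (inst v h)) \<subseteq> {..<S}" "\<forall>b \<in> set bs. set (code l (inst v b)) \<subseteq> {..<S}"
          by auto
        then show ?thesis unfolding Rule(2,3) v_def[symmetric] by (auto simp del: lessThan_iff)
      qed
    qed
    then have run: "stack_run S st (concat (map segment (us x))) \<longleftrightarrow> select st (us x)" for st
      by (rule stack_run_select)
    have "rel_sym g 0 < S" using S by (simp add: syms_def)
    then have "skip_dyck S (f x) \<longleftrightarrow> select [rel_sym g 0] (us x)"
      using run stack_run_pushes[of "[rel_sym g 0]" S "[]"] by (simp add: skip_dyck_iff_run f_def)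
    also have "[rel_sym g 0] = concat (map (code l) [(g, [])])"
      by (simp add: code_def)
    finally have iff: "skip_dyck S (f x) \<longleftrightarrow> select (concat (map (code l) [(g, [])])) (us x)" .
    show ?thesis
    proof
      assume "x \<in> A"
      from complete[OF this] obtain t where t: "t \<le> N x ^ T" "proves R e x (N x) t [(g, [])]"
        unfolding N_def by blast
      have "select (concat (map (code l) [(g, [])])) (concat (map
          (\<lambda>E. choices R e (in_cell x (E mod N x)) l (digits l E)) [0 * N x ^ K..<N x ^ T * N x ^ K]))"
        by (rule proves_select[OF t(2) N vars]) (use t(1) K(2) in simp_all)
      moreover have "N x ^ T * N x ^ K = N x ^ M"
        by (simp add: M_def power_add)
      ultimately have "select (concat (map (code l) [(g, [])])) (us x)"
        unfolding us_def ch_def l_def by (simp only: mult_0)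
      then show "f x \<in> {w. skip_dyck S w}"
        using iff by blast
    next
      assume "f x \<in> {w. skip_dyck S w}"
      then have "select (concat (map (code l) [(g, [])])) (us x)" using iff by blast
      then have "\<exists>t. proves R e x (N x) t [(g, [])]"
      proof (rule select_proves[OF _ N])
        show "\<forall>u \<in> set (us x). \<exists>E. u \<in> set (choices R e (in_cell x (E mod N x)) l (digits l E))"
        proof
          fix u
          assume "u \<in> set (us x)"
          then obtain E where "u \<in> set (ch x E)" by (auto simp: us_def)
          then show "\<exists>E. u \<in> set (choices R e (in_cell x (E mod N x)) l (digits l E))"
            unfolding ch_def l_def by (rule exI)
        qed
      qed simp
      then obtain t where "proves R e x (N x) t [(g, [])]" ..
      then show "x \<in> A" unfolding N_def by (rule sound)
    qed
  qed
  ultimately show ?thesis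
    unfolding LOGCFL_def using context_free_skip_dyck[of S]
    by (intro CollectI exI[of _ f] exI[of _ "{w. skip_dyck S w}"] conjI allI)
qed

section \<open>Variable-free formulas\<close>

primrec high :: "('w \<times> 'w) set \<Rightarrow> 'w set \<Rightarrow> nat \<Rightarrow> 'w set" where
  "high A W 0 = W"
| "high A W (Suc d) = {a. \<exists>b \<in> high A W d. (a, b) \<in> A}"

lemma high_antimono:
  assumes "A \<subseteq> W \<times> W" "d \<le> d'"
  shows "high A W d' \<subseteq> high A W d"
proof -
  have "high A W (Suc d) \<subseteq> high A W d" for d
  proof (induction d)
    case 0
    show ?case using assms(1) by auto
  next
    case (Suc d)
    then show ?case unfolding high.simps by blast
  qed
  then show ?thesis using assms(2) by (rule lift_Suc_antimono_le[of "high A W"])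
qed

lemma high_subset: "A \<subseteq> W \<times> W \<Longrightarrow> high A W d \<subseteq> W"
  using high_antimono[of A W 0 d] by simp

text \<open>By transitivity every successor of b is one of a, and by irreflexivity b itself is a
  successor of a only. The number of successors is thus a strictly decreasing measure along
  accessibility.\<close>

lemma card_successors_less:
  assumes "finite W" "A \<subseteq> W \<times> W" "trans A" "irrefl A" "(a, b) \<in> A"
  shows "card (A `` {b}) < card (A `` {a})"
proof (rule psubset_card_mono)
  show "finite (A `` {a})"
    using assms(1,2) by (auto intro: finite_subset[of _ W])
  show "A `` {b} \<subset> A `` {a}"
    using assms(3-5) by (auto dest: transD simp: irrefl_def)
qed

lemma high_card_successors:
  assumes "finite W" "A \<subseteq> W \<times> W" "trans A" "irrefl A" "a \<in> high A W d"
  shows "d \<le> card (A `` {a})"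
  using assms(5)
proof (induction d arbitrary: a)
  case (Suc d)
  then obtain b where "b \<in> high A W d" "(a, b) \<in> A" by auto
  then show ?case using Suc.IH[of b] card_successors_less[OF assms(1-4), of a b] by simp
qed simp

lemma high_card_empty:
  assumes "finite W" "A \<subseteq> W \<times> W" "trans A" "irrefl A" "card W \<le> d"
  shows "high A W d = {}"
proof (rule ccontr)
  assume "high A W d \<noteq> {}"
  then obtain a where a: "a \<in> high A W d" by auto
  then have "A `` {a} \<subset> W"
    using assms(2,4) high_subset[of A W d] by (auto simp: irrefl_def)
  then have "card (A `` {a}) < card W" using assms(1) by (rule psubset_card_mono[rotated])
  then show False using high_card_successors[OF assms(1-4) a] assms(5) by simp
qed

text \<open>Among the successors of a in \<open>high A W d\<close>, take one with the fewest
  successors. If it had a successor in \<open>high A W d\<close>, that one would also be a successor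
  of a, by transitivity, and would have still fewer.\<close>

lemma high_exact_successor:
  assumes "finite W" "A \<subseteq> W \<times> W" "trans A" "irrefl A" "a \<in> high A W (Suc d)"
  shows "\<exists>b. (a, b) \<in> A \<and> b \<in> high A W d \<and> b \<notin> high A W (Suc d)"
proof -
  define B where "B = {b. (a, b) \<in> A \<and> b \<in> high A W d}"
  obtain b0 where "b0 \<in> B" using assms(5) by (auto simp: B_def)
  then obtain b where b: "b \<in> B" "\<And>b'. b' \<in> B \<Longrightarrow> card (A `` {b}) \<le> card (A `` {b'})"
    using ex_has_least_nat[of "\<lambda>b. b \<in> B" b0 "\<lambda>b. card (A `` {b})"] by blast
  have "b \<notin> high A W (Suc d)"
  proof
    assume "b \<in> high A W (Suc d)"
    then obtain b' where b': "b' \<in> high A W d" "(b, b') \<in> A" by auto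
    then have "b' \<in> B" using b(1) assms(3) by (auto simp: B_def dest: transD)
    from b(2)[OF this] show False
      using card_successors_less[OF assms(1-4) b'(2)] by simp
  qed
  then show ?thesis using b(1) by (auto simp: B_def)
qed

text \<open>The argument \<open>m\<close> plays the role of infinity; any bound on the number of worlds will do.\<close>

primrec rank :: "nat \<Rightarrow> 'p form \<Rightarrow> nat" where
  "rank m Bot = 0"
| "rank m (Var p) = 0"
| "rank m (Conj \<phi> \<psi>) = min (rank m \<phi>) (rank m \<psi>)"
| "rank m (Disj \<phi> \<psi>) = max (rank m \<phi>) (rank m \<psi>)"
| "rank m (Imp \<phi> \<psi>) = (if rank m \<phi> \<le> rank m \<psi> then m else Suc (rank m \<psi>))"

lemma rank_le: "rank m \<phi> \<le> m"
  by (induction \<phi>) auto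

text \<open>A formula of rank r holds where no chain of r steps starts. An implication with ranks r
  and s fails at a if some successor lies in \<open>H s\<close> but not in \<open>H r\<close>. For r
  at most s this is impossible. For s < r it happens exactly if a is in \<open>H (Suc s)\<close>,
  because a successor in \<open>H s\<close> can then be chosen outside
  \<open>H (Suc s)\<close>.\<close>

lemma sat_iff_rank:
  assumes "FPL_model M" "card (worlds M) \<le> m" "vars \<phi> = {}" "a \<in> worlds M"
  shows "sat M a \<phi> \<longleftrightarrow> a \<notin> high (acc M) (worlds M) (rank m \<phi>)"
  using assms(3,4)
proof (induction \<phi> arbitrary: a)
  case (Conj \<phi> \<psi>)
  have M: "acc M \<subseteq> worlds M \<times> worlds M" using assms(1) by (simp add: FPL_model_def)
  show ?case using Conj high_antimono[OF M, of "rank m \<phi>" "rank m \<psi>"]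
      high_antimono[OF M, of "rank m \<psi>" "rank m \<phi>"]
    by (auto simp: min_def)
next
  case (Disj \<phi> \<psi>)
  have M: "acc M \<subseteq> worlds M \<times> worlds M" using assms(1) by (simp add: FPL_model_def)
  show ?case using Disj high_antimono[OF M, of "rank m \<phi>" "rank m \<psi>"]
      high_antimono[OF M, of "rank m \<psi>" "rank m \<phi>"]
    by (auto simp: max_def)
next
  case (Imp \<phi> \<psi>)
  define H where "H = high (acc M) (worlds M)"
  define r where "r = rank m \<phi>"
  define s where "s = rank m \<psi>"
  have M: "finite (worlds M)" "acc M \<subseteq> worlds M \<times> worlds M" "trans (acc M)" "irrefl (acc M)"
    using assms(1) by (simp_all add: FPL_model_def)
  have sat: "sat M a (Imp \<phi> \<psi>) \<longleftrightarrow> (\<forall>b. (a, b) \<in> acc M \<longrightarrow> b \<notin> H r \<longrightarrow> b \<notin> H s)"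
  proof -
    have "sat M b \<phi> \<longleftrightarrow> b \<notin> H r" "sat M b \<psi> \<longleftrightarrow> b \<notin> H s" if "(a, b) \<in> acc M" for b
      using Imp.IH[of b] Imp.prems that M(2) unfolding H_def r_def s_def by auto
    then show ?thesis by auto
  qed
  show ?case
  proof (cases "r \<le> s")
    case True
    then have "H s \<subseteq> H r" unfolding H_def by (rule high_antimono[OF M(2)])
    moreover have "H m = {}" unfolding H_def by (rule high_card_empty[OF M assms(2)])
    ultimately show ?thesis using sat True by (auto simp: H_def r_def s_def)
  next
    case False
    then have "H r \<subseteq> H (Suc s)" unfolding H_def by (intro high_antimono[OF M(2)]) simp
    moreover have "\<exists>b. (a, b) \<in> acc M \<and> b \<in> H s \<and> b \<notin> H (Suc s)" if "a \<in> H (Suc s)"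
      using that unfolding H_def by (rule high_exact_successor[OF M])
    ultimately have "sat M a (Imp \<phi> \<psi>) \<longleftrightarrow> a \<notin> H (Suc s)"
      unfolding sat by (auto simp: H_def)
    then show ?thesis using False by (simp add: H_def r_def s_def)
  qed
qed auto

section \<open>Rules for model checking\<close>

instance letter :: countable by countable_datatype
instance cell :: (countable) countable by countable_datatype

datatype rel =
    Edge "letter cell" | Zero | Top | Succ | Le | Lt | Min | Max | Arrow | Val
  | Path | Row | Rows | RowBit letter | Entry letter | Up1 | Up | UpRows | Irr
  | High | Avoid | Count | CountTo | Ones | Goal

instance rel :: countable by countable_datatype

type_synonym rel_rule = "rel atom \<times> rel atom list"

text \<open>Only the wrap-around pair (N - 1, 0) is labelled \<open>LeftEnd\<close>, so this label
  defines both zero and the largest number. The pairs with any other label are the successor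
  relation.\<close>

definition number_rules :: "rel_rule list" where
  "number_rules =
    [((Zero, [0]), [(Edge LeftEnd, [1, 0])]),
     ((Top, [0]), [(Edge LeftEnd, [0, 1])])] @
     map (\<lambda>c. ((Succ, [0, 1]), [(Edge c, [0, 1])]))
       (RightEnd # map Input [LBot, LVar, LAnd, LOr, LImp, LOpen, LClose, LZero, LOne, LSemi, LHash]) @
    [((Le, [0, 0]), []),
     ((Le, [0, 2]), [(Le, [0, 1]), (Succ, [1, 2])]),
     ((Lt, [0, 1]), [(Succ, [0, 2]), (Le, [2, 1])]),
     ((Min, [0, 1, 0]), [(Le, [0, 1])]),
     ((Min, [0, 1, 1]), [(Le, [1, 0])]),
     ((Max, [0, 1, 1]), [(Le, [0, 1])]),
     ((Max, [0, 1, 0]), [(Le, [1, 0])]),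
     ((Arrow, [0, 1, 2]), [(Le, [0, 1]), (Top, [2])]),
     ((Arrow, [0, 1, 2]), [(Succ, [1, 2]), (Le, [2, 0])])]"

text \<open>An attribute grammar: \<open>Val (i, j, r)\<close> states that the input from position i
  to j is a variable-free formula of rank r, with N - 1 as infinity.\<close>

definition formula_rules :: "rel_rule list" where
  "formula_rules =
    ((Val, [0, 1, 2]), [(Edge (Input LBot), [0, 1]), (Zero, [2])]) #
    map (\<lambda>(c, f). ((Val, [0, 1, 2]),
        [(Edge (Input LOpen), [0, 3]), (Val, [3, 4, 5]), (Edge (Input c), [4, 6]),
         (Val, [6, 7, 8]), (Edge (Input LClose), [7, 1]), (f, [5, 8, 2])]))
      [(LAnd, Min), (LOr, Max), (LImp, Arrow)]"

text \<open>In the facts about matrices, \<open>n\<close> is the number of worlds and \<open>j\<close> the position where the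
  adjacency matrix starts.\<close>

definition matrix_rules :: "rel_rule list" where
  "matrix_rules =
    [((Path, [0, 1, 0]), [(Zero, [1])]),
     ((Path, [0, 3, 4]), [(Path, [0, 1, 2]), (Succ, [1, 3]), (Edge (Input LZero), [2, 4])]),
     ((Path, [0, 3, 4]), [(Path, [0, 1, 2]), (Succ, [1, 3]), (Edge (Input LOne), [2, 4])]),
     ((Row, [0, 1, 2]), [(Path, [1, 0, 3]), (Edge (Input LSemi), [3, 2])]),
     ((Rows, [0, 1, 2, 2]), [(Zero, [1])]),
     ((Rows, [0, 1, 2, 3]), [(Rows, [0, 4, 2, 5]), (Succ, [4, 1]), (Row, [0, 5, 3])]),
     ((RowBit LZero, [0, 1]), [(Path, [0, 1, 2]), (Edge (Input LZero), [2, 3])]),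
     ((RowBit LOne, [0, 1]), [(Path, [0, 1, 2]), (Edge (Input LOne), [2, 3])]),
     ((Entry LZero, [0, 1, 2, 3]),
        [(Rows, [0, 2, 1, 4]), (RowBit LZero, [4, 3]), (Lt, [2, 0]), (Lt, [3, 0])]),
     ((Entry LOne, [0, 1, 2, 3]),
        [(Rows, [0, 2, 1, 4]), (RowBit LOne, [4, 3]), (Lt, [2, 0]), (Lt, [3, 0])])]"

text \<open>Horn rules lack negation, so an implication between entries is derived from a 0 in a
  premise or a 1 in the conclusion. \<open>UpRows\<close> checks that consecutive rows are upward
  closed sets of worlds. For the rows of the valuation this is monotonicity; for the rows of the
  adjacency matrix itself, which list successors, it is transitivity.\<close>

definition model_rules :: "rel_rule list" where
  "model_rules =
    [((Up1, [0, 1, 2, 3, 4]), [(Zero, [4])]),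
     ((Up1, [0, 1, 2, 3, 5]), [(Up1, [0, 1, 2, 3, 4]), (Succ, [4, 5]), (RowBit LZero, [2, 3])]),
     ((Up1, [0, 1, 2, 3, 5]), [(Up1, [0, 1, 2, 3, 4]), (Succ, [4, 5]), (Entry LZero, [0, 1, 3, 4])]),
     ((Up1, [0, 1, 2, 3, 5]), [(Up1, [0, 1, 2, 3, 4]), (Succ, [4, 5]), (RowBit LOne, [2, 4])]),
     ((Up, [0, 1, 2, 3]), [(Zero, [3])]),
     ((Up, [0, 1, 2, 4]), [(Up, [0, 1, 2, 3]), (Succ, [3, 4]), (Up1, [0, 1, 2, 3, 0])]),
     ((UpRows, [0, 1, 2, 3, 3]), [(Zero, [2])]),
     ((UpRows, [0, 1, 2, 3, 4]),
        [(UpRows, [0, 1, 5, 3, 6]), (Succ, [5, 2]), (Row, [0, 6, 4]), (Up, [0, 1, 6, 0])]),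
     ((Irr, [0, 1, 2]), [(Zero, [2])]),
     ((Irr, [0, 1, 3]), [(Irr, [0, 1, 2]), (Succ, [2, 3]), (Entry LZero, [0, 1, 2, 2])])]"

text \<open>\<open>Count (n, j, d, c)\<close> says that exactly \<open>c\<close> worlds start a chain of \<open>d\<close> steps.  Given this,
  \<open>Avoid (n, j, d, a, n, c)\<close> certifies that \<open>a\<close> starts no chain of \<open>d + 1\<close> steps, by exhibiting \<open>c\<close>
  such worlds that are not successors of \<open>a\<close>.\<close>

definition count_rules :: "rel_rule list" where
  "count_rules =
    [((High, [0, 1, 2, 3]), [(Zero, [3]), (Lt, [2, 0])]),
     ((High, [0, 1, 2, 4]), [(High, [0, 1, 5, 3]), (Succ, [3, 4]), (Entry LOne, [0, 1, 2, 5])]),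
     ((Avoid, [0, 1, 2, 3, 4, 4]), [(Zero, [4])]),
     ((Avoid, [0, 1, 2, 3, 6, 5]), [(Avoid, [0, 1, 2, 3, 4, 5]), (Succ, [4, 6])]),
     ((Avoid, [0, 1, 2, 3, 6, 7]),
        [(Avoid, [0, 1, 2, 3, 4, 5]), (Succ, [4, 6]), (Succ, [5, 7]), (High, [0, 1, 4, 2]),
         (Entry LZero, [0, 1, 3, 4])]),
     ((Count, [0, 1, 2, 0]), [(Zero, [2])]),
     ((Count, [0, 1, 4, 3]), [(CountTo, [0, 1, 2, 5, 0, 3]), (Succ, [2, 4])]),
     ((CountTo, [0, 1, 2, 3, 4, 4]), [(Count, [0, 1, 2, 3]), (Zero, [4])]),
     ((CountTo, [0, 1, 2, 3, 6, 7]),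
        [(CountTo, [0, 1, 2, 3, 4, 5]), (Succ, [4, 6]), (Succ, [5, 7]), (Succ, [2, 8]),
         (High, [0, 1, 4, 8])]),
     ((CountTo, [0, 1, 2, 3, 6, 5]),
        [(CountTo, [0, 1, 2, 3, 4, 5]), (Succ, [4, 6]), (Avoid, [0, 1, 2, 4, 0, 3])])]"

text \<open>In the goal rule, variable 2 is the rank, 3 the start of the adjacency matrix, 4 the
  number of worlds, 7 the number of valuation rows, 10 the world s, 13 the predecessor of the rank
  and 14 the count for it. The rank must be a successor, since a formula of rank 0 holds
  nowhere.\<close>

definition goal_rules :: "rel_rule list" where
  "goal_rules =
    [((Ones, [0, 1, 0]), [(Zero, [1])]),
     ((Ones, [0, 3, 4]), [(Ones, [0, 1, 2]), (Succ, [1, 3]), (Edge (Input LOne), [2, 4])]),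
     ((Goal, []),
        [(Zero, [0]), (Val, [0, 1, 2]), (Edge (Input LHash), [1, 3]),
         (UpRows, [4, 3, 4, 3, 5]), (Edge (Input LHash), [5, 6]),
         (UpRows, [4, 3, 7, 6, 8]), (Edge (Input LHash), [8, 9]),
         (Ones, [9, 10, 11]), (Edge RightEnd, [11, 12]), (Lt, [10, 4]), (Irr, [4, 3, 4]),
         (Count, [4, 3, 13, 14]), (Avoid, [4, 3, 13, 10, 4, 14]), (Succ, [13, 2])])]"

definition mc_rules :: "rel_rule list" where
  "mc_rules = number_rules @ formula_rules @ matrix_rules @ model_rules @ count_rules @ goal_rules"

section \<open>Soundness of the rules\<close>

text \<open>The bound leaves room for the cell of the right end marker,
  \<open>Suc (length x)\<close>, as a number. It also makes N - 1 large enough to serve as infinity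
  for every model written in the input.\<close>

locale mc_input =
  fixes x :: "letter list" and N :: nat
  assumes N: "Suc (length x) < N"
begin

definition letter_at :: "nat \<Rightarrow> letter \<Rightarrow> bool" where
  "letter_at i \<sigma> \<longleftrightarrow> i < length x \<and> x ! i = \<sigma>"

definition seg :: "nat \<Rightarrow> nat \<Rightarrow> letter list \<Rightarrow> bool" where
  "seg i j w \<longleftrightarrow> j = i + length w \<and> j \<le> length x \<and> (\<forall>k < length w. x ! (i + k) = w ! k)"

lemma seg_append: "seg i k (u @ v) \<longleftrightarrow> (\<exists>j. seg i j u \<and> seg j k v)"
proof
  assume *: "seg i k (u @ v)"
  have "x ! (i + l) = u ! l" if "l < length u" for l
    using * that by (auto simp: seg_def nth_append)
  moreover have "x ! (i + length u + l) = v ! l" if "l < length v" for l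
  proof -
    have "x ! (i + (length u + l)) = (u @ v) ! (length u + l)"
      using * that unfolding seg_def by simp
    then show ?thesis by (simp add: add.assoc)
  qed
  ultimately have "seg i (i + length u) u" "seg (i + length u) k v"
    using * by (auto simp: seg_def)
  then show "\<exists>j. seg i j u \<and> seg j k v" by blast
next
  assume "\<exists>j. seg i j u \<and> seg j k v"
  then obtain j where j: "seg i j u" "seg j k v" by blast
  show "seg i k (u @ v)"
    unfolding seg_def
  proof (intro conjI allI impI)
    fix l
    assume l: "l < length (u @ v)"
    show "x ! (i + l) = (u @ v) ! l"
    proof (cases "l < length u")
      case False
      then have "l - length u < length v" using l by simp
      then have "x ! (j + (l - length u)) = v ! (l - length u)"
        using j(2) unfolding seg_def by blast
      then show ?thesis using False j(1) by (simp add: seg_def nth_append)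
    qed (use j in \<open>auto simp: seg_def nth_append\<close>)
  qed (use j in \<open>auto simp: seg_def\<close>)
qed

lemma seg_Nil: "seg i j [] \<longleftrightarrow> j = i \<and> i \<le> length x"
  by (auto simp: seg_def)

lemma seg_single: "seg i j [\<sigma>] \<longleftrightarrow> j = Suc i \<and> letter_at i \<sigma>"
  by (auto simp: seg_def letter_at_def)

lemma seg_Cons: "seg i k (\<sigma> # v) \<longleftrightarrow> letter_at i \<sigma> \<and> seg (Suc i) k v"
  using seg_append[of i k "[\<sigma>]" v] by (simp add: seg_single)

lemma seg_whole: "seg 0 (length x) w \<longleftrightarrow> x = w"
  by (auto simp: seg_def list_eq_iff_nth_eq)

definition is_row :: "nat \<Rightarrow> nat \<Rightarrow> bool" where
  "is_row n i \<longleftrightarrow> (\<forall>b<n. letter_at (i + b) LZero \<or> letter_at (i + b) LOne) \<and> letter_at (i + n) LSemi"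

text \<open>The restriction to indices below n keeps \<open>chains\<close> inside
  \<open>{..<n}\<close> for every input, so the counting rules are sound whether or not a proper
  matrix stands at j.\<close>

definition entries :: "nat \<Rightarrow> nat \<Rightarrow> (nat \<times> nat) set" where
  "entries n j = {(a, b). a < n \<and> b < n \<and> letter_at (j + a * Suc n + b) LOne}"

abbreviation chains :: "nat \<Rightarrow> nat \<Rightarrow> nat \<Rightarrow> nat set" where
  "chains n j \<equiv> high (entries n j) {..<n}"

definition closed_at :: "nat \<Rightarrow> nat \<Rightarrow> nat \<Rightarrow> nat \<Rightarrow> nat \<Rightarrow> bool" where
  "closed_at n j i a b \<longleftrightarrow> \<not> (letter_at (i + a) LOne \<and> (a, b) \<in> entries n j \<and> \<not> letter_at (i + b) LOne)"

text \<open>The intended meaning, preserved by every rule. \<open>Avoid\<close> gives only a lower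
  bound, as its rules may pass over any world; comparison with the exact count turns this into a
  statement about all worlds.\<close>

primrec holds :: "rel \<Rightarrow> nat list \<Rightarrow> bool" where
  "holds (Edge c) v \<longleftrightarrow> v ! 1 < N \<and> in_cell x (v ! 1) = c \<and> v ! 0 = (v ! 1 + (N - 1)) mod N"
| "holds Zero v \<longleftrightarrow> v ! 0 = 0"
| "holds Top v \<longleftrightarrow> v ! 0 = N - 1"
| "holds Succ v \<longleftrightarrow> v ! 1 = Suc (v ! 0)"
| "holds Le v \<longleftrightarrow> v ! 0 \<le> v ! 1"
| "holds Lt v \<longleftrightarrow> v ! 0 < v ! 1"
| "holds Min v \<longleftrightarrow> v ! 2 = min (v ! 0) (v ! 1)"
| "holds Max v \<longleftrightarrow> v ! 2 = max (v ! 0) (v ! 1)"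
| "holds Arrow v \<longleftrightarrow> v ! 2 = (if v ! 0 \<le> v ! 1 then N - 1 else Suc (v ! 1))"
| "holds Val v \<longleftrightarrow>
     (\<exists>\<phi>. vars \<phi> = {} \<and> seg (v ! 0) (v ! 1) (enc_form \<phi>) \<and> v ! 2 = rank (N - 1) \<phi>)"
| "holds Path v \<longleftrightarrow> v ! 2 = v ! 0 + v ! 1 \<and> (\<forall>b < v ! 1. letter_at (v ! 0 + b) LZero \<or> letter_at (v ! 0 + b) LOne)"
| "holds Row v \<longleftrightarrow> v ! 2 = v ! 1 + Suc (v ! 0) \<and> is_row (v ! 0) (v ! 1)"
| "holds Rows v \<longleftrightarrow> v ! 3 = v ! 2 + v ! 1 * Suc (v ! 0)"
| "holds (RowBit \<sigma>) v \<longleftrightarrow> letter_at (v ! 0 + v ! 1) \<sigma>"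
| "holds (Entry \<sigma>) v \<longleftrightarrow> v ! 2 < v ! 0 \<and> v ! 3 < v ! 0 \<and> letter_at (v ! 1 + v ! 2 * Suc (v ! 0) + v ! 3) \<sigma>"
| "holds Up1 v \<longleftrightarrow> (\<forall>b < v ! 4. closed_at (v ! 0) (v ! 1) (v ! 2) (v ! 3) b)"
| "holds Up v \<longleftrightarrow> (\<forall>a < v ! 3. \<forall>b < v ! 0. closed_at (v ! 0) (v ! 1) (v ! 2) a b)"
| "holds UpRows v \<longleftrightarrow> v ! 4 = v ! 3 + v ! 2 * Suc (v ! 0) \<and>
     (\<forall>r < v ! 2. is_row (v ! 0) (v ! 3 + r * Suc (v ! 0)) \<and>
        (\<forall>a < v ! 0. \<forall>b < v ! 0. closed_at (v ! 0) (v ! 1) (v ! 3 + r * Suc (v ! 0)) a b))"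
| "holds Irr v \<longleftrightarrow> (\<forall>a < v ! 2. (a, a) \<notin> entries (v ! 0) (v ! 1))"
| "holds High v \<longleftrightarrow> v ! 2 \<in> chains (v ! 0) (v ! 1) (v ! 3)"
| "holds Avoid v \<longleftrightarrow> v ! 5 \<le>
     card {b \<in> chains (v ! 0) (v ! 1) (v ! 2). b < v ! 4 \<and> (v ! 3, b) \<notin> entries (v ! 0) (v ! 1)}"
| "holds Count v \<longleftrightarrow> v ! 3 = card (chains (v ! 0) (v ! 1) (v ! 2))"
| "holds CountTo v \<longleftrightarrow> v ! 3 = card (chains (v ! 0) (v ! 1) (v ! 2)) \<and>
     v ! 5 = card {a \<in> chains (v ! 0) (v ! 1) (Suc (v ! 2)). a < v ! 4}"
| "holds Ones v \<longleftrightarrow> v ! 2 = v ! 0 + v ! 1 \<and> (\<forall>k < v ! 1. letter_at (v ! 0 + k) LOne)"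
| "holds Goal v \<longleftrightarrow> x \<in> model_checking FPL0"

declare holds.simps(1) [simp del]

lemma pred_mod: "0 < j \<Longrightarrow> j < N \<Longrightarrow> (j + (N - 1)) mod N = j - 1"
proof -
  assume "0 < j" "j < N"
  then have "(j + (N - 1)) mod N = ((j - 1) + N) mod N" by (intro arg_cong2[of _ _ _ _ "(mod)"]) simp_all
  also have "\<dots> = (j - 1) mod N" by (rule mod_add_self2)
  also have "\<dots> = j - 1" using \<open>j < N\<close> by (intro mod_less) simp
  finally show ?thesis .
qed

lemma in_cell_eq:
  "in_cell x j = LeftEnd \<longleftrightarrow> j = 0"
  "in_cell x j = RightEnd \<longleftrightarrow> length x < j"
  "in_cell x j = Input \<sigma> \<longleftrightarrow> 0 < j \<and> letter_at (j - 1) \<sigma>"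
  by (auto simp: in_cell_def letter_at_def)

lemma holds_Edge_pos:
  "0 < j \<Longrightarrow> holds (Edge c) [i, j] \<longleftrightarrow> j < N \<and> in_cell x j = c \<and> j = Suc i"
  using pred_mod[of j] by (auto simp: holds.simps(1))

lemma holds_Edge_Input: "holds (Edge (Input \<sigma>)) [i, j] \<longleftrightarrow> j = Suc i \<and> letter_at i \<sigma>"
proof (cases "j = 0")
  case True
  then show ?thesis by (simp add: holds.simps(1) in_cell_eq)
next
  case False
  have "Suc i < N" if "letter_at i \<sigma>" using that N by (simp add: letter_at_def)
  then show ?thesis using False holds_Edge_pos[of j "Input \<sigma>" i] by (auto simp: in_cell_eq)
qed

lemma holds_Edge_LeftEnd: "holds (Edge LeftEnd) [i, j] \<longleftrightarrow> j = 0 \<and> i = N - 1"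
proof -
  have "(0 + (N - 1)) mod N = N - 1" "0 < N" using N by simp_all
  then show ?thesis by (cases "j = 0") (simp_all add: holds.simps(1) in_cell_eq)
qed

lemma holds_Edge_RightEnd: "holds (Edge RightEnd) [i, j] \<longleftrightarrow> j = Suc i \<and> length x \<le> i \<and> j < N"
proof (cases "j = 0")
  case True
  then show ?thesis by (simp add: holds.simps(1) in_cell_eq)
next
  case False
  then show ?thesis using holds_Edge_pos[of j RightEnd i] by (auto simp: in_cell_eq)
qed

lemmas holds_Edge = holds_Edge_Input holds_Edge_LeftEnd holds_Edge_RightEnd

lemma chains_finite: "finite (chains n j d)"
proof -
  have "chains n j d \<subseteq> {..<n}"
    by (rule high_subset) (auto simp: entries_def)
  then show ?thesis by (rule finite_subset) simp
qed

lemma chains_less: "a \<in> chains n j d \<Longrightarrow> a < n"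
proof -
  have "chains n j d \<subseteq> {..<n}"
    by (rule high_subset) (auto simp: entries_def)
  then show "a \<in> chains n j d \<Longrightarrow> a < n" by auto
qed

abbreviation sound_rule :: "rel_rule \<Rightarrow> bool" where
  "sound_rule r \<equiv> \<forall>env. (\<forall>b \<in> set (snd r). holds (fst b) (map env (snd b))) \<longrightarrow>
     holds (fst (fst r)) (map env (snd (fst r)))"

lemma sound_number_rules: "r \<in> set number_rules \<Longrightarrow> sound_rule r"
  by (auto simp: number_rules_def holds_Edge)

lemma holds_Val_Bot: "letter_at i LBot \<Longrightarrow> holds Val [i, Suc i, 0]"
  unfolding holds.simps by (intro exI[of _ Bot]) (auto simp: seg_single)

text \<open>Stated for an arbitrary binary constructor c, so that the three connectives share one
  argument.\<close>

lemma holds_Val_connective: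
  assumes "letter_at i LOpen" "holds Val [Suc i, k, p]" "letter_at k \<sigma>" "holds Val [Suc k, l, q]"
    "letter_at l LClose"
    and enc: "\<And>\<phi> \<psi>. enc_form (c \<phi> \<psi>) = [LOpen] @ enc_form \<phi> @ [\<sigma>] @ enc_form \<psi> @ [LClose]"
    and vars: "\<And>\<phi> \<psi>. vars (c \<phi> \<psi>) = vars \<phi> \<union> vars \<psi>"
    and r: "\<And>\<phi> \<psi>. p = rank (N - 1) \<phi> \<Longrightarrow> q = rank (N - 1) \<psi> \<Longrightarrow> r = rank (N - 1) (c \<phi> \<psi>)"
  shows "holds Val [i, Suc l, r]"
proof -
  obtain \<phi> where 1: "vars \<phi> = {}" "seg (Suc i) k (enc_form \<phi>)" "p = rank (N - 1) \<phi>"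
    using assms(2) by auto
  obtain \<psi> where 2: "vars \<psi> = {}" "seg (Suc k) l (enc_form \<psi>)" "q = rank (N - 1) \<psi>"
    using assms(4) by auto
  have "seg i (Suc l) (enc_form (c \<phi> \<psi>))"
    unfolding enc seg_append using assms(1,3,5) 1(2) 2(2) by (auto simp: seg_single)
  then show ?thesis
    unfolding holds.simps using 1 2 vars[of \<phi> \<psi>] r[of \<phi> \<psi>] by (intro exI[of _ "c \<phi> \<psi>"]) auto
qed

lemma sound_formula_rules:
  assumes "r \<in> set formula_rules"
  shows "sound_rule r"
proof (intro allI impI)
  fix env
  assume b: "\<forall>b \<in> set (snd r). holds (fst b) (map env (snd b))"
  consider "r = ((Val, [0, 1, 2]), [(Edge (Input LBot), [0, 1]), (Zero, [2])])"
    | \<sigma> f where "(\<sigma>, f) \<in> {(LAnd, Min), (LOr, Max), (LImp, Arrow)}" "r = ((Val, [0, 1, 2]),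
        [(Edge (Input LOpen), [0, 3]), (Val, [3, 4, 5]), (Edge (Input \<sigma>), [4, 6]),
         (Val, [6, 7, 8]), (Edge (Input LClose), [7, 1]), (f, [5, 8, 2])])"
    using assms by (auto simp: formula_rules_def)
  then show "holds (fst (fst r)) (map env (snd (fst r)))"
  proof cases
    case 1
    then show ?thesis using b holds_Val_Bot by (auto simp: holds_Edge simp del: holds.simps(10))
  next
    case 2
    have Sucs: "env 3 = Suc (env 0)" "env 6 = Suc (env 4)"
      using b unfolding 2(2) by (simp_all add: holds_Edge del: holds.simps(10))
    have body: "letter_at (env 0) LOpen" "holds Val [Suc (env 0), env 4, env 5]" "letter_at (env 4) \<sigma>"
      "holds Val [Suc (env 4), env 7, env 8]" "letter_at (env 7) LClose" "env 1 = Suc (env 7)"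
      "holds f [env 5, env 8, env 2]"
      using b unfolding 2(2) by (simp_all add: holds_Edge Sucs del: holds.simps(10))
    note connective = holds_Val_connective[OF body(1-5)]
    from 2(1) have "holds Val [env 0, Suc (env 7), env 2]"
    proof (elim insertE emptyE Pair_inject)
      assume "\<sigma> = LAnd" "f = Min"
      then show ?thesis using body(7) by (intro connective[where c = Conj]) auto
    next
      assume "\<sigma> = LOr" "f = Max"
      then show ?thesis using body(7) by (intro connective[where c = Disj]) auto
    next
      assume "\<sigma> = LImp" "f = Arrow"
      then show ?thesis using body(7) by (intro connective[where c = Imp]) auto
    qed
    then show ?thesis using body(6) by (simp add: 2(2) del: holds.simps(10))
  qed
qed

lemma sound_matrix_rules: "r \<in> set matrix_rules \<Longrightarrow> sound_rule r"
  by (auto simp: matrix_rules_def holds_Edge is_row_def less_Suc_eq)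

lemma sound_model_rules: "r \<in> set model_rules \<Longrightarrow> sound_rule r"
  by (auto simp: model_rules_def holds_Edge closed_at_def entries_def letter_at_def less_Suc_eq)

lemma card_less_Suc:
  assumes "finite (C :: nat set)"
  shows "card {b \<in> C. b < Suc k \<and> Q b} = card {b \<in> C. b < k \<and> Q b} + (if k \<in> C \<and> Q k then 1 else 0)"
proof -
  have "{b \<in> C. b < Suc k \<and> Q b} =
      (if k \<in> C \<and> Q k then insert k {b \<in> C. b < k \<and> Q b} else {b \<in> C. b < k \<and> Q b})"
    by (auto simp: less_Suc_eq)
  then show ?thesis using assms by simp
qed

text \<open>At least as many elements of \<open>chains n j d\<close> are non-successors of a as
  there are elements, so none is a successor.\<close>

lemma avoid_all:
  assumes "card (chains n j d) \<le> card {b \<in> chains n j d. b < n \<and> (a, b) \<notin> entries n j}"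
  shows "a \<notin> chains n j (Suc d)"
proof -
  have "{b \<in> chains n j d. b < n \<and> (a, b) \<notin> entries n j} = chains n j d"
    by (rule card_seteq[OF chains_finite _ assms]) auto
  then show ?thesis by auto
qed

lemma not_entry: "letter_at (j + a * Suc n + b) LZero \<Longrightarrow> (a, b) \<notin> entries n j"
  by (auto simp: entries_def letter_at_def)

lemma sound_count_rules:
  assumes "r \<in> set count_rules"
  shows "sound_rule r"
proof -
  have less_Suc: "card {b \<in> chains n j d. b < Suc k} =
      card {b \<in> chains n j d. b < k} + (if k \<in> chains n j d then 1 else 0)" for n j d k
    using card_less_Suc[OF chains_finite, of n j d k "\<lambda>_. True"] by simp
  have high: "a < n \<Longrightarrow> holds High [n, j, a, 0]"
    "holds High [n, j, b, d] \<Longrightarrow> holds (Entry LOne) [n, j, a, b] \<Longrightarrow> holds High [n, j, a, Suc d]"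
    for n j a b d
    by (auto simp: entries_def)
  have avoid: "holds Avoid [n, j, d, a, 0, 0]"
    "holds Avoid [n, j, d, a, b, k] \<Longrightarrow> holds Avoid [n, j, d, a, Suc b, k]"
    "holds Avoid [n, j, d, a, b, k] \<Longrightarrow> holds High [n, j, b, d] \<Longrightarrow>
      holds (Entry LZero) [n, j, a, b] \<Longrightarrow> holds Avoid [n, j, d, a, Suc b, Suc k]" for n j d a b k
    using card_less_Suc[OF chains_finite, of n j d b "\<lambda>b. (a, b) \<notin> entries n j"] not_entry
    by auto
  have count: "holds Count [n, j, 0, n]"
    "holds CountTo [n, j, d, c, n, k] \<Longrightarrow> holds Count [n, j, Suc d, k]" for n j d c k
  proof -
    have "{a \<in> chains n j (Suc d). a < n} = chains n j (Suc d)"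
      using chains_less[of _ n j "Suc d"] by (auto simp del: high.simps)
    then show "holds CountTo [n, j, d, c, n, k] \<Longrightarrow> holds Count [n, j, Suc d, k]"
      by (simp del: high.simps)
  qed simp
  have count_to: "holds Count [n, j, d, c] \<Longrightarrow> holds CountTo [n, j, d, c, 0, 0]"
    "holds CountTo [n, j, d, c, a, k] \<Longrightarrow> holds High [n, j, a, Suc d] \<Longrightarrow>
      holds CountTo [n, j, d, c, Suc a, Suc k]"
    "holds CountTo [n, j, d, c, a, k] \<Longrightarrow> holds Avoid [n, j, d, a, n, c] \<Longrightarrow>
      holds CountTo [n, j, d, c, Suc a, k]" for n j d c a k
    using less_Suc[of n j "Suc d" a] avoid_all[of n j d a] by (simp_all del: high.simps)
  show ?thesis
    using assms high avoid count count_to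
    by (auto simp: count_rules_def simp del: holds.simps(15,20-23))
qed

lemma seg_row:
  "seg i k (enc_row n X) \<longleftrightarrow>
     k = i + Suc n \<and> is_row n i \<and> (\<forall>b<n. letter_at (i + b) LOne \<longleftrightarrow> b \<in> X)"
proof -
  define w where "w = map (\<lambda>b. if b \<in> X then LOne else LZero) [0..<n]"
  have w: "seg i l w \<longleftrightarrow> l = i + n \<and> l \<le> length x \<and>
      (\<forall>b<n. x ! (i + b) = (if b \<in> X then LOne else LZero))" for l
    by (simp add: seg_def w_def)
  have "seg i k (enc_row n X) \<longleftrightarrow> seg i (i + n) w \<and> letter_at (i + n) LSemi \<and> k = i + Suc n"
    unfolding enc_row_def w_def[symmetric] seg_append seg_single using w by auto
  also have "\<dots> \<longleftrightarrow> k = i + Suc n \<and> is_row n i \<and> (\<forall>b<n. letter_at (i + b) LOne \<longleftrightarrow> b \<in> X)"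
  proof (cases "letter_at (i + n) LSemi")
    case True
    then have lt: "i + b < length x" if "b < n" for b using that by (simp add: letter_at_def)
    have "x ! (i + b) = (if b \<in> X then LOne else LZero) \<longleftrightarrow>
        (letter_at (i + b) LZero \<or> letter_at (i + b) LOne) \<and> (letter_at (i + b) LOne \<longleftrightarrow> b \<in> X)"
      if "b < n" for b
      using lt[OF that] by (auto simp: letter_at_def)
    moreover have "i + n \<le> length x" using True by (simp add: letter_at_def)
    ultimately show ?thesis unfolding w is_row_def using True by blast
  qed (simp add: is_row_def)
  finally show ?thesis .
qed

text \<open>The assumption matters for m = 0: an empty segment must still start inside the input or
  at its end.\<close>

lemma seg_rows:
  assumes "i \<le> length x"
  shows "seg i k (concat (map (\<lambda>r. enc_row n (X r)) [0..<m])) \<longleftrightarrow>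
     k = i + m * Suc n \<and> (\<forall>r<m. is_row n (i + r * Suc n) \<and>
       (\<forall>b<n. letter_at (i + r * Suc n + b) LOne \<longleftrightarrow> b \<in> X r))"
proof (induction m arbitrary: k)
  case 0
  show ?case using assms by (simp add: seg_Nil)
next
  case (Suc m)
  have "seg i k (concat (map (\<lambda>r. enc_row n (X r)) [0..<Suc m])) \<longleftrightarrow>
      (\<exists>l. seg i l (concat (map (\<lambda>r. enc_row n (X r)) [0..<m])) \<and> seg l k (enc_row n (X m)))"
    by (simp add: seg_append)
  also have "\<dots> \<longleftrightarrow> k = i + Suc m * Suc n \<and> (\<forall>r<Suc m. is_row n (i + r * Suc n) \<and>
       (\<forall>b<n. letter_at (i + r * Suc n + b) LOne \<longleftrightarrow> b \<in> X r))"
    unfolding Suc seg_row All_less_Suc by (auto simp: add.assoc)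
  finally show ?case .
qed

lemma seg_ones:
  assumes "i \<le> length x"
  shows "seg i k (replicate s LOne) \<longleftrightarrow> k = i + s \<and> (\<forall>l<s. letter_at (i + l) LOne)"
proof -
  have "i + s \<le> length x" if "\<forall>l<s. letter_at (i + l) LOne"
    using that assms by (cases s) (auto simp: letter_at_def)
  then show ?thesis by (auto simp: seg_def letter_at_def)
qed

lemma letter_at_le: "letter_at i \<sigma> \<Longrightarrow> Suc i \<le> length x"
  by (simp add: letter_at_def)

text \<open>The model is read off the two matrices, so that x is its encoding by construction.
  Transitivity and monotonicity come from the two \<open>UpRows\<close> facts, and satisfaction from
  \<open>avoid_all\<close> with \<open>sat_iff_rank\<close>.\<close>

lemma sound_goal:
  assumes \<phi>: "seg 0 i (enc_form \<phi>)" "vars \<phi> = {}" "rank (N - 1) \<phi> = Suc d"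
    and hash: "letter_at i LHash" "letter_at k LHash" "letter_at l LHash"
    and acc_rows: "holds UpRows [n, Suc i, n, Suc i, k]"
    and val_rows: "holds UpRows [n, Suc i, m, Suc k, l]"
    and s: "holds Ones [Suc l, s, e]" "length x \<le> e" "s < n"
    and irr: "holds Irr [n, Suc i, n]"
    and avoid: "card (chains n (Suc i) d) \<le>
      card {b \<in> chains n (Suc i) d. b < n \<and> (s, b) \<notin> entries n (Suc i)}"
  shows "x \<in> model_checking FPL0"
proof -
  define A where "A = entries n (Suc i)"
  define V where "V p = (if p < m then {b. b < n \<and> letter_at (Suc k + p * Suc n + b) LOne} else {})" for p
  define M where "M = \<lparr>worlds = {..<n}, acc = A, val = V\<rparr>"
  have rows: "is_row n (Suc i + r * Suc n)" if "r < n" for r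
    using acc_rows that by simp
  have up: "letter_at (Suc i + a * Suc n + c) LOne"
    if "a < n" "b < n" "c < n" "letter_at (Suc i + a * Suc n + b) LOne" "(b, c) \<in> A" for a b c
    using acc_rows that by (auto simp: closed_at_def A_def)
  have upv: "letter_at (Suc k + p * Suc n + c) LOne"
    if "p < m" "b < n" "c < n" "letter_at (Suc k + p * Suc n + b) LOne" "(b, c) \<in> A" for p b c
    using val_rows that by (auto simp: closed_at_def A_def)
  have A: "(a, b) \<in> A \<longleftrightarrow> a < n \<and> b < n \<and> letter_at (Suc i + a * Suc n + b) LOne" for a b
    by (simp add: A_def entries_def)
  have model: "FPL_model M"
    unfolding FPL_model_def
  proof (intro conjI allI impI)
    show "worlds M \<noteq> {}" using s(3) by (auto simp: M_def)
    show "trans (acc M)"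
      by (intro transI) (use up in \<open>auto simp: M_def A simp del: mult_Suc_right\<close>)
    show "irrefl (acc M)"
    proof (rule irreflI)
      fix a show "(a, a) \<notin> acc M" using irr by (cases "a < n") (auto simp: M_def A_def entries_def)
    qed
    fix p a b assume "a \<in> val M p" "(a, b) \<in> acc M"
    then show "b \<in> val M p"
      using upv[of p a b] by (auto simp: M_def A V_def simp del: mult_Suc_right split: if_splits)
  qed (auto simp: M_def A V_def split: if_splits)
  \<comment> \<open>The first row ends inside the input, which bounds n by N - 1.\<close>
  have "letter_at (Suc i + n) LSemi"
    using rows[of 0] s(3) by (simp add: is_row_def)
  then have "n \<le> N - 1"
    using letter_at_le[of "Suc i + n" LSemi] N by simp
  moreover have "s \<notin> high A {..<n} (Suc d)"
    using avoid_all[OF avoid] by (simp add: A_def)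
  ultimately have sat: "sat M s \<phi>"
    using sat_iff_rank[OF model _ \<phi>(2), of "N - 1" s] \<phi>(3) s(3) by (simp add: M_def del: high.simps)
  \<comment> \<open>The ones lie inside the input and are followed by the right end marker. For s =
    0 the last \<open>LHash\<close> provides the upper bound.\<close>
  have e: "e = length x" "e = Suc l + s" "\<forall>t<s. letter_at (Suc l + t) LOne"
  proof -
    show ones: "e = Suc l + s" "\<forall>t<s. letter_at (Suc l + t) LOne" using s(1) by simp_all
    have "e \<le> length x"
      using ones letter_at_le[OF hash(3)] letter_at_le[of "Suc l + (s - 1)" LOne] by (cases s) auto
    then show "e = length x" using s(2) by simp
  qed
  have "seg 0 (length x) (enc_instance \<phi> n m M s)"
    unfolding enc_instance_def seg_append seg_single
  proof (intro exI conjI)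
    show "seg 0 i (enc_form \<phi>)" by fact
    show "Suc i = Suc i" "Suc k = Suc k" "Suc l = Suc l" by simp_all
    show "letter_at i LHash" "letter_at k LHash" "letter_at l LHash" by fact+
    show "seg (Suc i) k (concat (map (\<lambda>a. enc_row n {b. (a, b) \<in> acc M}) [0..<n]))"
      unfolding seg_rows[OF letter_at_le[OF hash(1)]] using acc_rows
      by (simp add: M_def A del: mult_Suc_right)
    show "seg (Suc k) l (concat (map (\<lambda>p. enc_row n (val M p)) [0..<m]))"
      unfolding seg_rows[OF letter_at_le[OF hash(2)]] using val_rows
      by (simp add: M_def V_def del: mult_Suc_right)
    show "seg (Suc l) (length x) (replicate s LOne)"
      unfolding seg_ones[OF letter_at_le[OF hash(3)]] using e by simp
  qed
  then have "x = enc_instance \<phi> n m M s" by (simp only: seg_whole)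
  then show ?thesis
    unfolding model_checking_def FPL0_def using model sat \<phi>(2) s(3)
    by (intro CollectI exI[of _ \<phi>] exI[of _ n] exI[of _ m] exI[of _ M] exI[of _ s])
      (auto simp: M_def V_def)
qed

lemma sound_goal_rules:
  assumes "r \<in> set goal_rules"
  shows "sound_rule r"
proof -
  consider "r \<in> set (take 2 goal_rules)" | "r = last goal_rules"
    using assms by (auto simp: goal_rules_def)
  then show ?thesis
  proof cases
    case 1
    then show ?thesis by (auto simp: goal_rules_def holds_Edge less_Suc_eq)
  next
    case 2
    show ?thesis
    proof (intro allI impI)
      fix env
      assume b: "\<forall>b \<in> set (snd r). holds (fst b) (map env (snd b))"
      let ?h = "\<lambda>r v. holds r (map env v)"
      have bodies: "?h Zero [0]" "?h Val [0, 1, 2]" "?h (Edge (Input LHash)) [1, 3]"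
        "?h UpRows [4, 3, 4, 3, 5]" "?h (Edge (Input LHash)) [5, 6]"
        "?h UpRows [4, 3, 7, 6, 8]" "?h (Edge (Input LHash)) [8, 9]"
        "?h Ones [9, 10, 11]" "?h (Edge RightEnd) [11, 12]" "?h Lt [10, 4]" "?h Irr [4, 3, 4]"
        "?h Count [4, 3, 13, 14]" "?h Avoid [4, 3, 13, 10, 4, 14]" "?h Succ [13, 2]"
        using b unfolding 2 goal_rules_def by (simp_all del: holds.simps list.map)
      obtain \<phi> where \<phi>: "vars \<phi> = {}" "seg 0 (env 1) (enc_form \<phi>)" "rank (N - 1) \<phi> = Suc (env 13)"
        using bodies(1,2,14) by auto
      have pos: "env 3 = Suc (env 1)" "env 6 = Suc (env 5)" "env 9 = Suc (env 8)"
        "letter_at (env 1) LHash" "letter_at (env 5) LHash" "letter_at (env 8) LHash"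
        using bodies(3,5,7) by (simp_all add: holds_Edge)
      have "x \<in> model_checking FPL0"
      proof (rule sound_goal[OF \<phi>(2,1,3) pos(4-6)])
        show "holds UpRows [env 4, Suc (env 1), env 4, Suc (env 1), env 5]"
          using bodies(4) unfolding pos(1)[symmetric] by (simp only: list.map)
        show "holds UpRows [env 4, Suc (env 1), env 7, Suc (env 5), env 8]"
          using bodies(6) unfolding pos(1,2)[symmetric] by (simp only: list.map)
        show "holds Ones [Suc (env 8), env 10, env 11]"
          using bodies(8) unfolding pos(3)[symmetric] by (simp only: list.map)
        show "length x \<le> env 11" using bodies(9) by (simp add: holds_Edge)
        show "env 10 < env 4" using bodies(10) by simp
        show "holds Irr [env 4, Suc (env 1), env 4]"
          using bodies(11) unfolding pos(1)[symmetric] by (simp only: list.map)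
        show "card (chains (env 4) (Suc (env 1)) (env 13)) \<le> card {b \<in> chains (env 4) (Suc (env 1)) (env 13).
            b < env 4 \<and> (env 10, b) \<notin> entries (env 4) (Suc (env 1))}"
          using bodies(12,13) unfolding pos(1)[symmetric] by simp
      qed
      then show "holds (fst (fst r)) (map env (snd (fst r)))"
        unfolding 2 by (simp add: goal_rules_def)
    qed
  qed
qed

lemma sound_mc_rules: "r \<in> set mc_rules \<Longrightarrow> sound_rule r"
  unfolding mc_rules_def set_append
  by (elim UnE) (rule sound_number_rules sound_formula_rules sound_matrix_rules sound_model_rules
    sound_count_rules sound_goal_rules, assumption)+

lemma proves_holds:
  "proves mc_rules Edge x N t fs \<Longrightarrow> \<forall>f \<in> set fs. holds (fst f) (snd f)"
proof (induction rule: proves.induct)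
  case (Edge j t fs)
  then show ?case by (simp add: holds.simps(1))
next
  case (Rule h bs env t fs)
  then have "\<forall>b \<in> set bs. holds (fst (inst env b)) (snd (inst env b))"
    by simp
  then have "\<forall>b \<in> set (snd (h, bs)). holds (fst b) (map env (snd b))"
    by (simp add: inst_def)
  then have "holds (fst h) (map env (snd h))"
    using sound_mc_rules[OF Rule(1)] by simp
  then show ?case using Rule by (auto simp: inst_def)
qed simp

end

section \<open>Polynomial derivations\<close>

context mc_input
begin

definition der :: "nat \<Rightarrow> rel \<Rightarrow> nat list \<Rightarrow> bool" where
  "der s r v \<longleftrightarrow> (\<exists>t\<le>s. proves mc_rules Edge x N t [(r, v)])"

lemma proves_append:
  "proves R e x N t fs \<Longrightarrow> proves R e x N t' gs \<Longrightarrow> proves R e x N (t + t') (fs @ gs)"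
proof (induction rule: proves.induct)
  case (Rule h bs env t fs)
  then show ?case using proves.Rule[of h bs R env N e x "t + t'" "fs @ gs"] by simp
next
  case (Edge j t fs)
  then show ?case using proves.Edge[of j N R e x "t + t'" "fs @ gs"] by simp
qed simp

lemma der_list:
  "list_all2 (\<lambda>s f. der s (fst f) (snd f)) ss fs \<Longrightarrow> \<exists>t\<le>sum_list ss. proves mc_rules Edge x N t fs"
proof (induction rule: list_all2_induct)
  case Nil
  show ?case by (auto intro: proves.Nil)
next
  case (Cons s ss f fs)
  then obtain t t' where "t \<le> s" "proves mc_rules Edge x N t [f]"
    "t' \<le> sum_list ss" "proves mc_rules Edge x N t' fs"
    by (auto simp: der_def)
  then show ?case using proves_append[of mc_rules Edge t "[f]" t' fs]
    by (intro exI[of _ "t + t'"]) auto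
qed

text \<open>Valuations of a rule given by finite lists; the default 0 is a number below N.\<close>

definition pick :: "nat list \<Rightarrow> nat \<Rightarrow> nat" where
  "pick es i = (if i < length es then es ! i else 0)"

lemma der_rule:
  assumes "(h, bs) \<in> set mc_rules" "\<forall>v \<in> set es. v < N"
    and "list_all2 (\<lambda>s b. der s (fst b) (map (pick es) (snd b))) ss bs"
  shows "der (Suc (sum_list ss)) (fst h) (map (pick es) (snd h))"
proof -
  have env: "pick es i < N" for i
    using assms(2) N by (auto simp: pick_def)
  have "list_all2 (\<lambda>s f. der s (fst f) (snd f)) ss (map (inst (pick es)) bs)"
    using assms(3) by (simp add: list_all2_map2 inst_def)
  then obtain t where "t \<le> sum_list ss" "proves mc_rules Edge x N t (map (inst (pick es)) bs @ [])"
    using der_list by auto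
  then have "Suc t \<le> Suc (sum_list ss)" "proves mc_rules Edge x N (Suc t) [inst (pick es) h]"
    using proves.Rule[OF assms(1), of "pick es" N Edge x t "[]", OF env] by auto
  then show ?thesis unfolding der_def inst_def by blast
qed

lemma der_mono: "der s r v \<Longrightarrow> s \<le> s' \<Longrightarrow> der s' r v"
  unfolding der_def using le_trans by blast

abbreviation lev :: "nat \<Rightarrow> rel \<Rightarrow> nat list \<Rightarrow> bool" where
  "lev e \<equiv> der (N ^ e)"

lemma N_ge_2: "2 \<le> N"
  using N by simp

lemma lev_mono: "lev e r v \<Longrightarrow> e \<le> e' \<Longrightarrow> lev e' r v"
  using N by (elim der_mono) (simp add: power_increasing)

text \<open>The longest rule, that for \<open>Goal\<close>, has 14 premises. As N is at least 2, the
  factor \<open>N ^ 4\<close> is at least 16 and absorbs them together with the new node. So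
  applying a rule raises the exponent by 4.\<close>

lemma size_step: "k \<le> 14 \<Longrightarrow> Suc (k * N ^ e) \<le> N ^ (e + 4)"
proof -
  assume "k \<le> 14"
  then have "k * N ^ e \<le> 14 * N ^ e" by (rule mult_right_mono) simp
  moreover have "1 \<le> N ^ e" using N by simp
  ultimately have "Suc (k * N ^ e) \<le> 16 * N ^ e" by linarith
  also have "(16 :: nat) \<le> N ^ 4" using power_mono[OF N_ge_2, of 4] by simp
  then have "16 * N ^ e \<le> N ^ (e + 4)" by (simp add: power_add mult.commute)
  finally show ?thesis .
qed

lemma list_all2_replicate:
  "list_all2 P (replicate (length bs) s) bs \<longleftrightarrow> (\<forall>b \<in> set bs. P s b)"
  by (induction bs) auto

lemma lev_rule:
  assumes "(h, bs) \<in> set mc_rules" "\<forall>v \<in> set es. v < N" "length bs \<le> 14"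
    and "\<forall>b \<in> set bs. lev e (fst b) (map (pick es) (snd b))"
  shows "lev (e + 4) (fst h) (map (pick es) (snd h))"
proof -
  have "der (Suc (sum_list (replicate (length bs) (N ^ e)))) (fst h) (map (pick es) (snd h))"
    using assms by (intro der_rule[OF assms(1,2)]) (simp add: list_all2_replicate)
  then show ?thesis
    using size_step[OF assms(3), of e] by (elim der_mono) (simp add: sum_list_replicate)
qed

text \<open>For rules that recurse through their first premise, a round adds a summand
  \<open>N ^ (e + 4)\<close> instead of raising the exponent. By \<open>lev_chain\<close>, up to N
  rounds together raise it by 1, so a loop over premises of level e has level e + 5.\<close>

lemma der_chain:
  assumes "(h, b # bs) \<in> set mc_rules" "\<forall>v \<in> set es. v < N" "length bs \<le> 14"
    and "der (k * N ^ (e + 4)) (fst b) (map (pick es) (snd b))"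
    and "\<forall>b \<in> set bs. lev e (fst b) (map (pick es) (snd b))"
  shows "der (Suc k * N ^ (e + 4)) (fst h) (map (pick es) (snd h))"
proof -
  have "der (Suc (sum_list (k * N ^ (e + 4) # replicate (length bs) (N ^ e)))) (fst h) (map (pick es) (snd h))"
    using assms by (intro der_rule[OF assms(1,2)]) (simp add: list_all2_replicate)
  then show ?thesis
    using size_step[OF assms(3), of e] by (elim der_mono) (simp add: sum_list_replicate)
qed

lemma lev_chain: "der (k * N ^ e) r v \<Longrightarrow> k \<le> N \<Longrightarrow> lev (Suc e) r v"
  by (elim der_mono) simp

lemma der_Edge: "holds (Edge c) [i, j] \<Longrightarrow> der 1 (Edge c) [i, j]"
  using proves.Edge[OF _ proves.Nil, of j N mc_rules Edge x]
  by (auto simp: holds.simps(1) der_def)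

lemma lev_Edge: "holds (Edge c) [i, j] \<Longrightarrow> lev e (Edge c) [i, j]"
  using der_Edge N by (elim der_mono[OF der_Edge]) simp

lemmas rule_simps = mc_rules_def number_rules_def formula_rules_def matrix_rules_def
  model_rules_def count_rules_def goal_rules_def pick_def

section \<open>Derivation sizes for numbers and rows\<close>

lemma lev_Zero: "lev 4 Zero [0]"
  using lev_rule[of "(Zero, [0])" "[(Edge LeftEnd, [1, 0])]" "[0, N - 1]" 0]
    lev_Edge[of LeftEnd "N - 1" 0 0] N
  by (simp add: rule_simps holds_Edge)

lemma lev_Top: "lev 4 Top [N - 1]"
  using lev_rule[of "(Top, [0])" "[(Edge LeftEnd, [0, 1])]" "[N - 1, 0]" 0]
    lev_Edge[of LeftEnd "N - 1" 0 0] N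
  by (simp add: rule_simps holds_Edge)

lemma lev_Succ: "Suc i < N \<Longrightarrow> lev 4 Succ [i, Suc i]"
proof -
  assume i: "Suc i < N"
  define c where "c = in_cell x (Suc i)"
  have "holds (Edge c) [i, Suc i]"
    using i by (simp add: holds_Edge_pos c_def)
  moreover have "((Succ, [0, 1]), [(Edge c, [0, 1])]) \<in> set mc_rules"
  proof (cases c)
    case LeftEnd
    then show ?thesis by (simp add: c_def in_cell_eq)
  next
    case (Input \<sigma>)
    then show ?thesis by (cases \<sigma>) (simp_all add: rule_simps)
  qed (simp add: rule_simps)
  ultimately show ?thesis
    using lev_rule[of "(Succ, [0, 1])" "[(Edge c, [0, 1])]" "[i, Suc i]" 0] lev_Edge[of c i "Suc i" 0] i
    by (simp add: pick_def)
qed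

lemma lev_Le: "a \<le> b \<Longrightarrow> b < N \<Longrightarrow> lev 9 Le [a, b]"
proof -
  have "a + k < N \<Longrightarrow> der (Suc k * N ^ 8) Le [a, a + k]" for k
  proof (induction k)
    case 0
    then show ?case
      using lev_rule[of "(Le, [0, 0])" "[]" "[a]" 4] by (simp add: rule_simps)
  next
    case (Suc k)
    then show ?case
      using der_chain[of "(Le, [0, 2])" "(Le, [0, 1])" "[(Succ, [1, 2])]" "[a, a + k, Suc (a + k)]" "Suc k" 4]
        lev_Succ[of "a + k"]
      by (simp add: rule_simps)
  qed
  from this[of "b - a"] show "a \<le> b \<Longrightarrow> b < N \<Longrightarrow> lev 9 Le [a, b]"
    using lev_chain[of "Suc (b - a)" 8] by simp
qed

lemma lev_Lt: "a < b \<Longrightarrow> b < N \<Longrightarrow> lev 13 Lt [a, b]"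
  using lev_rule[of "(Lt, [0, 1])" "[(Succ, [0, 2]), (Le, [2, 1])]" "[a, b, Suc a]" 9]
    lev_mono[OF lev_Succ[of a], of 9] lev_Le[of "Suc a" b]
  by (simp add: rule_simps)

lemma lev_Min: "a < N \<Longrightarrow> b < N \<Longrightarrow> lev 13 Min [a, b, min a b]"
  using lev_rule[of "(Min, [0, 1, 0])" "[(Le, [0, 1])]" "[a, b]" 9]
    lev_rule[of "(Min, [0, 1, 1])" "[(Le, [1, 0])]" "[a, b]" 9] lev_Le[of a b] lev_Le[of b a]
  by (cases "a \<le> b") (simp_all add: rule_simps min_def)

lemma lev_Max: "a < N \<Longrightarrow> b < N \<Longrightarrow> lev 13 Max [a, b, max a b]"
  using lev_rule[of "(Max, [0, 1, 1])" "[(Le, [0, 1])]" "[a, b]" 9]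
    lev_rule[of "(Max, [0, 1, 0])" "[(Le, [1, 0])]" "[a, b]" 9] lev_Le[of a b] lev_Le[of b a]
  by (cases "a \<le> b") (simp_all add: rule_simps max_def)

lemma lev_Arrow:
  assumes "a < N" "b < N"
  shows "lev 13 Arrow [a, b, if a \<le> b then N - 1 else Suc b]"
proof (cases "a \<le> b")
  case True
  then show ?thesis
    using lev_rule[of "(Arrow, [0, 1, 2])" "[(Le, [0, 1]), (Top, [2])]" "[a, b, N - 1]" 9]
      lev_Le[of a b] lev_mono[OF lev_Top, of 9] assms
    by (simp add: rule_simps)
next
  case False
  then show ?thesis
    using lev_rule[of "(Arrow, [0, 1, 2])" "[(Succ, [1, 2]), (Le, [2, 0])]" "[a, b, Suc b]" 9]
      lev_Le[of "Suc b" a] lev_mono[OF lev_Succ[of b], of 9] assms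
    by (simp add: rule_simps)
qed

lemma letter_at_less: "letter_at i \<sigma> \<Longrightarrow> Suc i < N"
  using letter_at_le N by fastforce

lemma lev_Path:
  assumes "\<forall>k<b. letter_at (i + k) LZero \<or> letter_at (i + k) LOne" "i + b < N"
  shows "lev 9 Path [i, b, i + b]"
proof -
  have "k \<le> b \<Longrightarrow> der (Suc k * N ^ 8) Path [i, k, i + k]" for k
  proof (induction k)
    case 0
    then show ?case
      using lev_rule[of "(Path, [0, 1, 0])" "[(Zero, [1])]" "[i, 0]" 4] lev_Zero assms(2)
      by (simp add: rule_simps)
  next
    case (Suc k)
    then have "letter_at (i + k) LZero \<or> letter_at (i + k) LOne" using assms(1) by simp
    then show ?case
    proof
      assume "letter_at (i + k) LZero"
      then show ?thesis
        using der_chain[of "(Path, [0, 3, 4])" "(Path, [0, 1, 2])"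
            "[(Succ, [1, 3]), (Edge (Input LZero), [2, 4])]" "[i, k, i + k, Suc k, Suc (i + k)]" "Suc k" 4]
          lev_Succ[of k] lev_Edge[of "Input LZero" "i + k" "Suc (i + k)" 4] Suc assms(2)
        by (simp add: rule_simps holds_Edge)
    next
      assume "letter_at (i + k) LOne"
      then show ?thesis
        using der_chain[of "(Path, [0, 3, 4])" "(Path, [0, 1, 2])"
            "[(Succ, [1, 3]), (Edge (Input LOne), [2, 4])]" "[i, k, i + k, Suc k, Suc (i + k)]" "Suc k" 4]
          lev_Succ[of k] lev_Edge[of "Input LOne" "i + k" "Suc (i + k)" 4] Suc assms(2)
        by (simp add: rule_simps holds_Edge)
    qed
  qed
  from lev_chain[OF this[OF order_refl]] show ?thesis using assms(2) by simp
qed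

lemma lev_Ones:
  assumes "\<forall>k<b. letter_at (i + k) LOne" "i + b < N"
  shows "lev 9 Ones [i, b, i + b]"
proof -
  have "k \<le> b \<Longrightarrow> der (Suc k * N ^ 8) Ones [i, k, i + k]" for k
  proof (induction k)
    case 0
    then show ?case
      using lev_rule[of "(Ones, [0, 1, 0])" "[(Zero, [1])]" "[i, 0]" 4] lev_Zero assms(2)
      by (simp add: rule_simps)
  next
    case (Suc k)
    then have "letter_at (i + k) LOne" using assms(1) by simp
    then show ?case
      using der_chain[of "(Ones, [0, 3, 4])" "(Ones, [0, 1, 2])"
          "[(Succ, [1, 3]), (Edge (Input LOne), [2, 4])]" "[i, k, i + k, Suc k, Suc (i + k)]" "Suc k" 4]
        lev_Succ[of k] lev_Edge[of "Input LOne" "i + k" "Suc (i + k)" 4] Suc assms(2)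
      by (simp add: rule_simps holds_Edge)
  qed
  from lev_chain[OF this[OF order_refl]] show ?thesis using assms(2) by simp
qed

lemma is_row_less: "is_row n i \<Longrightarrow> i + Suc n < N"
  using letter_at_less[of "i + n" LSemi] by (simp add: is_row_def)

lemma lev_Row: "is_row n i \<Longrightarrow> lev 13 Row [n, i, i + Suc n]"
  using lev_rule[of "(Row, [0, 1, 2])" "[(Path, [1, 0, 3]), (Edge (Input LSemi), [3, 2])]"
      "[n, i, i + Suc n, i + n]" 9]
    lev_Path[of n i] lev_Edge[of "Input LSemi" "i + n" "i + Suc n" 9] is_row_less[of n i]
  by (simp add: rule_simps holds_Edge is_row_def)

section \<open>Derivation sizes for matrices, the model conditions and counting\<close>

definition matrix :: "nat \<Rightarrow> nat \<Rightarrow> bool" where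
  "matrix n j \<longleftrightarrow> 0 < n \<and> (\<forall>r<n. is_row n (j + r * Suc n))"

lemma matrix_less: "matrix n j \<Longrightarrow> n < N \<and> j < N"
  using is_row_less[of n j] by (auto simp: matrix_def dest: spec[of _ 0])

lemma lev_Rows:
  assumes "matrix n j" "a < n"
  shows "lev 18 Rows [n, a, j, j + a * Suc n]"
proof -
  have less: "n < N" "j < N" using matrix_less[OF assms(1)] by simp_all
  have row: "is_row n (j + r * Suc n)" "j + r * Suc n + Suc n < N" if "r < n" for r
    using assms(1) that is_row_less[of n "j + r * Suc n"] by (simp_all add: matrix_def)
  have "r \<le> a \<Longrightarrow> der (Suc r * N ^ 17) Rows [n, r, j, j + r * Suc n]" for r
  proof (induction r)
    case 0
    then show ?case
      using lev_mono[OF lev_rule[of "(Rows, [0, 1, 2, 2])" "[(Zero, [1])]" "[n, 0, j]" 4], of 17]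
        lev_Zero less
      by (simp add: rule_simps)
  next
    case (Suc r)
    have r: "r < n" "Suc r < N" using Suc.prems assms(2) less by simp_all
    define q where "q = j + r * Suc n"
    have q: "is_row n q" "q + Suc n < N" using row[OF r(1)] by (simp_all add: q_def)
    have "der (Suc r * N ^ 17) Rows [n, r, j, q]" using Suc by (simp add: q_def)
    then have "der (Suc (Suc r) * N ^ 17) Rows [n, Suc r, j, q + Suc n]"
      using der_chain[of "(Rows, [0, 1, 2, 3])" "(Rows, [0, 4, 2, 5])" "[(Succ, [4, 1]), (Row, [0, 5, 3])]"
          "[n, Suc r, j, q + Suc n, r, q]" "Suc r" 13]
        lev_mono[OF lev_Succ[OF r(2)], of 13] lev_Row[OF q(1)] q(2) r less
      by (simp add: rule_simps)
    moreover have "q + Suc n = j + Suc r * Suc n" by (simp add: q_def)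
    ultimately show ?case by (simp only:)
  qed
  from lev_chain[OF this[OF order_refl]] show ?thesis using assms(2) less by (simp del: mult_Suc_right)
qed

lemma lev_RowBit:
  assumes "is_row n i" "b < n" "letter_at (i + b) \<sigma>"
  shows "lev 13 (RowBit \<sigma>) [i, b]"
proof -
  have "\<sigma> = LZero \<or> \<sigma> = LOne" using assms by (auto simp: is_row_def letter_at_def)
  moreover have "lev 9 Path [i, b, i + b]"
    using assms is_row_less[OF assms(1)] by (intro lev_Path) (auto simp: is_row_def)
  moreover have "lev 9 (Edge (Input \<sigma>)) [i + b, Suc (i + b)]"
    using assms(3) by (intro lev_Edge) (simp add: holds_Edge)
  ultimately show ?thesis
    using lev_rule[of "(RowBit \<sigma>, [0, 1])" "[(Path, [0, 1, 2]), (Edge (Input \<sigma>), [2, 3])]"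
        "[i, b, i + b, Suc (i + b)]" 9] is_row_less[OF assms(1)] assms(2)
    by (auto simp: rule_simps)
qed

lemma lev_Entry:
  assumes "matrix n j" "a < n" "b < n" "letter_at (j + a * Suc n + b) \<sigma>"
  shows "lev 22 (Entry \<sigma>) [n, j, a, b]"
proof -
  define k where "k = j + a * Suc n"
  have row: "is_row n k" using assms(1,2) by (simp add: matrix_def k_def)
  then have "\<sigma> = LZero \<or> \<sigma> = LOne" using assms(3,4) by (auto simp: is_row_def letter_at_def k_def)
  moreover have "lev 18 Rows [n, a, j, k]"
    using lev_Rows[OF assms(1,2)] by (simp add: k_def)
  moreover have "lev 18 (RowBit \<sigma>) [k, b]"
    using lev_RowBit[OF row assms(3)] assms(4) by (intro lev_mono[of 13 _ _ 18]) (auto simp: k_def)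
  moreover have "lev 18 Lt [a, n]" "lev 18 Lt [b, n]"
    using lev_Lt assms(2,3) matrix_less[OF assms(1)] by (auto intro: lev_mono[of 13 _ _ 18])
  ultimately show ?thesis
    using lev_rule[of "(Entry \<sigma>, [0, 1, 2, 3])"
        "[(Rows, [0, 2, 1, 4]), (RowBit \<sigma>, [4, 3]), (Lt, [2, 0]), (Lt, [3, 0])]" "[n, j, a, b, k]" 18]
      is_row_less[OF row] assms(2,3) matrix_less[OF assms(1)]
    by (auto simp: rule_simps)
qed

lemma lev_not_entry:
  assumes "matrix n j" "a < n" "b < n" "(a, b) \<notin> entries n j"
  shows "lev 22 (Entry LZero) [n, j, a, b]"
proof -
  have "letter_at (j + a * Suc n + b) LZero \<or> letter_at (j + a * Suc n + b) LOne"
    using assms(1-3) unfolding matrix_def is_row_def by blast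
  then show ?thesis using assms by (intro lev_Entry) (auto simp: entries_def)
qed

lemma lev_entry: "matrix n j \<Longrightarrow> (a, b) \<in> entries n j \<Longrightarrow> lev 22 (Entry LOne) [n, j, a, b]"
  by (rule lev_Entry) (auto simp: entries_def)

lemma lev_Up1:
  assumes "matrix n j" "is_row n i" "a < n" "\<forall>b<n. closed_at n j i a b"
  shows "lev 27 Up1 [n, j, i, a, n]"
proof -
  have less: "n < N" "j < N" using matrix_less[OF assms(1)] by simp_all
  have i: "i < N" using is_row_less[OF assms(2)] by simp
  have "b \<le> n \<Longrightarrow> der (Suc b * N ^ 26) Up1 [n, j, i, a, b]" for b
  proof (induction b)
    case 0
    have "lev 8 Up1 [n, j, i, a, 0]"
      using lev_rule[of "(Up1, [0, 1, 2, 3, 4])" "[(Zero, [4])]" "[n, j, i, a, 0]" 4]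
        lev_Zero less i assms(3)
      by (simp add: rule_simps)
    then show ?case using lev_mono[of 8 Up1 _ 26] by simp
  next
    case (Suc b)
    then have b: "b < n" "Suc b < N" using less by simp_all
    have succ: "lev 22 Succ [b, Suc b]" using lev_mono[OF lev_Succ[OF b(2)], of 22] by simp
    have IH: "der (Suc b * N ^ 26) Up1 [n, j, i, a, b]" using Suc by simp
    consider "letter_at (i + a) LZero" | "(a, b) \<notin> entries n j" | "letter_at (i + b) LOne"
      using assms b(1) unfolding closed_at_def is_row_def by blast
    then show ?case
    proof cases
      case 1
      then have "lev 22 (RowBit LZero) [i, a]"
        using lev_mono[OF lev_RowBit[OF assms(2,3)], of LZero 22] by simp
      then show ?thesis
        using der_chain[of "(Up1, [0, 1, 2, 3, 5])" "(Up1, [0, 1, 2, 3, 4])"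
            "[(Succ, [4, 5]), (RowBit LZero, [2, 3])]" "[n, j, i, a, b, Suc b]" "Suc b" 22]
          succ IH less i b assms(3)
        by (simp add: rule_simps)
    next
      case 2
      then have "lev 22 (Entry LZero) [n, j, a, b]"
        using lev_not_entry[OF assms(1,3) b(1)] by simp
      then show ?thesis
        using der_chain[of "(Up1, [0, 1, 2, 3, 5])" "(Up1, [0, 1, 2, 3, 4])"
            "[(Succ, [4, 5]), (Entry LZero, [0, 1, 3, 4])]" "[n, j, i, a, b, Suc b]" "Suc b" 22]
          succ IH less i b assms(3)
        by (simp add: rule_simps)
    next
      case 3
      then have "lev 22 (RowBit LOne) [i, b]"
        using lev_mono[OF lev_RowBit[OF assms(2) b(1)], of LOne 22] by simp
      then show ?thesis
        using der_chain[of "(Up1, [0, 1, 2, 3, 5])" "(Up1, [0, 1, 2, 3, 4])"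
            "[(Succ, [4, 5]), (RowBit LOne, [2, 4])]" "[n, j, i, a, b, Suc b]" "Suc b" 22]
          succ IH less i b assms(3)
        by (simp add: rule_simps)
    qed
  qed
  from lev_chain[OF this[OF order_refl]] show ?thesis using less by simp
qed

lemma lev_Up:
  assumes "matrix n j" "is_row n i" "\<forall>a<n. \<forall>b<n. closed_at n j i a b"
  shows "lev 32 Up [n, j, i, n]"
proof -
  have less: "n < N" "j < N" using matrix_less[OF assms(1)] by simp_all
  have i: "i < N" using is_row_less[OF assms(2)] by simp
  have "a \<le> n \<Longrightarrow> der (Suc a * N ^ 31) Up [n, j, i, a]" for a
  proof (induction a)
    case 0
    have "lev 8 Up [n, j, i, 0]"
      using lev_rule[of "(Up, [0, 1, 2, 3])" "[(Zero, [3])]" "[n, j, i, 0]" 4] lev_Zero less i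
      by (simp add: rule_simps)
    then show ?case using lev_mono[of 8 Up _ 31] by simp
  next
    case (Suc a)
    then have a: "a < n" "Suc a < N" using less by simp_all
    have "lev 27 Succ [a, Suc a]" using lev_mono[OF lev_Succ[OF a(2)], of 27] by simp
    moreover have "lev 27 Up1 [n, j, i, a, n]" using assms a(1) by (intro lev_Up1) auto
    ultimately show ?case
      using der_chain[of "(Up, [0, 1, 2, 4])" "(Up, [0, 1, 2, 3])"
          "[(Succ, [3, 4]), (Up1, [0, 1, 2, 3, 0])]" "[n, j, i, a, Suc a]" "Suc a" 27]
        Suc less i a
      by (simp add: rule_simps)
  qed
  from lev_chain[OF this[OF order_refl]] show ?thesis using less by simp
qed

lemma lev_UpRows:
  assumes "matrix n j" "i < N" "m < N" "\<forall>r<m. is_row n (i + r * Suc n)"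
    and "\<forall>r<m. \<forall>a<n. \<forall>b<n. closed_at n j (i + r * Suc n) a b"
  shows "lev 37 UpRows [n, j, m, i, i + m * Suc n]"
proof -
  have less: "n < N" "j < N" using matrix_less[OF assms(1)] by simp_all
  have "r \<le> m \<Longrightarrow> der (Suc r * N ^ 36) UpRows [n, j, r, i, i + r * Suc n]" for r
  proof (induction r)
    case 0
    have "lev 8 UpRows [n, j, 0, i, i]"
      using lev_rule[of "(UpRows, [0, 1, 2, 3, 3])" "[(Zero, [2])]" "[n, j, 0, i]" 4] lev_Zero less assms(2)
      by (simp add: rule_simps)
    then show ?case using lev_mono[of 8 UpRows _ 36] by simp
  next
    case (Suc r)
    then have r: "r < m" "Suc r < N" using assms(3) by simp_all
    define q where "q = i + r * Suc n"
    have q: "is_row n q" "\<forall>a<n. \<forall>b<n. closed_at n j q a b"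
      using assms(4,5) r(1) by (simp_all add: q_def)
    have "lev 32 Succ [r, Suc r]" using lev_mono[OF lev_Succ[OF r(2)], of 32] by simp
    moreover have "lev 32 Row [n, q, q + Suc n]" using lev_mono[OF lev_Row[OF q(1)], of 32] by simp
    moreover have "lev 32 Up [n, j, q, n]" using assms(1) q by (rule lev_Up)
    moreover have "der (Suc r * N ^ 36) UpRows [n, j, r, i, q]" using Suc by (simp add: q_def)
    ultimately have "der (Suc (Suc r) * N ^ 36) UpRows [n, j, Suc r, i, q + Suc n]"
      using der_chain[of "(UpRows, [0, 1, 2, 3, 4])" "(UpRows, [0, 1, 5, 3, 6])"
          "[(Succ, [5, 2]), (Row, [0, 6, 4]), (Up, [0, 1, 6, 0])]" "[n, j, Suc r, i, q + Suc n, r, q]" "Suc r" 32]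
        less r assms(2) is_row_less[OF q(1)]
      by (simp add: rule_simps)
    moreover have "q + Suc n = i + Suc r * Suc n" by (simp add: q_def)
    ultimately show ?case by (simp only:)
  qed
  from lev_chain[OF this[OF order_refl]] show ?thesis using assms(3) by (simp del: mult_Suc_right)
qed

lemma lev_Irr:
  assumes "matrix n j" "\<forall>a<n. (a, a) \<notin> entries n j"
  shows "lev 27 Irr [n, j, n]"
proof -
  have less: "n < N" "j < N" using matrix_less[OF assms(1)] by simp_all
  have "a \<le> n \<Longrightarrow> der (Suc a * N ^ 26) Irr [n, j, a]" for a
  proof (induction a)
    case 0
    have "lev 8 Irr [n, j, 0]"
      using lev_rule[of "(Irr, [0, 1, 2])" "[(Zero, [2])]" "[n, j, 0]" 4] lev_Zero less
      by (simp add: rule_simps)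
    then show ?case using lev_mono[of 8 Irr _ 26] by simp
  next
    case (Suc a)
    then have a: "a < n" "Suc a < N" using less by simp_all
    have "lev 22 Succ [a, Suc a]" using lev_mono[OF lev_Succ[OF a(2)], of 22] by simp
    moreover have "lev 22 (Entry LZero) [n, j, a, a]"
      using assms a(1) by (intro lev_not_entry) auto
    ultimately show ?case
      using der_chain[of "(Irr, [0, 1, 3])" "(Irr, [0, 1, 2])"
          "[(Succ, [2, 3]), (Entry LZero, [0, 1, 2, 2])]" "[n, j, a, Suc a]" "Suc a" 22]
        Suc less a
      by (simp add: rule_simps)
  qed
  from lev_chain[OF this[OF order_refl]] show ?thesis using less by simp
qed

lemma lev_High:
  assumes "matrix n j" "a \<in> chains n j d" "d < N"
  shows "lev 27 High [n, j, a, d]"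
proof -
  have less: "n < N" "j < N" using matrix_less[OF assms(1)] by simp_all
  have "d < N \<Longrightarrow> a \<in> chains n j d \<Longrightarrow> der (Suc d * N ^ 26) High [n, j, a, d]" for a d
  proof (induction d arbitrary: a)
    case 0
    then have a: "a < n" by simp
    have "lev 13 Zero [0]" using lev_mono[OF lev_Zero] by simp
    then have "lev 17 High [n, j, a, 0]"
      using lev_rule[of "(High, [0, 1, 2, 3])" "[(Zero, [3]), (Lt, [2, 0])]" "[n, j, a, 0]" 13]
        lev_Lt[OF a] less a
      by (simp add: rule_simps)
    then show ?case using lev_mono[of 17 High _ 26] by simp
  next
    case (Suc d)
    then obtain b where b: "b \<in> chains n j d" "(a, b) \<in> entries n j" by auto
    have "a < n" "b < n" using b(2) by (auto simp: entries_def)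
    moreover have "lev 22 Succ [d, Suc d]" using lev_mono[OF lev_Succ, of d 22] Suc.prems by simp
    moreover have "der (Suc d * N ^ 26) High [n, j, b, d]" using Suc b by simp
    ultimately show ?case
      using der_chain[of "(High, [0, 1, 2, 4])" "(High, [0, 1, 5, 3])"
          "[(Succ, [3, 4]), (Entry LOne, [0, 1, 2, 5])]" "[n, j, a, d, Suc d, b]" "Suc d" 22]
        Suc.prems(1) less lev_entry[OF assms(1) b(2)]
      by (simp add: rule_simps)
  qed
  from lev_chain[OF this[OF assms(3,2)]] show ?thesis using assms(3) by simp
qed

lemma card_below: "card {b \<in> C. b < (k :: nat) \<and> Q b} \<le> k"
proof -
  have "card {b \<in> C. b < k \<and> Q b} \<le> card {..<k}" by (rule card_mono) auto
  then show ?thesis by simp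
qed

lemma lev_Avoid:
  assumes "matrix n j" "a < n" "d < N"
  shows "lev 32 Avoid [n, j, d, a, n, card {b \<in> chains n j d. b < n \<and> (a, b) \<notin> entries n j}]"
proof -
  have less: "n < N" "j < N" using matrix_less[OF assms(1)] by simp_all
  define f where "f k = card {b \<in> chains n j d. b < k \<and> (a, b) \<notin> entries n j}" for k
  have f: "f (Suc k) = f k + (if k \<in> chains n j d \<and> (a, k) \<notin> entries n j then 1 else 0)" for k
    unfolding f_def by (rule card_less_Suc[OF chains_finite])
  have f_le: "f k \<le> k" for k unfolding f_def by (rule card_below)
  have "k \<le> n \<Longrightarrow> der (Suc k * N ^ 31) Avoid [n, j, d, a, k, f k]" for k
  proof (induction k)
    case 0
    have "lev 8 Avoid [n, j, d, a, 0, 0]"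
      using lev_rule[of "(Avoid, [0, 1, 2, 3, 4, 4])" "[(Zero, [4])]" "[n, j, d, a, 0]" 4] lev_Zero less assms(2,3)
      by (simp add: rule_simps)
    then show ?case using lev_mono[of 8 Avoid _ 31] by (simp add: f_def)
  next
    case (Suc k)
    then have k: "k < n" "Suc k < N" using less by simp_all
    have fk: "f k < N" "Suc (f k) < N" using f_le[of k] k by simp_all
    have succ: "lev 27 Succ [k, Suc k]" "lev 27 Succ [f k, Suc (f k)]"
      using lev_mono[OF lev_Succ, of _ 27] k fk by simp_all
    have IH: "der (Suc k * N ^ 31) Avoid [n, j, d, a, k, f k]" using Suc by simp
    show ?case
    proof (cases "k \<in> chains n j d \<and> (a, k) \<notin> entries n j")
      case True
      have "lev 27 High [n, j, k, d]" using lev_High assms True by blast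
      moreover have "lev 27 (Entry LZero) [n, j, a, k]"
        using lev_mono[OF lev_not_entry[OF assms(1,2) k(1)], of 27] True by simp
      ultimately show ?thesis
        using der_chain[of "(Avoid, [0, 1, 2, 3, 6, 7])" "(Avoid, [0, 1, 2, 3, 4, 5])"
            "[(Succ, [4, 6]), (Succ, [5, 7]), (High, [0, 1, 4, 2]), (Entry LZero, [0, 1, 3, 4])]"
            "[n, j, d, a, k, f k, Suc k, Suc (f k)]" "Suc k" 27]
          succ IH less assms(2,3) k fk True f[of k]
        by (simp add: rule_simps)
    next
      case False
      then have "f (Suc k) = f k" using f[of k] by simp
      then show ?thesis
        using der_chain[of "(Avoid, [0, 1, 2, 3, 6, 5])" "(Avoid, [0, 1, 2, 3, 4, 5])"
            "[(Succ, [4, 6])]" "[n, j, d, a, k, f k, Suc k]" "Suc k" 27]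
          succ IH less assms(2,3) k fk
        by (simp add: rule_simps)
    qed
  qed
  from lev_chain[OF this[OF order_refl]] show ?thesis using less by (simp add: f_def)
qed

text \<open>The derivation of \<open>Count\<close> for d, of cost k, occurs only once, at the start
  of the chain. Every further world adds one unit \<open>N ^ 36\<close>, as its certificate
  \<open>High\<close> or \<open>Avoid\<close> contains no count derivation.\<close>

lemma der_CountTo:
  assumes "matrix n j" "Suc d < N" and c: "c = card (chains n j d)"
    and "der (k * N ^ 36) Count [n, j, d, c]" "a \<le> n"
  shows "der ((Suc k + a) * N ^ 36) CountTo [n, j, d, c, a, card {b \<in> chains n j (Suc d). b < a}]"
  using assms(5)
proof (induction a)
  have less: "n < N" "j < N" using matrix_less[OF assms(1)] by simp_all
  have "chains n j d \<subseteq> {..<n}" using chains_less by auto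
  then have "c \<le> n" unfolding c using card_mono[of "{..<n}" "chains n j d"] by simp
  then have cN: "c < N" using less by simp
  {
    case 0
    have "lev 32 Zero [0]" using lev_mono[OF lev_Zero] by simp
    then show ?case
      using der_chain[of "(CountTo, [0, 1, 2, 3, 4, 4])" "(Count, [0, 1, 2, 3])" "[(Zero, [4])]"
          "[n, j, d, c, 0]" k 32] assms(2,4) less cN
      by (simp add: rule_simps)
  next
    case (Suc a)
    define f where "f a = card {b \<in> chains n j (Suc d). b < a}" for a
    have f: "f (Suc a) = f a + (if a \<in> chains n j (Suc d) then 1 else 0)"
      using card_less_Suc[OF chains_finite, of n j "Suc d" a "\<lambda>_. True"] by (simp add: f_def)
    have f_le: "f a \<le> a" using card_below[of "chains n j (Suc d)" a "\<lambda>_. True"] by (simp add: f_def)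
    have a: "a < n" "Suc a < N" "f a < N" "Suc (f a) < N" using Suc.prems less f_le by simp_all
    have succ: "lev 32 Succ [a, Suc a]" "lev 32 Succ [f a, Suc (f a)]" "lev 32 Succ [d, Suc d]"
      using lev_mono[OF lev_Succ, of _ 32] a assms(2) by simp_all
    have IH: "der ((Suc k + a) * N ^ 36) CountTo [n, j, d, c, a, f a]" using Suc by (simp add: f_def)
    have "der (Suc (Suc k + a) * N ^ 36) CountTo [n, j, d, c, Suc a, f (Suc a)]"
    proof (cases "a \<in> chains n j (Suc d)")
      case True
      have "lev 32 High [n, j, a, Suc d]"
        using lev_mono[OF lev_High[OF assms(1) True assms(2)]] by simp
      then show ?thesis
        using der_chain[of "(CountTo, [0, 1, 2, 3, 6, 7])" "(CountTo, [0, 1, 2, 3, 4, 5])"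
            "[(Succ, [4, 6]), (Succ, [5, 7]), (Succ, [2, 8]), (High, [0, 1, 4, 8])]"
            "[n, j, d, c, a, f a, Suc a, Suc (f a), Suc d]" "Suc k + a" 32]
          succ IH less assms(2) a cN f True
        by (simp add: rule_simps del: high.simps)
    next
      case False
      then have "{b \<in> chains n j d. b < n \<and> (a, b) \<notin> entries n j} = chains n j d"
        using chains_less by auto
      then have "lev 32 Avoid [n, j, d, a, n, c]"
        using lev_Avoid[OF assms(1) a(1), of d] assms(2) by (simp add: c)
      moreover have "f (Suc a) = f a" using f False by simp
      ultimately show ?thesis
        using der_chain[of "(CountTo, [0, 1, 2, 3, 6, 5])" "(CountTo, [0, 1, 2, 3, 4, 5])"
            "[(Succ, [4, 6]), (Avoid, [0, 1, 2, 4, 0, 3])]" "[n, j, d, c, a, f a, Suc a]" "Suc k + a" 32]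
          succ IH less assms(2) a cN
        by (simp add: rule_simps)
    qed
    then show ?case by (simp add: f_def)
  }
qed

text \<open>Passing from d to \<open>Suc d\<close> costs n + 2 units: one to start
  \<open>CountTo\<close>, one for each world, and one to return to \<open>Count\<close>. With d < N
  and n + 2 at most N^2, the number of units is at most N^3, whence 39 = 36 + 3.\<close>

lemma lev_Count:
  assumes "matrix n j" "d < N"
  shows "lev 39 Count [n, j, d, card (chains n j d)]"
proof -
  have less: "n < N" "j < N" using matrix_less[OF assms(1)] by simp_all
  have "d < N \<Longrightarrow> der ((d * (n + 2) + 1) * N ^ 36) Count [n, j, d, card (chains n j d)]" for d
  proof (induction d)
    case 0
    have "lev 8 Count [n, j, 0, n]"
      using lev_rule[of "(Count, [0, 1, 2, 0])" "[(Zero, [2])]" "[n, j, 0]" 4] lev_Zero less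
      by (simp add: rule_simps)
    then show ?case using lev_mono[of 8 Count _ 36] by simp
  next
    case (Suc d)
    define k where "k = d * (n + 2) + 1"
    define c where "c = card (chains n j d)"
    define c' where "c' = card (chains n j (Suc d))"
    have c: "c < N" "c' < N"
      using card_mono[of "{..<n}" "chains n j d"] card_mono[of "{..<n}" "chains n j (Suc d)"]
        chains_less less
      by (auto simp: c_def c'_def subset_iff simp del: high.simps intro: le_less_trans)
    have "{b \<in> chains n j (Suc d). b < n} = chains n j (Suc d)"
      using chains_less[of _ n j "Suc d"] by (auto simp del: high.simps)
    then have "der ((Suc k + n) * N ^ 36) CountTo [n, j, d, c, n, c']"
      using der_CountTo[OF assms(1) Suc.prems c_def, of k n] Suc by (simp add: k_def c_def c'_def del: high.simps)
    moreover have "lev 32 Succ [d, Suc d]"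
      using lev_mono[OF lev_Succ, of d 32] Suc.prems by simp
    ultimately have "der (Suc (Suc k + n) * N ^ 36) Count [n, j, Suc d, c']"
      using der_chain[of "(Count, [0, 1, 4, 3])" "(CountTo, [0, 1, 2, 5, 0, 3])" "[(Succ, [2, 4])]"
          "[n, j, d, c', Suc d, c]" "Suc k + n" 32] less c Suc.prems
      by (simp add: rule_simps)
    moreover have "Suc (Suc k + n) = Suc d * (n + 2) + 1" by (simp add: k_def)
    ultimately show ?case by (simp only: c'_def)
  qed
  from this[OF assms(2)] show ?thesis
  proof (rule der_mono)
    have "n + 2 \<le> 2 * N" using less by simp
    also have "2 * N \<le> N * N" using N_ge_2 by (rule mult_right_mono) simp
    finally have "d * (n + 2) \<le> d * (N * N)" by (rule mult_left_mono) simp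
    moreover have "1 \<le> N * N" using N by simp
    ultimately have "d * (n + 2) + 1 \<le> d * (N * N) + N * N" by (rule add_mono)
    also have "\<dots> = Suc d * (N * N)" by (simp only: mult_Suc add.commute)
    also have "\<dots> \<le> N * (N * N)" using assms(2) by (intro mult_right_mono) simp_all
    finally have "(d * (n + 2) + 1) * N ^ 36 \<le> N * (N * N) * N ^ 36" by (rule mult_right_mono) simp
    also have "\<dots> = N ^ 39" by (simp add: power_numeral_reduce)
    finally show "(d * (n + 2) + 1) * N ^ 36 \<le> N ^ 39" .
  qed
qed

text \<open>Nesting is unbounded, so raising the exponent with each connective would be too
  expensive. The cost is instead counted in units \<open>N ^ 17\<close>, one per letter; the 3 pays
  for two parentheses and the connective.\<close>

lemma der_connective:
  assumes "(\<sigma>, f) \<in> {(LAnd, Min), (LOr, Max), (LImp, Arrow)}"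
    and "letter_at i LOpen" "der (s * N ^ 17) Val [Suc i, k, p]" "letter_at k \<sigma>"
    and "der (t * N ^ 17) Val [Suc k, l, q]" "letter_at l LClose" "lev 13 f [p, q, r]"
    and "p < N" "q < N" "r < N"
  shows "der ((s + t + 3) * N ^ 17) Val [i, Suc l, r]"
proof -
  have bounds: "\<forall>v \<in> set [i, Suc l, r, Suc i, k, p, Suc k, l, q]. v < N"
    using letter_at_less[OF assms(2)] letter_at_less[OF assms(4)] letter_at_less[OF assms(6)] assms(8-10)
    by simp
  have edges: "der 1 (Edge (Input LOpen)) [i, Suc i]" "der 1 (Edge (Input \<sigma>)) [k, Suc k]"
    "der 1 (Edge (Input LClose)) [l, Suc l]"
    using der_Edge[of "Input LOpen" i "Suc i"] der_Edge[of "Input \<sigma>" k "Suc k"]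
      der_Edge[of "Input LClose" l "Suc l"] assms(2,4,6)
    by (simp_all add: holds_Edge)
  have rule: "((Val, [0, 1, 2]),
        [(Edge (Input LOpen), [0, 3]), (Val, [3, 4, 5]), (Edge (Input \<sigma>), [4, 6]),
         (Val, [6, 7, 8]), (Edge (Input LClose), [7, 1]), (f, [5, 8, 2])]) \<in> set mc_rules"
    using assms(1) by (auto simp: mc_rules_def formula_rules_def)
  have "der (Suc (sum_list [1, s * N ^ 17, 1, t * N ^ 17, 1, N ^ 13])) Val [i, Suc l, r]"
    using der_rule[OF rule bounds, of "[1, s * N ^ 17, 1, t * N ^ 17, 1, N ^ 13]"] edges assms(3,5,7)
    by (simp add: pick_def)
  moreover have "4 + N ^ 13 \<le> 3 * N ^ 17"
    using size_step[of 1 13] power_mono[OF N_ge_2, of 17] by simp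
  ultimately show ?thesis
    by (elim der_mono) (simp add: distrib_right)
qed

lemma rank_less: "rank (N - 1) \<phi> < N"
  using rank_le[of "N - 1" \<phi>] N by simp

lemma der_Val:
  assumes "vars \<phi> = {}" "seg i j (enc_form \<phi>)"
  shows "der (length (enc_form \<phi>) * N ^ 17) Val [i, j, rank (N - 1) \<phi>]"
  using assms
proof (induction \<phi> arbitrary: i j)
  case Bot
  then have "j = Suc i" "letter_at i LBot" by (simp_all add: seg_single)
  moreover have "lev 4 (Edge (Input LBot)) [i, Suc i]" if "letter_at i LBot"
    using that by (intro lev_Edge) (simp add: holds_Edge)
  ultimately have "lev 8 Val [i, j, 0]"
    using lev_rule[of "(Val, [0, 1, 2])" "[(Edge (Input LBot), [0, 1]), (Zero, [2])]" "[i, j, 0]" 4]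
      lev_Zero letter_at_less[of i LBot]
    by (simp add: rule_simps)
  then show ?case using lev_mono[of 8 Val _ 17] by simp
next
  case (Var p)
  then show ?case by simp
next
  case (Conj \<phi> \<psi>)
  then obtain k l where "letter_at i LOpen" "seg (Suc i) k (enc_form \<phi>)" "letter_at k LAnd"
    "seg (Suc k) l (enc_form \<psi>)" "letter_at l LClose" "j = Suc l"
    by (auto simp: seg_append seg_Cons seg_Nil)
  moreover have "lev 13 Min [rank (N - 1) \<phi>, rank (N - 1) \<psi>, rank (N - 1) (Conj \<phi> \<psi>)]"
    using lev_Min[OF rank_less rank_less] by simp
  moreover have "vars \<phi> = {}" "vars \<psi> = {}" using Conj.prems by simp_all
  ultimately have "der ((length (enc_form \<phi>) + length (enc_form \<psi>) + 3) * N ^ 17)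
      Val [i, j, rank (N - 1) (Conj \<phi> \<psi>)]"
    using der_connective[of LAnd Min i "length (enc_form \<phi>)" k "rank (N - 1) \<phi>" "length (enc_form \<psi>)"
        l "rank (N - 1) \<psi>" "rank (N - 1) (Conj \<phi> \<psi>)"] Conj.IH
      rank_less[of \<phi>] rank_less[of \<psi>] rank_less[of "Conj \<phi> \<psi>"] by simp
  then show ?case by (simp add: numeral_3_eq_3 del: rank.simps)
next
  case (Disj \<phi> \<psi>)
  then obtain k l where "letter_at i LOpen" "seg (Suc i) k (enc_form \<phi>)" "letter_at k LOr"
    "seg (Suc k) l (enc_form \<psi>)" "letter_at l LClose" "j = Suc l"
    by (auto simp: seg_append seg_Cons seg_Nil)
  moreover have "lev 13 Max [rank (N - 1) \<phi>, rank (N - 1) \<psi>, rank (N - 1) (Disj \<phi> \<psi>)]"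
    using lev_Max[OF rank_less rank_less] by simp
  moreover have "vars \<phi> = {}" "vars \<psi> = {}" using Disj.prems by simp_all
  ultimately have "der ((length (enc_form \<phi>) + length (enc_form \<psi>) + 3) * N ^ 17)
      Val [i, j, rank (N - 1) (Disj \<phi> \<psi>)]"
    using der_connective[of LOr Max i "length (enc_form \<phi>)" k "rank (N - 1) \<phi>" "length (enc_form \<psi>)"
        l "rank (N - 1) \<psi>" "rank (N - 1) (Disj \<phi> \<psi>)"] Disj.IH
      rank_less[of \<phi>] rank_less[of \<psi>] rank_less[of "Disj \<phi> \<psi>"] by simp
  then show ?case by (simp add: numeral_3_eq_3 del: rank.simps)
next
  case (Imp \<phi> \<psi>)
  then obtain k l where "letter_at i LOpen" "seg (Suc i) k (enc_form \<phi>)" "letter_at k LImp"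
    "seg (Suc k) l (enc_form \<psi>)" "letter_at l LClose" "j = Suc l"
    by (auto simp: seg_append seg_Cons seg_Nil)
  moreover have "lev 13 Arrow [rank (N - 1) \<phi>, rank (N - 1) \<psi>, rank (N - 1) (Imp \<phi> \<psi>)]"
    using lev_Arrow[OF rank_less[of \<phi>] rank_less[of \<psi>]] by (simp only: rank.simps)
  moreover have "vars \<phi> = {}" "vars \<psi> = {}" using Imp.prems by simp_all
  ultimately have "der ((length (enc_form \<phi>) + length (enc_form \<psi>) + 3) * N ^ 17)
      Val [i, j, rank (N - 1) (Imp \<phi> \<psi>)]"
    using der_connective[of LImp Arrow i "length (enc_form \<phi>)" k "rank (N - 1) \<phi>" "length (enc_form \<psi>)"
        l "rank (N - 1) \<psi>" "rank (N - 1) (Imp \<phi> \<psi>)"] Imp.IH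
      rank_less[of \<phi>] rank_less[of \<psi>] rank_less[of "Imp \<phi> \<psi>"] by simp
  then show ?case by (simp add: numeral_3_eq_3 del: rank.simps)
qed

lemma lev_Val:
  assumes "vars \<phi> = {}" "seg i j (enc_form \<phi>)"
  shows "lev 18 Val [i, j, rank (N - 1) \<phi>]"
  using lev_chain[OF der_Val[OF assms]] assms(2) N by (simp add: seg_def)

text \<open>All premises are brought to level 39, the level of \<open>Count\<close>; the goal rule
  adds 4.\<close>

lemma lev_Goal:
  assumes "x \<in> model_checking FPL0"
  shows "lev 43 Goal []"
proof -
  obtain \<phi> n m M s where x: "x = enc_instance \<phi> n m M s" and \<phi>: "vars \<phi> = {}" and M: "FPL_model M"
    "worlds M = {..<n}" and s: "s < n" and sat: "sat M s \<phi>"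
    using assms by (auto simp: model_checking_def FPL0_def)
  have "seg 0 (length x) (enc_instance \<phi> n m M s)"
    unfolding seg_whole by (rule x)
  then obtain i k l where segs: "seg 0 i (enc_form \<phi>)" "letter_at i LHash"
    "seg (Suc i) k (concat (map (\<lambda>a. enc_row n {b. (a, b) \<in> acc M}) [0..<n]))" "letter_at k LHash"
    "seg (Suc k) l (concat (map (\<lambda>p. enc_row n (val M p)) [0..<m]))" "letter_at l LHash"
    "seg (Suc l) (length x) (replicate s LOne)"
    unfolding enc_instance_def seg_append seg_single by (elim exE conjE) simp
  define j where "j = Suc i"
  have acc: "k = j + n * Suc n" "\<And>r. r < n \<Longrightarrow> is_row n (j + r * Suc n)"
    "\<And>r b. r < n \<Longrightarrow> b < n \<Longrightarrow> letter_at (j + r * Suc n + b) LOne \<longleftrightarrow> (r, b) \<in> acc M"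
    using segs(3) unfolding seg_rows[OF letter_at_le[OF segs(2)]] j_def mem_Collect_eq by blast+
  have val: "l = Suc k + m * Suc n" "\<And>r. r < m \<Longrightarrow> is_row n (Suc k + r * Suc n)"
    "\<And>r b. r < m \<Longrightarrow> b < n \<Longrightarrow> letter_at (Suc k + r * Suc n + b) LOne \<longleftrightarrow> b \<in> val M r"
    using segs(5) unfolding seg_rows[OF letter_at_le[OF segs(4)]] by blast+
  have ones: "length x = Suc l + s" "\<forall>t<s. letter_at (Suc l + t) LOne"
    using segs(7) unfolding seg_ones[OF letter_at_le[OF segs(6)]] by simp_all
  have mat: "matrix n j" using s acc(2) by (simp add: matrix_def)
  have M_acc: "acc M \<subseteq> {..<n} \<times> {..<n}" "trans (acc M)" "irrefl (acc M)"
    and M_val: "\<And>p a b. a \<in> val M p \<Longrightarrow> (a, b) \<in> acc M \<Longrightarrow> b \<in> val M p"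
    using M(1) unfolding FPL_model_def M(2) by blast+
  have entries: "entries n j = acc M"
  proof (intro set_eqI)
    fix p :: "nat \<times> nat"
    obtain a b where p: "p = (a, b)" by (cases p)
    show "p \<in> entries n j \<longleftrightarrow> p \<in> acc M"
      using acc(3)[of a b] M_acc(1) unfolding p entries_def by blast
  qed
  have "closed_at n j (j + r * Suc n) a b" if "r < n" "a < n" "b < n" for r a b
    unfolding closed_at_def entries acc(3)[OF that(1,2)] acc(3)[OF that(1,3)]
    using transD[OF M_acc(2), of r a b] by blast
  then have acc_rows: "lev 39 UpRows [n, j, n, j, k]"
    using lev_mono[OF lev_UpRows[OF mat, of j n]] acc matrix_less[OF mat] by simp
  \<comment> \<open>Each valuation row occupies at least one letter, so m is a number below
    N.\<close>
  have "m \<le> m * Suc n" by simp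
  then have "m < N" "Suc k < N" using val(1) letter_at_less[OF segs(6)] by linarith+
  moreover have "closed_at n j (Suc k + r * Suc n) a b" if "r < m" "a < n" "b < n" for r a b
    unfolding closed_at_def entries val(3)[OF that(1,2)] val(3)[OF that(1,3)]
    using M_val[of a r b] by blast
  ultimately have val_rows: "lev 39 UpRows [n, j, m, Suc k, l]"
    using lev_mono[OF lev_UpRows[OF mat, of "Suc k" m]] val by simp
  have irr: "lev 39 Irr [n, j, n]"
    using lev_mono[OF lev_Irr[OF mat]] M_acc(3) by (simp add: entries irrefl_def)
  have "letter_at (j + n) LSemi" using acc(2)[of 0] s by (simp add: is_row_def)
  then have "n \<le> N - 1" using letter_at_less[of "j + n" LSemi] by simp
  then have not_high: "s \<notin> chains n j (rank (N - 1) \<phi>)"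
    using sat_iff_rank[OF M(1) _ \<phi>, of "N - 1" s] sat s M(2) entries by simp
  \<comment> \<open>Rank 0 is excluded because \<open>chains n j 0\<close> contains every
    world.\<close>
  then obtain d where d: "rank (N - 1) \<phi> = Suc d"
    using s by (cases "rank (N - 1) \<phi>") auto
  have dN: "Suc d < N" using rank_less[of \<phi>] unfolding d .
  define c where "c = card (chains n j d)"
  \<comment> \<open>A successor of s in \<open>chains n j d\<close> would put s into
    \<open>chains n j (Suc d)\<close>, so the avoidance count reaches the full c.\<close>
  have "{b \<in> chains n j d. b < n \<and> (s, b) \<notin> entries n j} = chains n j d"
    using not_high chains_less unfolding d by auto
  then have avoid: "lev 39 Avoid [n, j, d, s, n, c]"
    using lev_mono[OF lev_Avoid[OF mat s, of d]] dN by (simp add: c_def)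
  have count: "lev 39 Count [n, j, d, c]"
    using lev_Count[OF mat, of d] dN by (simp add: c_def)
  have "chains n j d \<subseteq> {..<n}" using chains_less by auto
  then have "c \<le> n" unfolding c_def using card_mono[of "{..<n}" "chains n j d"] by simp
  then have cN: "c < N" using matrix_less[OF mat] by simp
  have val_\<phi>: "lev 39 Val [0, i, Suc d]"
    using lev_mono[OF lev_Val[OF \<phi> segs(1)], of 39] unfolding d by simp
  have hash: "lev 39 (Edge (Input LHash)) [i, j]" "lev 39 (Edge (Input LHash)) [k, Suc k]"
    "lev 39 (Edge (Input LHash)) [l, Suc l]" "lev 39 (Edge RightEnd) [length x, Suc (length x)]"
    using segs N by (auto intro!: lev_Edge simp: holds_Edge j_def)
  have rest: "lev 39 Zero [0]" "lev 39 Ones [Suc l, s, length x]" "lev 39 Lt [s, n]" "lev 39 Succ [d, Suc d]"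
    using lev_mono[OF lev_Zero] lev_mono[OF lev_Ones[OF ones(2)]] lev_mono[OF lev_Lt[OF s]]
      lev_mono[OF lev_Succ[OF dN]] ones(1) N matrix_less[OF mat]
    by simp_all
  have bounds: "\<forall>v \<in> set [0, i, Suc d, j, n, k, Suc k, m, l, Suc l, s, length x, Suc (length x), d, c]. v < N"
    using letter_at_less[OF segs(2)] letter_at_less[OF segs(4)] letter_at_less[OF segs(6)]
      dN cN N s matrix_less[OF mat] \<open>m < N\<close> by simp
  show ?thesis
    using lev_rule[OF _ bounds, of "(Goal, [])"
      "[(Zero, [0]), (Val, [0, 1, 2]), (Edge (Input LHash), [1, 3]),
         (UpRows, [4, 3, 4, 3, 5]), (Edge (Input LHash), [5, 6]),
         (UpRows, [4, 3, 7, 6, 8]), (Edge (Input LHash), [8, 9]),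
         (Ones, [9, 10, 11]), (Edge RightEnd, [11, 12]), (Lt, [10, 4]), (Irr, [4, 3, 4]),
         (Count, [4, 3, 13, 14]), (Avoid, [4, 3, 13, 10, 4, 14]), (Succ, [13, 2])]" 39]
      acc_rows val_rows irr avoid count val_\<phi> hash rest
    by (simp add: rule_simps)
qed

end

theorem theorem3p7: "model_checking FPL0 \<in> LOGCFL"
proof (rule proves_LOGCFL)
  fix x :: "letter list"
  let ?N = "2 ^ bitlength (Suc (length x)) :: nat"
  interpret mc_input x ?N
    by unfold_locales (rule less_bitlength)
  show "proves mc_rules Edge x ?N t [(Goal, [])] \<Longrightarrow> x \<in> model_checking FPL0" for t
    using proves_holds by fastforce
  show "x \<in> model_checking FPL0 \<Longrightarrow> \<exists>t\<le>?N ^ 43. proves mc_rules Edge x ?N t [(Goal, [])]"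
    using lev_Goal unfolding der_def .
qed

end
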